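(* Let $K$ be a real Hilbert space with $\dim K>1$, let $\mathscr G(K)$ be its Grassmann manifold, and let $\mathbf T(\mathscr G(K))$ be the tangent bundle of $\mathscr G(K)$, whose elements are identified with pairs $(E,T)$ with $E\in\mathscr G(K)$ and $T\in\mathcal L(E,E^\perp)$. Let $\mathcal I(K)$ be the set of idempotents in $\mathcal L(K)\setminus\{0,I\}$, with the Banach submanifold structure induced from $\mathcal L(K)$. (a) The assignment $Q\mapsto\big(Q(K),\ \bar P_{Q(K)^\perp}\circ Q^*|_{Q(K)}\big)$ is a (real) bi-analytic bijection from $\mathcal I(K)$ onto $\mathbf T(\mathscr G(K))$ such that, for each $E\in\mathscr G(K)$, it restricts to an affine map from $\{Q\in\mathcal I(K):Q(K)=E\}$ onto the tangent space $\mathcal L(E,E^\perp)$ at $E$. (b) The assignment $(E,T)\mapsto(E,T\circ\bar P_E)$ is a fiberwise linear bi-analytic map from $\mathbf T(\mathscr G(K))$ onto the Banach subbundle $\{(E,S):E\in\mathscr G(K),\ S\in\mathcal L^{E^\perp}(K,E^\perp)\}$ of the trivial Banach bundle $(\mathscr G(K)\times\mathcal L(K),\mathscr G(K),\kappa_0)$.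
   Context: $\mathcal L(X,Y)$ denotes bounded real-linear operators, $\mathcal L(K)=\mathcal L(K,K)$, and $I$ is the identity. $\mathscr G(K)$ is the set of all non-zero proper closed subspaces of $K$ (all are complemented). For $F\in\mathscr G(K)$, $\mathcal C_F$ is the set of closed complements of $F$. For $E\in\mathcal C_F$ the map $q_{E,F}:\mathcal L(E,F)\to\mathcal C_F$, $q_{E,F}(T)=(I+T)(E)$, is a bijection with inverse $p_{E,F}$. $\mathscr G(K)$ has a Hausdorff metrizable topology in which each $\mathcal C_F$ is open and each $p_{E,F}$ is a homeomorphism, and the charts $(\mathcal C_F,p_{E,F},\mathcal L(E,F))$ form a real analytic atlas. The tangent space of $\mathscr G(K)$ at $E$ is identified with $\mathcal L(E,E^\perp)$ through the derivative at $E$ of the chart $p_{E,E^\perp}$, so that $\mathbf T(\mathscr G(K))=\biguplus_{E\in\mathscr G(K)}\mathcal L(E,E^\perp)$ with its usual analytic Banach manifold (tangent bundle) structure. $\mathcal I(K)=\{Q\in\mathcal L(K)\setminus\{0,I\}:Q^2=Q\}$ is a real analytic Banach submanifold of $\mathcal L(K)$, and $\{Q\in\mathcal I(K):Q(K)=E\}$ is a closed affine subspace of $\mathcal L(K)$. $E^\perp$ is the orthogonal complement of $E$, $\bar P_E:K\to E$ is the orthogonal projection regarded as a map onto $E$, and $Q^*$ is the Hilbert space adjoint. $\kappa_0:\mathscr G(K)\times\mathcal L(K)\to\mathscr G(K)$ is the projection onto the first coordinate. For a closed subspace $F\subseteq K$, $\mathcal L^F(K,F):=\{S\in\mathcal L(K):S(F)=\{0\},\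 S(K)\subseteq F\}$; in (b), $T\circ\bar P_E$ is viewed as an element of $\mathcal L(K)$ via $E^\perp\subseteq K$. *)

theory Defs
  imports "HOL-Analysis.Analysis"
begin

section \<open>Real analytic maps between Banach spaces\<close>

text \<open>
  The Banach spaces used as local models are closed linear subspaces \<open>V\<close> of a Banach space
  type, so that \<open>\<L>(E,F)\<close> may vary with \<open>E\<close> and \<open>F\<close> without leaving a single type.
\<close>

definition banach_model :: "'a::banach set \<Rightarrow> bool" where
  "banach_model V \<longleftrightarrow> subspace V \<and> closed V"

text \<open>
  Local expansion \<open>f (x + h) = (\<Sum>n. A\<^sub>n (h, \<dots>, h))\<close> for small \<open>h \<in> V\<close>, with bounded
  \<open>n\<close>-linear maps \<open>A\<^sub>n\<close> on \<open>V\<close> and a positive radius of (normal) convergence.  The family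
  \<open>A\<^sub>n\<close> is one function on lists; \<open>A\<^sub>n\<close> is its restriction to lists of length \<open>n\<close>.
\<close>

definition analytic_at_in ::
    "'a::real_normed_vector set \<Rightarrow> ('a \<Rightarrow> 'b::real_normed_vector) \<Rightarrow> 'a \<Rightarrow> bool" where
  "analytic_at_in V f x \<longleftrightarrow>
    (\<exists>(A :: 'a list \<Rightarrow> 'b) (C :: nat \<Rightarrow> real) (r :: real). r > 0 \<and>
      (\<forall>xs ys. \<forall>u\<in>V. \<forall>v\<in>V. \<forall>a b. set xs \<subseteq> V \<and> set ys \<subseteq> V \<longrightarrow>
         A (xs @ (a *\<^sub>R u + b *\<^sub>R v) # ys) = a *\<^sub>R A (xs @ u # ys) + b *\<^sub>R A (xs @ v # ys)) \<and>
      (\<forall>xs. set xs \<subseteq> V \<longrightarrow> norm (A xs) \<le> C (length xs) * prod_list (map norm xs)) \<and>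
      summable (\<lambda>n. C n * r ^ n) \<and>
      (\<forall>h\<in>V. norm h < r \<longrightarrow> (\<lambda>n. A (replicate n h)) sums f (x + h)))"

definition analytic_on_in ::
    "'a::real_normed_vector set \<Rightarrow> 'a set \<Rightarrow> ('a \<Rightarrow> 'b::real_normed_vector) \<Rightarrow> bool" where
  "analytic_on_in V U f \<longleftrightarrow>
    openin (top_of_set V) U \<and> (\<forall>x\<in>U. analytic_at_in V f x)"


section \<open>Real analytic Banach manifolds\<close>

text \<open>A chart is a triple of its domain, the coordinate map, and the model space.\<close>

type_synonym ('p, 'm) chart = "'p set \<times> ('p \<Rightarrow> 'm) \<times> 'm set"

definition is_chart :: "('p, 'm::banach) chart \<Rightarrow> bool" where
  "is_chart = (\<lambda>(U, \<phi>, V).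
     banach_model V \<and> inj_on \<phi> U \<and> openin (top_of_set V) (\<phi> ` U))"

definition chart_compatible ::
    "('p, 'm::banach) chart \<Rightarrow> ('p, 'n::banach) chart \<Rightarrow> bool" where
  "chart_compatible = (\<lambda>(U, \<phi>, V) (W, \<psi>, Z).
     analytic_on_in V (\<phi> ` (U \<inter> W)) (\<psi> \<circ> inv_into U \<phi>) \<and>
     analytic_on_in Z (\<psi> ` (U \<inter> W)) (\<phi> \<circ> inv_into W \<psi>))"

definition max_atlas :: "('p, 'm::banach) chart set \<Rightarrow> ('p, 'm) chart set" where
  "max_atlas \<A> = {c. is_chart c \<and> fst c \<subseteq> \<Union> (fst ` \<A>) \<and> (\<forall>d\<in>\<A>. chart_compatible c d)}"

text \<open>
  The topology of a manifold is the one for which the charts are homeomorphisms between open sets.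
\<close>

definition mopen :: "('p, 'm::banach) chart set \<Rightarrow> 'p set \<Rightarrow> bool" where
  "mopen \<A> O' \<longleftrightarrow> O' \<subseteq> \<Union> (fst ` \<A>) \<and>
     (\<forall>(U, \<phi>, V)\<in>\<A>. openin (top_of_set V) (\<phi> ` (U \<inter> O')))"

text \<open>
  \<open>M\<close> and \<open>N\<close> are the underlying sets, or open subsets of them.  Each point of \<open>M\<close> is required
  to lie in a chart, as is its image; openness of the coordinate domain encodes continuity.
\<close>

definition analytic_map ::
    "'p set \<Rightarrow> ('p, 'm::banach) chart set \<Rightarrow> 'q set \<Rightarrow> ('q, 'n::banach) chart set
      \<Rightarrow> ('p \<Rightarrow> 'q) \<Rightarrow> bool" where
  "analytic_map M \<A> N \<B> f \<longleftrightarrow> f ` M \<subseteq> N \<and>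
     (\<forall>p\<in>M. \<exists>(U, \<phi>, V)\<in>\<A>. \<exists>(W, \<psi>, Z)\<in>\<B>. p \<in> U \<and> f p \<in> W \<and>
        analytic_on_in V (\<phi> ` (U \<inter> M \<inter> f -` W)) (\<psi> \<circ> f \<circ> inv_into U \<phi>))"

definition bianalytic ::
    "'p set \<Rightarrow> ('p, 'm::banach) chart set \<Rightarrow> 'q set \<Rightarrow> ('q, 'n::banach) chart set
      \<Rightarrow> ('p \<Rightarrow> 'q) \<Rightarrow> bool" where
  "bianalytic M \<A> N \<B> f \<longleftrightarrow> bij_betw f M N \<and>
     analytic_map M \<A> N \<B> f \<and> analytic_map N \<B> M \<A> (inv_into M f)"

definition flat_atlas :: "('a::banach, 'a) chart set" where
  "flat_atlas = {(UNIV, id, UNIV)}"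

definition prod_atlas ::
    "('p, 'm::banach) chart set \<Rightarrow> ('q, 'n::banach) chart set \<Rightarrow> ('p \<times> 'q, 'm \<times> 'n) chart set" where
  "prod_atlas \<A> \<B> =
     {(U \<times> W, map_prod \<phi> \<psi>, V \<times> Z) |U \<phi> V W \<psi> Z. (U, \<phi>, V) \<in> \<A> \<and> (W, \<psi>, Z) \<in> \<B>}"

definition closed_complements_in :: "'a::real_normed_vector set \<Rightarrow> 'a set \<Rightarrow> 'a set set" where
  "closed_complements_in V F =
     {E. subspace E \<and> closed E \<and> E \<inter> F = {0} \<and> {x + y |x y. x \<in> E \<and> y \<in> F} = V}"

text \<open>
  Induced structure on a (split) submanifold \<open>S\<close>: restrictions to \<open>S\<close> of those charts of the
  ambient manifold that carry \<open>S\<close> to a complemented closed subspace \<open>Y\<close> of the model space.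
\<close>

definition submanifold_atlas ::
    "('p, 'm::banach) chart set \<Rightarrow> 'p set \<Rightarrow> ('p, 'm) chart set" where
  "submanifold_atlas \<A> S =
     {(U \<inter> S, \<phi>, Y) |U \<phi> V Y. (U, \<phi>, V) \<in> max_atlas \<A> \<and>
        banach_model Y \<and> closed_complements_in V Y \<noteq> {} \<and> \<phi> ` (U \<inter> S) = \<phi> ` U \<inter> Y}"

text \<open>
  Subbundles \<open>B\<close> of the trivial bundle \<open>M \<times> 'b\<close> with projection \<open>fst\<close>: over a neighbourhood
  \<open>O'\<close> of each base point there is a local trivialization \<open>\<tau>\<close> of the ambient bundle carrying all
  fibres of \<open>B\<close> to one complemented closed subspace \<open>Y\<close>.
\<close>

definition trivial_bundle_subbundle ::
    "'p set \<Rightarrow> ('p, 'm::banach) chart set \<Rightarrow> ('p \<times> 'b::banach) set \<Rightarrow> bool" where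
  "trivial_bundle_subbundle M \<A> B \<longleftrightarrow> B \<subseteq> M \<times> UNIV \<and>
     (\<forall>p\<in>M. \<exists>O' (\<tau> :: 'p \<Rightarrow> 'b \<Rightarrow> 'b) Y. p \<in> O' \<and> O' \<subseteq> M \<and> mopen \<A> O' \<and>
        banach_model Y \<and> closed_complements_in UNIV Y \<noteq> {} \<and>
        bianalytic (O' \<times> UNIV) (prod_atlas \<A> flat_atlas) (O' \<times> UNIV) (prod_atlas \<A> flat_atlas)
          (\<lambda>(e, s). (e, \<tau> e s)) \<and>
        (\<forall>e\<in>O'. linear (\<tau> e) \<and> \<tau> e ` {s. (e, s) \<in> B} = Y))"


section \<open>Operators between closed subspaces of a Hilbert space\<close>

text \<open>
  Elements of \<open>\<L>(E,F)\<close> are functions on \<open>E\<close>, made total by the value \<open>undefined\<close> off \<open>E\<close>.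
\<close>

definition bops :: "'k::real_normed_vector set \<Rightarrow> 'k set \<Rightarrow> ('k \<Rightarrow> 'k) set" where
  "bops E F = {T \<in> E \<rightarrow>\<^sub>E F.
     (\<forall>x\<in>E. \<forall>y\<in>E. T (x + y) = T x + T y) \<and>
     (\<forall>c. \<forall>x\<in>E. T (c *\<^sub>R x) = c *\<^sub>R T x) \<and>
     (\<exists>C. \<forall>x\<in>E. norm (T x) \<le> C * norm x)}"

definition bops_comb ::
    "'k::real_vector set \<Rightarrow> real \<Rightarrow> ('k \<Rightarrow> 'k) \<Rightarrow> real \<Rightarrow> ('k \<Rightarrow> 'k) \<Rightarrow> ('k \<Rightarrow> 'k)" where
  "bops_comb E a S b T = (\<lambda>x\<in>E. a *\<^sub>R S x + b *\<^sub>R T x)"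

definition orth_proj :: "'k::real_inner set \<Rightarrow> 'k \<Rightarrow> 'k" where
  "orth_proj E x = (THE y. y \<in> E \<and> x - y \<in> E\<^sup>\<bottom>)"

definition comp_proj :: "'k::{real_inner,banach} set \<Rightarrow> ('k \<Rightarrow> 'k) \<Rightarrow> ('k \<Rightarrow>\<^sub>L 'k)" where
  "comp_proj E T = Blinfun (T \<circ> orth_proj E)"

definition ops_vanishing :: "'k::real_normed_vector set \<Rightarrow> ('k \<Rightarrow>\<^sub>L 'k) set" where
  "ops_vanishing F = {S. blinfun_apply S ` F = {0} \<and> range (blinfun_apply S) \<subseteq> F}"


section \<open>The Grassmann manifold and its tangent bundle\<close>

definition grassmannian :: "'k::real_normed_vector set set" where
  "grassmannian = {E. subspace E \<and> closed E \<and> E \<noteq> {0} \<and> E \<noteq> UNIV}"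

definition gr_q :: "'k::real_normed_vector set \<Rightarrow> ('k \<Rightarrow> 'k) \<Rightarrow> 'k set" where
  "gr_q E T = (\<lambda>x. x + T x) ` E"

definition gr_p :: "'k::real_normed_vector set \<Rightarrow> 'k set \<Rightarrow> 'k set \<Rightarrow> ('k \<Rightarrow> 'k)" where
  "gr_p E F = inv_into (bops E F) (gr_q E)"

text \<open>
  For the operator norm on \<open>\<L>(E,F)\<close>, the map \<open>T \<mapsto> T \<circ> P\<^sub>E\<close> is a linear isometry onto a closed
  subspace of \<open>\<L>(K)\<close>; this copy of \<open>\<L>(E,F)\<close> is the model space of the chart \<open>p\<^sub>E\<^sub>,\<^sub>F\<close>.
\<close>

definition gr_model :: "'k::{real_inner,banach} set \<Rightarrow> 'k set \<Rightarrow> ('k \<Rightarrow>\<^sub>L 'k) set" where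
  "gr_model E F = comp_proj E ` bops E F"

definition gr_coord :: "'k::{real_inner,banach} set \<Rightarrow> 'k set \<Rightarrow> 'k set \<Rightarrow> ('k \<Rightarrow>\<^sub>L 'k)" where
  "gr_coord E F G = comp_proj E (gr_p E F G)"

definition gr_atlas :: "('k::{real_inner,banach} set, 'k \<Rightarrow>\<^sub>L 'k) chart set" where
  "gr_atlas = {(closed_complements_in UNIV F, gr_coord E F, gr_model E F) |E F.
     F \<in> grassmannian \<and> E \<in> closed_complements_in UNIV F}"

definition gr_tangent :: "('k::real_inner set \<times> ('k \<Rightarrow> 'k)) set" where
  "gr_tangent = Sigma grassmannian (\<lambda>E. bops E (E\<^sup>\<bottom>))"

text \<open>
  \<open>T \<in> \<L>(G,G\<^sup>\<bottom>)\<close> is the tangent vector at \<open>G\<close> whose representative in the chart \<open>p\<close> attached to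
  \<open>(G,G\<^sup>\<bottom>)\<close> is \<open>T\<close>.  Its representative in another chart \<open>\<phi>\<close> is therefore its image under the
  derivative of the coordinate change.
\<close>

definition gr_tangent_rep ::
    "('k::{real_inner,banach} set \<Rightarrow> ('k \<Rightarrow>\<^sub>L 'k)) \<Rightarrow> 'k set \<Rightarrow> ('k \<Rightarrow> 'k) \<Rightarrow> ('k \<Rightarrow>\<^sub>L 'k)" where
  "gr_tangent_rep \<phi> G T =
     frechet_derivative
       (\<phi> \<circ> inv_into (closed_complements_in UNIV (G\<^sup>\<bottom>)) (gr_coord G (G\<^sup>\<bottom>)))
       (at (gr_coord G (G\<^sup>\<bottom>) G) within gr_model G (G\<^sup>\<bottom>))
       (comp_proj G T)"

definition gr_tangent_atlas ::
    "('k::{real_inner,banach} set \<times> ('k \<Rightarrow> 'k), ('k \<Rightarrow>\<^sub>L 'k) \<times> ('k \<Rightarrow>\<^sub>L 'k)) chart set" where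
  "gr_tangent_atlas =
     {(gr_tangent \<inter> (U \<times> UNIV), (\<lambda>(G, T). (\<phi> G, gr_tangent_rep \<phi> G T)), V \<times> V) |U \<phi> V.
        (U, \<phi>, V) \<in> gr_atlas}"


section \<open>Idempotents and the two maps\<close>

definition idempotents :: "('k::real_normed_vector \<Rightarrow>\<^sub>L 'k) set" where
  "idempotents = {Q. Q \<noteq> 0 \<and> Q \<noteq> id_blinfun \<and> Q o\<^sub>L Q = Q}"

definition idempotents_onto :: "'k::real_normed_vector set \<Rightarrow> ('k \<Rightarrow>\<^sub>L 'k) set" where
  "idempotents_onto E = {Q \<in> idempotents. range (blinfun_apply Q) = E}"

definition idem_to_tangent :: "('k::real_inner \<Rightarrow>\<^sub>L 'k) \<Rightarrow> 'k set \<times> ('k \<Rightarrow> 'k)" where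
  "idem_to_tangent Q =
     (let E = range (blinfun_apply Q)
      in (E, \<lambda>x\<in>E. orth_proj (E\<^sup>\<bottom>) (adjoint (blinfun_apply Q) x)))"

definition tangent_to_trivial ::
    "'k::{real_inner,banach} set \<times> ('k \<Rightarrow> 'k) \<Rightarrow> 'k set \<times> ('k \<Rightarrow>\<^sub>L 'k)" where
  "tangent_to_trivial = (\<lambda>(E, T). (E, comp_proj E T))"

definition vanishing_bundle :: "('k::real_inner set \<times> ('k \<Rightarrow>\<^sub>L 'k)) set" where
  "vanishing_bundle = {(E, S). E \<in> grassmannian \<and> S \<in> ops_vanishing (E\<^sup>\<bottom>)}"

end

theory Submission
  imports Defs
begin

text \<open>
  Every coordinate expression involved is a rational function of operators, built from sums,
  products, adjoints and inverses; such functions are analytic because the coefficients of a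
  convergent inverse power series can be computed recursively.  The bridge between closed
  subspaces and operators is the orthogonal projection \<open>P\<^sub>G\<close>.  If \<open>Q\<close> is idempotent with range \<open>G\<close> and
  kernel \<open>F\<close>, then \<open>P\<^sub>G = Q (Q + Q\<^sup>* - I)\<^sup>-\<^sup>1\<close>; moreover \<open>G\<close> is complementary to \<open>F\<close> iff
  \<open>P\<^sub>G - P\<^sub>F\<close> is invertible, and then \<open>Q = P\<^sub>G (P\<^sub>G - P\<^sub>F)\<^sup>-\<^sup>1\<close>.  The chart \<open>p\<^sub>E\<^sub>,\<^sub>F\<close> sends \<open>G\<close> to
  \<open>(Q - I) P\<^sub>E\<close> and has inverse \<open>A \<mapsto> (I + A) Q\<^sub>0\<close> in terms of projections along \<open>F\<close>, where \<open>Q\<^sub>0\<close> is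
  the one onto \<open>E\<close>; a tangent vector \<open>T\<close> at \<open>G\<close> has coordinate \<open>(I - Q) T P\<^sub>G Q P\<^sub>E\<close>.  The
  inverse of the map in (a) is \<open>(G, T) \<mapsto> P\<^sub>G + (T P\<^sub>G)\<^sup>*\<close>.
\<close>


section \<open>Power series in a closed subspace\<close>

text \<open>No general chain rule for analytic maps is used. Every closure lemma concerns functions
  of one and the same coordinate, and a chart change or a map between manifolds is first rewritten
  as one explicit operator expression in that coordinate. Such an expression agrees with the map
  only on the coordinate domain, so openness of domains matters as much as analyticity;
  complementarity is therefore restated as invertibility of an operator, an open condition.

  Projections replace subspaces because a subspace-valued function has no power series, whereas the
  orthogonal projection determines the subspace and lies in one fixed Banach space. Boundedness of
  oblique projections rests on the closed graph theorem, existence of adjoints on the Riesz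
  representation; both are proved here.

  The idempotents inherit their structure from L(K), so a parametrisation of that set alone is no
  chart: a neighbourhood in L(K) has to be straightened so that the idempotents become a
  complemented linear piece. The bundle in (b) poses the same problem, and there conjugation makes
  the varying fibres constant.\<close>

definition multilinear_on ::
    "'a::real_vector set \<Rightarrow> ('a list \<Rightarrow> 'b::real_vector) \<Rightarrow> bool" where
  "multilinear_on V A \<longleftrightarrow>
    (\<forall>xs ys. \<forall>u\<in>V. \<forall>v\<in>V. \<forall>a b. set xs \<subseteq> V \<and> set ys \<subseteq> V \<longrightarrow>
         A (xs @ (a *\<^sub>R u + b *\<^sub>R v) # ys) = a *\<^sub>R A (xs @ u # ys) + b *\<^sub>R A (xs @ v # ys))"

lemma multilinear_onD:
  assumes "multilinear_on V A" "u \<in> V" "v \<in> V" "set xs \<subseteq> V" "set ys \<subseteq> V"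
  shows "A (xs @ (a *\<^sub>R u + b *\<^sub>R v) # ys) = a *\<^sub>R A (xs @ u # ys) + b *\<^sub>R A (xs @ v # ys)"
  using assms unfolding multilinear_on_def by blast

text \<open>Nonnegativity of \<open>C\<close> is added to the bound in \<open>analytic_at_in\<close>
  because majorants are multiplied and compared below; \<open>analytic_at_inE\<close> shows that
  this loses no generality.\<close>

definition series_bound ::
    "'a::real_normed_vector set \<Rightarrow> ('a list \<Rightarrow> 'b::real_normed_vector) \<Rightarrow> (nat \<Rightarrow> real) \<Rightarrow> bool" where
  "series_bound V A C \<longleftrightarrow> (\<forall>n. 0 \<le> C n) \<and>
    (\<forall>xs. set xs \<subseteq> V \<longrightarrow> norm (A xs) \<le> C (length xs) * prod_list (map norm xs))"

lemma series_boundD: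
  assumes "series_bound V A C" "set xs \<subseteq> V"
  shows "norm (A xs) \<le> C (length xs) * prod_list (map norm xs)"
  using assms by (simp add: series_bound_def)

lemma prod_list_norm_nonneg [simp]: "0 \<le> prod_list (map norm xs)"
  by (induction xs) auto

definition has_series ::
    "'a::real_normed_vector set \<Rightarrow> ('a \<Rightarrow> 'b::real_normed_vector) \<Rightarrow> 'a \<Rightarrow>
      ('a list \<Rightarrow> 'b) \<Rightarrow> (nat \<Rightarrow> real) \<Rightarrow> real \<Rightarrow> bool" where
  "has_series V f x A C r \<longleftrightarrow> r > 0 \<and> multilinear_on V A \<and> series_bound V A C \<and>
    summable (\<lambda>n. C n * r ^ n) \<and>
    (\<forall>h. h \<in> V \<longrightarrow> norm h < r \<longrightarrow> (\<lambda>n. A (replicate n h)) sums f (x + h))"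

lemma has_seriesD:
  assumes "has_series V f x A C r"
  shows "0 < r" "multilinear_on V A" "series_bound V A C" "summable (\<lambda>n. C n * r ^ n)"
    "\<And>h. h \<in> V \<Longrightarrow> norm h < r \<Longrightarrow> (\<lambda>n. A (replicate n h)) sums f (x + h)" "0 \<le> C n"
  using assms by (auto simp: has_series_def series_bound_def)

lemma analytic_at_inI:
  assumes "r > 0" "multilinear_on V A" "series_bound V A C" "summable (\<lambda>n. C n * r ^ n)"
    and "\<And>h. h \<in> V \<Longrightarrow> norm h < r \<Longrightarrow> (\<lambda>n. A (replicate n h)) sums f (x + h)"
  shows "analytic_at_in V f x"
  unfolding analytic_at_in_def using assms
  by (intro exI[of _ A] exI[of _ C] exI[of _ r]) (auto simp: multilinear_on_def series_bound_def)

text \<open>The definition asks only that \<open>C n * r ^ n\<close> be summable, without a sign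
  condition. A radius strictly below \<open>r\<close> makes the convergence absolute, so
  \<open>\<bar>C n\<bar>\<close> can replace \<open>C n\<close>. The cap \<open>s\<close> lets two
  expansions share one radius.\<close>

lemma analytic_at_inE:
  assumes "analytic_at_in V f x" "s > 0"
  obtains A C r where "has_series V f x A C r" "r \<le> s"
proof -
  obtain A :: "'a list \<Rightarrow> 'b" and C r where r: "r > 0" and m: "multilinear_on V A"
    and b: "\<forall>xs. set xs \<subseteq> V \<longrightarrow> norm (A xs) \<le> C (length xs) * prod_list (map norm xs)"
    and s: "summable (\<lambda>n. C n * r ^ n)"
    and f: "\<forall>h\<in>V. norm h < r \<longrightarrow> (\<lambda>n. A (replicate n h)) sums f (x + h)"
    using assms(1) unfolding analytic_at_in_def multilinear_on_def[symmetric] by blast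
  define t where "t = min (r/2) s"
  have t: "0 < t" "t \<le> s" "t < r" using r assms(2) by (auto simp: t_def)
  have "summable (\<lambda>n. norm (C n * t ^ n))"
    by (rule powser_insidea[OF s]) (use t in auto)
  then have 1: "summable (\<lambda>n. \<bar>C n\<bar> * t ^ n)"
    using t by (simp add: abs_mult)
  have 2: "norm (A xs) \<le> \<bar>C (length xs)\<bar> * prod_list (map norm xs)" if "set xs \<subseteq> V" for xs
    by (rule order_trans[OF b[rule_format, OF that]]) (simp add: mult_right_mono)
  have "has_series V f x A (\<lambda>n. \<bar>C n\<bar>) t"
    unfolding has_series_def series_bound_def using t 1 2 m f by auto
  then show ?thesis using t(2) by (rule that)
qed

lemma series_bound_mono_radius:
  fixes C :: "nat \<Rightarrow> real"
  assumes "\<And>n. 0 \<le> C n" "summable (\<lambda>n. C n * r ^ n)" "0 \<le> t" "t \<le> r"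
  shows "summable (\<lambda>n. C n * t ^ n)"
  by (rule summable_comparison_test'[OF assms(2), where N = 0])
     (use assms in \<open>auto intro!: mult_left_mono power_mono\<close>)

lemma series_summable_norm:
  assumes "series_bound V A C" "summable (\<lambda>n. C n * r ^ n)" "h \<in> V" "norm h \<le> r"
  shows "summable (\<lambda>n. norm (A (replicate n h)))"
proof (rule summable_comparison_test'[OF assms(2), where N = 0])
  fix n
  have "norm (A (replicate n h)) \<le> C n * norm h ^ n"
    using series_boundD[OF assms(1), of "replicate n h"] assms(3) by (auto simp: set_replicate_conv_if split: if_splits)
  also have "\<dots> \<le> C n * r ^ n"
    using assms by (auto simp: series_bound_def intro!: mult_left_mono power_mono)
  finally show "norm (norm (A (replicate n h))) \<le> C n * r ^ n" by simp
qed

lemma analytic_at_in_cong: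
  assumes "analytic_at_in V f x" "s > 0"
    and "\<And>h. h \<in> V \<Longrightarrow> norm h < s \<Longrightarrow> g (x + h) = f (x + h)"
  shows "analytic_at_in V g x"
proof -
  obtain A C r where "has_series V f x A C r" and r: "r \<le> s"
    using analytic_at_inE[OF assms(1,2)] by blast
  note * = has_seriesD[OF this(1)]
  show ?thesis
    by (rule analytic_at_inI[OF *(1-4)]) (use * r assms(3) in auto)
qed

lemma openin_subspace_ball:
  assumes "openin (top_of_set V) U" "x \<in> U" "subspace V"
  obtains s where "s > 0" "\<And>h. h \<in> V \<Longrightarrow> norm h < s \<Longrightarrow> x + h \<in> U"
proof -
  obtain s where s: "s > 0" "ball x s \<inter> V \<subseteq> U"
    using assms(1,2) by (meson openin_contains_ball)
  have "x \<in> V" using assms(1,2) openin_imp_subset by auto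
  then show ?thesis
    using s assms(3) by (intro that[of s]) (auto simp: dist_norm subspace_add)
qed

lemma openin_subspaceI:
  assumes "subspace V" "U \<subseteq> V"
    and "\<And>x. x \<in> U \<Longrightarrow> \<exists>s>0. \<forall>h\<in>V. norm h < s \<longrightarrow> x + h \<in> U"
  shows "openin (top_of_set V) U"
  unfolding openin_contains_ball
proof (intro conjI ballI)
  fix x assume x: "x \<in> U"
  then obtain s where s: "s > 0" "\<forall>h\<in>V. norm h < s \<longrightarrow> x + h \<in> U" using assms(3) by blast
  have "y \<in> U" if "y \<in> V" "dist x y < s" for y
  proof -
    have "y - x \<in> V" using that x assms(1,2) by (auto intro: subspace_diff)
    then show ?thesis using s(2) that by (auto simp: dist_norm norm_minus_commute dest!: bspec[of _ _ "y - x"])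
  qed
  then show "\<exists>e>0. ball x e \<inter> V \<subseteq> U" using s(1) by (intro exI[of _ s]) auto
qed (use assms in auto)

text \<open>A coordinate expression and its rational formula agree only on the coordinate domain;
  openness of the domain turns this into agreement near each point, on which alone analyticity
  depends.\<close>

lemma analytic_on_in_cong:
  assumes "analytic_on_in V U f" "subspace V" "U' = U" "\<And>x. x \<in> U \<Longrightarrow> g x = f x"
  shows "analytic_on_in V U' g"
  unfolding analytic_on_in_def
proof (intro conjI ballI)
  show "openin (top_of_set V) U'" using assms by (simp add: analytic_on_in_def)
  fix x assume x: "x \<in> U'"
  obtain s where s: "s > 0" "\<And>h. h \<in> V \<Longrightarrow> norm h < s \<Longrightarrow> x + h \<in> U"
    using openin_subspace_ball[of V U x] assms x unfolding analytic_on_in_def by auto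
  show "analytic_at_in V g x"
    by (rule analytic_at_in_cong[where f = f and s = s])
       (use s assms x in \<open>auto simp: analytic_on_in_def\<close>)
qed

section \<open>Closure properties of analytic maps\<close>

lemma analytic_at_in_const [simp]: "analytic_at_in V (\<lambda>_. c) x"
proof (rule analytic_at_inI[where r = 1 and A = "\<lambda>xs. if xs = [] then c else 0"
      and C = "\<lambda>n. if n = 0 then norm c else 0"])
  show "summable (\<lambda>n. (if n = 0 then norm c else 0) * (1::real) ^ n)"
    by (rule summable_finite[of "{0}"]) auto
  have "(\<lambda>n. if n = 0 then c else 0) sums c"
    using sums_single[of 0 "\<lambda>_. c"] by simp
  then show "(\<lambda>n. if replicate n h = [] then c else 0) sums c" for h :: 'a
    by simp
qed (auto simp: multilinear_on_def series_bound_def)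

lemma analytic_at_in_linear:
  assumes "bounded_linear f"
  shows "analytic_at_in V f x"
proof -
  interpret bounded_linear f by fact
  define A where "A xs = (case xs of [] \<Rightarrow> f x | [h] \<Rightarrow> f h | _ \<Rightarrow> 0)" for xs
  \<comment> \<open>An inserted argument makes the list nonempty, so the constant term
    \<open>f x\<close> never enters and only lists of length one survive.\<close>
  have A1: "A (xs @ w # ys) = (if xs = [] \<and> ys = [] then f w else 0)" for xs ys w
    by (cases xs; cases "tl xs"; cases ys) (auto simp: A_def)
  define C where "C n = (if n = 0 then norm (f x) else if n = 1 then onorm f else 0)" for n :: nat
  show ?thesis
  proof (rule analytic_at_inI[where r = 1 and A = A and C = C])
    show "multilinear_on V A"
      unfolding multilinear_on_def by (auto simp: A1 add scale)
    show "series_bound V A C"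
      unfolding series_bound_def A_def C_def
      by (auto simp: onorm_pos_le[OF assms] onorm[OF assms] split: list.splits)
    show "summable (\<lambda>n. C n * 1 ^ n)"
      by (rule summable_finite[of "{0,1}"]) (auto simp: C_def)
    fix h
    have *: "A (replicate n h) = 0" if "n \<notin> {0,1}" for n
      using that by (cases n; cases "n - 1") (auto simp: A_def)
    have "(\<lambda>n. A (replicate n h)) sums (\<Sum>n\<in>{0,1}. A (replicate n h))"
      by (rule sums_finite) (simp, rule *)
    then show "(\<lambda>n. A (replicate n h)) sums f (x + h)"
      by (simp add: A_def add)
  qed simp
qed

text \<open>Square partial sums converge to the product, so it suffices that they differ from the
  triangular ones by a null sequence. In norm this difference is at most \<open>K\<close> times the
  same difference for the two real series of norms, whose Cauchy product is known to
  converge.\<close>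

lemma sums_bilinear_Cauchy:
  fixes a :: "nat \<Rightarrow> 'a::real_normed_vector" and b :: "nat \<Rightarrow> 'b::real_normed_vector"
  assumes "bounded_bilinear mul" and a: "a sums s" "summable (\<lambda>n. norm (a n))"
    and b: "b sums t" "summable (\<lambda>n. norm (b n))"
  shows "(\<lambda>n. \<Sum>k\<le>n. mul (a k) (b (n - k))) sums (mul s t)"
proof -
  interpret bounded_bilinear mul by fact
  obtain K where K: "K \<ge> 0" "\<And>x y. norm (mul x y) \<le> norm x * norm y * K"
    using nonneg_bounded by blast
  \<comment> \<open>The part of the n by n square of indices that lies beyond the triangle i + j <
    n.\<close>
  define T where "T n = {(i, j). i < n \<and> j < n \<and> n \<le> i + j}" for n :: nat
  have split: "(\<Sum>i<n. \<Sum>j<n. f i j) = (\<Sum>m<n. \<Sum>k\<le>m. f k (m - k)) + (\<Sum>(i,j)\<in>T n. f i j)"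
    for f :: "nat \<Rightarrow> nat \<Rightarrow> 'd::comm_monoid_add" and n
  proof -
    have "(\<Sum>i<n. \<Sum>j<n. f i j) = (\<Sum>(i,j)\<in>{..<n} \<times> {..<n}. f i j)"
      by (simp add: sum.cartesian_product)
    also have "{..<n} \<times> {..<n} = {(i,j). i + j < n} \<union> T n" by (auto simp: T_def)
    also have "(\<Sum>(i,j)\<in>\<dots>. f i j) = (\<Sum>(i,j)\<in>{(i,j). i + j < n}. f i j) + (\<Sum>(i,j)\<in>T n. f i j)"
    proof (rule sum.union_disjoint)
      show "finite {(i, j). i + j < n}"
        by (rule finite_subset[of _ "{..<n} \<times> {..<n}"]) auto
      show "finite (T n)"
        by (rule finite_subset[of _ "{..<n} \<times> {..<n}"]) (auto simp: T_def)
    qed (auto simp: T_def)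
    also have "(\<Sum>(i,j)\<in>{(i,j). i + j < n}. f i j) = (\<Sum>m<n. \<Sum>k\<le>m. f k (m - k))"
      by (rule sum.triangle_reindex)
    finally show ?thesis .
  qed
  let ?c = "\<lambda>n. \<Sum>k\<le>n. norm (a k) * norm (b (n - k))"
  define R where "R n = (\<Sum>i<n. norm (a i)) * (\<Sum>j<n. norm (b j)) - (\<Sum>m<n. ?c m)" for n
  have "(\<lambda>n. \<Sum>m<n. ?c m) \<longlonglongrightarrow> (\<Sum>n. norm (a n)) * (\<Sum>n. norm (b n))"
    using Cauchy_product_sums[of "\<lambda>n. norm (a n)" "\<lambda>n. norm (b n)"] a b by (simp add: sums_def)
  moreover have "(\<lambda>n. (\<Sum>i<n. norm (a i)) * (\<Sum>j<n. norm (b j))) \<longlonglongrightarrow>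
      (\<Sum>n. norm (a n)) * (\<Sum>n. norm (b n))"
    using a b by (intro tendsto_mult summable_LIMSEQ)
  ultimately have "R \<longlonglongrightarrow> 0" unfolding R_def using tendsto_diff by fastforce
  then have R0: "(\<lambda>n. K * R n) \<longlonglongrightarrow> 0"
    using tendsto_mult_right_zero by blast
  have R: "R n = (\<Sum>(i,j)\<in>T n. norm (a i) * norm (b j))" for n
    unfolding R_def sum_product split by simp
  have "norm (mul (\<Sum>i<n. a i) (\<Sum>j<n. b j) - (\<Sum>m<n. \<Sum>k\<le>m. mul (a k) (b (m - k)))) \<le> K * R n" for n
  proof -
    have "mul (\<Sum>i<n. a i) (\<Sum>j<n. b j) - (\<Sum>m<n. \<Sum>k\<le>m. mul (a k) (b (m - k)))
        = (\<Sum>(i,j)\<in>T n. mul (a i) (b j))"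
      by (subst sum_left, subst sum_right, subst split) simp
    also have "norm \<dots> \<le> (\<Sum>(i,j)\<in>T n. K * (norm (a i) * norm (b j)))"
      by (rule sum_norm_le) (use K in \<open>auto simp: mult_ac\<close>)
    also have "\<dots> = K * R n" by (simp add: R sum_distrib_left case_prod_unfold)
    finally show ?thesis .
  qed
  then have "(\<lambda>n. mul (\<Sum>i<n. a i) (\<Sum>j<n. b j) - (\<Sum>m<n. \<Sum>k\<le>m. mul (a k) (b (m - k)))) \<longlonglongrightarrow> 0"
    by (intro Lim_null_comparison[OF _ R0] always_eventually allI)
  moreover have "(\<lambda>n. mul (\<Sum>i<n. a i) (\<Sum>j<n. b j)) \<longlonglongrightarrow> mul s t"
    using a b by (intro tendsto) (auto simp: sums_def)
  ultimately show ?thesis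
    unfolding sums_def by (rule Lim_transform2[rotated])
qed

text \<open>Cutting the list at \<open>k\<close> leaves the distinguished argument either in the
  block for \<open>A\<close> or in the one for \<open>B\<close>. Linearity of \<open>B\<close> is
  assumed only below length bound \<open>N\<close>, so that the lemma also serves an induction in
  which \<open>B\<close> is still being studied.\<close>

lemma multilinear_split:
  assumes A: "multilinear_on V A" and B: "\<And>xs u v a b ys.
      \<lbrakk>u \<in> V; v \<in> V; set xs \<subseteq> V; set ys \<subseteq> V; length xs + length ys < N\<rbrakk> \<Longrightarrow>
      B (xs @ (a *\<^sub>R u + b *\<^sub>R v) # ys) = a *\<^sub>R B (xs @ u # ys) + b *\<^sub>R B (xs @ v # ys)"
    and pr: "bounded_bilinear mul" and V: "u \<in> V" "v \<in> V" "set xs \<subseteq> V" "set ys \<subseteq> V"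
    and N: "length xs + length ys < N + k"
  shows "mul (A (take k (xs @ (a *\<^sub>R u + b *\<^sub>R v) # ys))) (B (drop k (xs @ (a *\<^sub>R u + b *\<^sub>R v) # ys)))
    = a *\<^sub>R mul (A (take k (xs @ u # ys))) (B (drop k (xs @ u # ys)))
    + b *\<^sub>R mul (A (take k (xs @ v # ys))) (B (drop k (xs @ v # ys)))"
proof (cases "k \<le> length xs")
  interpret bounded_bilinear mul by fact
  case True
  have "set (drop k xs) \<subseteq> V" using V set_drop_subset by fast
  then show ?thesis using True V N
    by (simp add: B add_right scaleR_right)
next
  interpret bounded_bilinear mul by fact
  case False
  then obtain m where m: "k - length xs = Suc m" by (metis Suc_diff_Suc not_le)
  have "set (take m ys) \<subseteq> V" using V set_take_subset by fast
  then show ?thesis using False V m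
    by (simp add: multilinear_onD[OF A] add_left scaleR_left)
qed

lemma series_bound_split:
  assumes "series_bound V A C" "series_bound V B D" "set xs \<subseteq> V" "k \<le> length xs"
    "\<And>x y. norm (mul x y) \<le> norm x * norm y * K" "0 \<le> K"
  shows "norm (mul (A (take k xs)) (B (drop k xs)))
      \<le> K * (C k * D (length xs - k)) * prod_list (map norm xs)"
proof -
  have s: "set (take k xs) \<subseteq> V" "set (drop k xs) \<subseteq> V"
    using assms(3) set_take_subset set_drop_subset by fast+
  have "norm (A (take k xs)) \<le> C k * prod_list (map norm (take k xs))"
       "norm (B (drop k xs)) \<le> D (length xs - k) * prod_list (map norm (drop k xs))"
    using series_boundD[OF assms(1) s(1)] series_boundD[OF assms(2) s(2)] assms(4)
    by (simp_all add: min_absorb2)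
  then have "norm (A (take k xs)) * norm (B (drop k xs)) * K
     \<le> (C k * prod_list (map norm (take k xs))) * (D (length xs - k) * prod_list (map norm (drop k xs))) * K"
    using assms(1,2,6) by (intro mult_mono mult_nonneg_nonneg) (auto simp: series_bound_def)
  also have "\<dots> = K * (C k * D (length xs - k)) * (prod_list (map norm (take k xs @ drop k xs)))"
    by (simp only: map_append prod_list.append mult_ac)
  finally show ?thesis using assms(5) by (auto intro: order_trans)
qed

lemma analytic_at_in_bilinear:
  assumes pr: "bounded_bilinear mul" and f: "analytic_at_in V f x" and g: "analytic_at_in V g x"
  shows "analytic_at_in V (\<lambda>y. mul (f y) (g y)) x"
proof -
  interpret bounded_bilinear mul by fact
  obtain K where K: "K \<ge> 0" "\<And>x y. norm (mul x y) \<le> norm x * norm y * K"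
    using nonneg_bounded by blast
  obtain A C r0 where "has_series V f x A C r0"
    using analytic_at_inE[OF f zero_less_one] by blast
  note A = has_seriesD[OF this]
  obtain B D r where "has_series V g x B D r" and r: "r \<le> r0"
    using analytic_at_inE[OF g A(1)] by blast
  note B = has_seriesD[OF this(1)]
  have sC: "summable (\<lambda>n. C n * r ^ n)"
    using series_bound_mono_radius[OF A(6,4)] B(1) r by auto
  define E where "E n = (\<Sum>k\<le>n. K * (C k * D (n - k)))" for n
  define P where "P xs = (\<Sum>k\<le>length xs. mul (A (take k xs)) (B (drop k xs)))" for xs
  show ?thesis
  proof (rule analytic_at_inI[where r = r and A = P and C = E])
    show "multilinear_on V P"
      unfolding multilinear_on_def
    proof (intro allI ballI impI)
      fix xs ys u v and a b :: real assume *: "u \<in> V" "v \<in> V" "set xs \<subseteq> V \<and> set ys \<subseteq> V"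
      show "P (xs @ (a *\<^sub>R u + b *\<^sub>R v) # ys) = a *\<^sub>R P (xs @ u # ys) + b *\<^sub>R P (xs @ v # ys)"
        unfolding P_def scaleR_right.sum
        using * by (subst multilinear_split[OF A(2) multilinear_onD[OF B(2)] pr, where N = "Suc (length xs + length ys)"])
            (auto simp: sum.distrib scaleR_sum_right)
    qed
    have "norm (P xs) \<le> E (length xs) * prod_list (map norm xs)" if "set xs \<subseteq> V" for xs
      unfolding P_def E_def sum_distrib_right
      by (rule sum_norm_le) (use series_bound_split[OF A(3) B(3) that _ K(2,1)] in auto)
    moreover have "0 \<le> E n" for n
      unfolding E_def using A(6) B(6) K by (intro sum_nonneg) auto
    ultimately show "series_bound V P E" by (auto simp: series_bound_def)
    have "summable (\<lambda>n. \<Sum>k\<le>n. (C k * r ^ k) * (D (n - k) * r ^ (n - k)))"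
      using summable_Cauchy_product[of "\<lambda>n. C n * r ^ n" "\<lambda>n. D n * r ^ n"] sC B(1,4,6) A(6) by simp
    moreover have "(\<Sum>k\<le>n. (C k * r ^ k) * (D (n - k) * r ^ (n - k))) = (\<Sum>k\<le>n. C k * D (n - k)) * r ^ n" for n
      unfolding sum_distrib_right
    proof (rule sum.cong[OF refl])
      fix k assume "k \<in> {..n}"
      then have "r ^ n = r ^ k * r ^ (n - k)" by (simp flip: power_add)
      then show "C k * r ^ k * (D (n - k) * r ^ (n - k)) = C k * D (n - k) * r ^ n"
        by (simp add: mult_ac)
    qed
    ultimately have "summable (\<lambda>n. K * ((\<Sum>k\<le>n. C k * D (n - k)) * r ^ n))"
      by (intro summable_mult) simp
    then show "summable (\<lambda>n. E n * r ^ n)" by (simp add: E_def sum_distrib_left mult_ac)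
    fix h assume h: "h \<in> V" "norm h < r"
    have "(\<lambda>n. \<Sum>k\<le>n. mul (A (replicate k h)) (B (replicate (n - k) h))) sums mul (f (x + h)) (g (x + h))"
      using series_summable_norm[OF A(3) sC, of h] series_summable_norm[OF B(3,4), of h] A(5)[of h] B(5)[of h] h r
      by (intro sums_bilinear_Cauchy[OF pr]) auto
    moreover have "P (replicate n h) = (\<Sum>k\<le>n. mul (A (replicate k h)) (B (replicate (n - k) h)))" for n
      unfolding P_def by (intro sum.cong) (auto simp: min_def)
    ultimately show "(\<lambda>n. P (replicate n h)) sums mul (f (x + h)) (g (x + h))" by simp
  qed (rule B(1))
qed

text \<open>Multiplication by the constant scalar function 1 makes this a case of the bilinear
  product.\<close>

lemma analytic_at_in_linear_compose:
  assumes "bounded_linear L" "analytic_at_in V f x"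
  shows "analytic_at_in V (\<lambda>y. L (f y)) x"
proof -
  have "bounded_bilinear (\<lambda>(c::real) y. c *\<^sub>R L y)"
    using bounded_bilinear.comp[OF bounded_bilinear_scaleR bounded_linear_ident assms(1)] by simp
  from analytic_at_in_bilinear[OF this analytic_at_in_const[of V 1 x] assms(2)]
  show ?thesis by simp
qed

lemma analytic_at_in_add:
  assumes f: "analytic_at_in V f x" and g: "analytic_at_in V g x"
  shows "analytic_at_in V (\<lambda>y. f y + g y) x"
proof -
  obtain A C r0 where "has_series V f x A C r0"
    using analytic_at_inE[OF f zero_less_one] by blast
  note A = has_seriesD[OF this]
  obtain B D r where "has_series V g x B D r" and r: "r \<le> r0"
    using analytic_at_inE[OF g A(1)] by blast
  note B = has_seriesD[OF this(1)]
  have sC: "summable (\<lambda>n. C n * r ^ n)"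
    using series_bound_mono_radius[OF A(6,4)] B(1) r by auto
  show ?thesis
  proof (rule analytic_at_inI[where r = r and A = "\<lambda>xs. A xs + B xs" and C = "\<lambda>n. C n + D n"])
    show "multilinear_on V (\<lambda>xs. A xs + B xs)"
      using A(2) B(2) by (auto simp: multilinear_on_def scaleR_add_right)
    show "series_bound V (\<lambda>xs. A xs + B xs) (\<lambda>n. C n + D n)"
      using A(3) B(3) unfolding series_bound_def
      by (auto simp: distrib_right intro!: norm_triangle_le add_mono)
    show "summable (\<lambda>n. (C n + D n) * r ^ n)"
      using summable_add[OF sC B(4)] by (simp add: distrib_right)
    show "(\<lambda>n. A (replicate n h) + B (replicate n h)) sums (f (x + h) + g (x + h))"
      if "h \<in> V" "norm h < r" for h
      using that A(5)[of h] B(5)[of h] r by (intro sums_add) auto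
  qed (rule B(1))
qed

lemma analytic_at_in_minus:
  assumes "analytic_at_in V f x"
  shows "analytic_at_in V (\<lambda>y. - f y) x"
  by (rule analytic_at_in_linear_compose[OF _ assms]) (rule bounded_linear_minus[OF bounded_linear_ident])

lemma analytic_at_in_diff:
  assumes "analytic_at_in V f x" "analytic_at_in V g x"
  shows "analytic_at_in V (\<lambda>y. f y - g y) x"
  using analytic_at_in_add[OF assms(1) analytic_at_in_minus[OF assms(2)]] by simp

lemma analytic_at_in_Pair:
  assumes "analytic_at_in V f x" "analytic_at_in V g x"
  shows "analytic_at_in V (\<lambda>y. (f y, g y)) x"
proof -
  have "analytic_at_in V (\<lambda>y. (f y, 0) + (0, g y)) x"
    by (intro analytic_at_in_add
        analytic_at_in_linear_compose[OF _ assms(1), of "\<lambda>y. (y, 0)"]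
        analytic_at_in_linear_compose[OF _ assms(2), of "\<lambda>y. (0, y)"]
        bounded_linear_Pair bounded_linear_ident bounded_linear_zero)
  then show ?thesis by simp
qed

lemma analytic_at_in_compose:
  assumes "analytic_at_in V f x" "analytic_at_in V g x"
  shows "analytic_at_in V (\<lambda>y. f y o\<^sub>L g y) x"
  using analytic_at_in_bilinear[OF bounded_bilinear_blinfun_compose assms] .

lemmas analytic_intros =
  analytic_at_in_const analytic_at_in_add analytic_at_in_minus analytic_at_in_diff
  analytic_at_in_Pair analytic_at_in_compose
  analytic_at_in_linear[OF bounded_linear_ident] analytic_at_in_linear[OF bounded_linear_fst]
  analytic_at_in_linear[OF bounded_linear_snd]

section \<open>Inversion\<close>

lemmas compose_simps =
  bounded_bilinear.add_left[OF bounded_bilinear_blinfun_compose]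
  bounded_bilinear.add_right[OF bounded_bilinear_blinfun_compose]
  bounded_bilinear.diff_left[OF bounded_bilinear_blinfun_compose]
  bounded_bilinear.diff_right[OF bounded_bilinear_blinfun_compose]
  bounded_bilinear.minus_left[OF bounded_bilinear_blinfun_compose]
  bounded_bilinear.minus_right[OF bounded_bilinear_blinfun_compose]
  bounded_bilinear.scaleR_left[OF bounded_bilinear_blinfun_compose]
  bounded_bilinear.scaleR_right[OF bounded_bilinear_blinfun_compose]

lemma compose_assoc: "(A o\<^sub>L B) o\<^sub>L C = A o\<^sub>L (B o\<^sub>L C)"
  by (rule blinfun_eqI) simp

lemma compose_id [simp]: "id_blinfun o\<^sub>L A = A" "A o\<^sub>L id_blinfun = A"
  by (auto intro!: blinfun_eqI)

definition op_invertible :: "('k::real_normed_vector \<Rightarrow>\<^sub>L 'k) \<Rightarrow> bool" where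
  "op_invertible A \<longleftrightarrow> (\<exists>B. A o\<^sub>L B = id_blinfun \<and> B o\<^sub>L A = id_blinfun)"

text \<open>A total function, so that rational operator expressions can be written down before
  invertibility is known; its value at a non-invertible operator is arbitrary.\<close>

definition op_inv :: "('k::real_normed_vector \<Rightarrow>\<^sub>L 'k) \<Rightarrow> ('k \<Rightarrow>\<^sub>L 'k)" where
  "op_inv A = (SOME B. A o\<^sub>L B = id_blinfun \<and> B o\<^sub>L A = id_blinfun)"

lemma op_inv:
  assumes "op_invertible A"
  shows "A o\<^sub>L op_inv A = id_blinfun" "op_inv A o\<^sub>L A = id_blinfun"
  using someI_ex[OF assms[unfolded op_invertible_def]] unfolding op_inv_def by blast+

lemma op_inv_assoc:
  assumes "op_invertible A"
  shows "A o\<^sub>L (op_inv A o\<^sub>L B) = B" "op_inv A o\<^sub>L (A o\<^sub>L B) = B"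
  by (simp_all add: op_inv[OF assms] flip: compose_assoc)

lemma op_inv_unique:
  assumes "A o\<^sub>L B = id_blinfun" "C o\<^sub>L A = id_blinfun"
  shows "op_invertible A" "op_inv A = B" "op_inv A = C"
proof -
  have "C = C o\<^sub>L (A o\<^sub>L B)" using assms by simp
  also have "\<dots> = (C o\<^sub>L A) o\<^sub>L B" by (simp only: compose_assoc)
  also have "\<dots> = B" using assms(2) by simp
  finally have CB: "C = B" .
  then show inv: "op_invertible A" using assms unfolding op_invertible_def by blast
  have "op_inv A = op_inv A o\<^sub>L (A o\<^sub>L B)" using assms by simp
  also have "\<dots> = B" by (simp add: op_inv_assoc[OF inv])
  finally show "op_inv A = B" "op_inv A = C" using CB by auto
qed

lemma op_inv_cancel:
  assumes "op_invertible A"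
  shows "A o\<^sub>L B = A o\<^sub>L C \<longleftrightarrow> B = C" "B o\<^sub>L A = C o\<^sub>L A \<longleftrightarrow> B = C"
proof -
  show "A o\<^sub>L B = A o\<^sub>L C \<longleftrightarrow> B = C" by (metis op_inv_assoc(2)[OF assms])
  show "B o\<^sub>L A = C o\<^sub>L A \<longleftrightarrow> B = C"
    by (metis compose_assoc op_inv(1)[OF assms] compose_id(2))
qed

text \<open>Coefficients of the power series \<open>B\<close> determined by \<open>A B = 1\<close>, where \<open>b\<close> is inverse to
  the constant term of \<open>A\<close>.\<close>

function inverse_coeff :: "('a list \<Rightarrow> ('k::real_normed_vector \<Rightarrow>\<^sub>L 'k)) \<Rightarrow> ('k \<Rightarrow>\<^sub>L 'k) \<Rightarrow> 'a list \<Rightarrow> ('k \<Rightarrow>\<^sub>L 'k)"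
  where "inverse_coeff A b xs = (if xs = [] then b else
    - (b o\<^sub>L (\<Sum>k\<in>{1..length xs}. A (take k xs) o\<^sub>L inverse_coeff A b (drop k xs))))"
  by pat_completeness auto
termination
  by (relation "Wellfounded.measure (\<lambda>(A, b, xs). length xs)") auto

text \<open>The scalar majorant of \<open>inverse_coeff\<close>: the same recursion after the
  triangle inequality, with \<beta> in place of the norm of \<open>b\<close>.\<close>

function inverse_bound :: "(nat \<Rightarrow> real) \<Rightarrow> real \<Rightarrow> nat \<Rightarrow> real"
  where "inverse_bound C \<beta> n = (if n = 0 then \<beta> else
    \<beta> * (\<Sum>k\<in>{1..n}. C k * inverse_bound C \<beta> (n - k)))"
  by pat_completeness auto
termination
  by (relation "Wellfounded.measure (\<lambda>(C, b, n). n)") auto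

declare inverse_coeff.simps [simp del] inverse_bound.simps [simp del]

lemma inverse_bound_nonneg:
  assumes "\<And>n. 0 \<le> C n" "0 \<le> \<beta>"
  shows "0 \<le> inverse_bound C \<beta> n"
proof (induction n rule: less_induct)
  case (less n)
  then show ?case
    using assms by (subst inverse_bound.simps) (auto intro!: mult_nonneg_nonneg sum_nonneg)
qed

lemma multilinear_inverse_coeff:
  fixes A :: "'a::real_normed_vector list \<Rightarrow> ('k::real_normed_vector \<Rightarrow>\<^sub>L 'k)"
  assumes "multilinear_on V A"
  shows "\<lbrakk>u \<in> V; v \<in> V; set xs \<subseteq> V; set ys \<subseteq> V; length xs + length ys < N\<rbrakk> \<Longrightarrow>
      inverse_coeff A \<beta> (xs @ (a *\<^sub>R u + b *\<^sub>R v) # ys)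
      = a *\<^sub>R inverse_coeff A \<beta> (xs @ u # ys) + b *\<^sub>R inverse_coeff A \<beta> (xs @ v # ys)"
proof (induction N arbitrary: xs ys u v a b)
  case (Suc N)
  let ?B = "inverse_coeff A \<beta>"
  let ?S = "\<lambda>w. \<Sum>k\<in>{1..Suc (length xs + length ys)}.
     A (take k (xs @ w # ys)) o\<^sub>L ?B (drop k (xs @ w # ys))"
  \<comment> \<open>Since \<open>k \<ge> 1\<close>, the blocks handed to
    \<open>inverse_coeff\<close> are short enough for the induction hypothesis at
    \<open>N\<close>.\<close>
  have "A (take k (xs @ (a *\<^sub>R u + b *\<^sub>R v) # ys)) o\<^sub>L ?B (drop k (xs @ (a *\<^sub>R u + b *\<^sub>R v) # ys))
    = a *\<^sub>R (A (take k (xs @ u # ys)) o\<^sub>L ?B (drop k (xs @ u # ys)))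
    + b *\<^sub>R (A (take k (xs @ v # ys)) o\<^sub>L ?B (drop k (xs @ v # ys)))" if "k \<ge> 1" for k
    by (rule multilinear_split[OF assms Suc.IH bounded_bilinear_blinfun_compose, where N = N])
       (use Suc.prems that in auto)
  then have "?S (a *\<^sub>R u + b *\<^sub>R v) = (\<Sum>k\<in>{1..Suc (length xs + length ys)}.
      a *\<^sub>R (A (take k (xs @ u # ys)) o\<^sub>L ?B (drop k (xs @ u # ys)))
    + b *\<^sub>R (A (take k (xs @ v # ys)) o\<^sub>L ?B (drop k (xs @ v # ys))))"
    by (intro sum.cong refl) simp_all
  then have "?S (a *\<^sub>R u + b *\<^sub>R v) = a *\<^sub>R ?S u + b *\<^sub>R ?S v"
    by (simp only: sum.distrib scaleR_sum_right)
  moreover have "?B (xs @ w # ys) = - (\<beta> o\<^sub>L ?S w)" for w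
    by (subst inverse_coeff.simps) simp
  ultimately show ?case
    by (simp only: compose_simps scaleR_minus_right minus_add_distrib)
qed simp

lemma bound_inverse_coeff:
  assumes "series_bound V A C" "set xs \<subseteq> V"
  shows "norm (inverse_coeff A b xs) \<le> inverse_bound C (norm b) (length xs) * prod_list (map norm xs)"
  using assms(2)
proof (induction "length xs" arbitrary: xs rule: less_induct)
  case less
  have C0: "0 \<le> C n" for n using assms(1) by (simp add: series_bound_def)
  show ?case
  proof (cases "xs = []")
    case True
    then show ?thesis by (simp add: inverse_coeff.simps inverse_bound.simps)
  next
    case False
    let ?S = "\<Sum>k\<in>{1..length xs}. A (take k xs) o\<^sub>L inverse_coeff A b (drop k xs)"
    let ?T = "\<Sum>k\<in>{1..length xs}. C k * inverse_bound C (norm b) (length xs - k)"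
    have "norm ?S \<le> (\<Sum>k\<in>{1..length xs}. (C k * inverse_bound C (norm b) (length xs - k)) * prod_list (map norm xs))"
    proof (rule sum_norm_le)
      fix k assume k: "k \<in> {1..length xs}"
      have s: "set (take k xs) \<subseteq> V" "set (drop k xs) \<subseteq> V"
        using less.prems set_take_subset set_drop_subset by fast+
      have len: "length (drop k xs) < length xs" using k by auto
      have 1: "norm (A (take k xs)) \<le> C k * prod_list (map norm (take k xs))"
        using series_boundD[OF assms(1) s(1)] k by (simp add: min_absorb2)
      have 2: "norm (inverse_coeff A b (drop k xs))
         \<le> inverse_bound C (norm b) (length xs - k) * prod_list (map norm (drop k xs))"
        using less.hyps[OF _ s(2)] k len by simp
      have "norm (A (take k xs) o\<^sub>L inverse_coeff A b (drop k xs))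
          \<le> norm (A (take k xs)) * norm (inverse_coeff A b (drop k xs))"
        by (rule norm_blinfun_compose)
      also have "\<dots> \<le> (C k * prod_list (map norm (take k xs))) *
          (inverse_bound C (norm b) (length xs - k) * prod_list (map norm (drop k xs)))"
        using C0 by (intro mult_mono 1 2 mult_nonneg_nonneg) auto
      also have "\<dots> = C k * inverse_bound C (norm b) (length xs - k) *
           prod_list (map norm (take k xs @ drop k xs))"
        by (simp only: map_append prod_list.append mult_ac)
      finally show "norm (A (take k xs) o\<^sub>L inverse_coeff A b (drop k xs))
         \<le> C k * inverse_bound C (norm b) (length xs - k) * prod_list (map norm xs)" by simp
    qed
    then have S: "norm ?S \<le> ?T * prod_list (map norm xs)" by (simp add: sum_distrib_right)
    have "norm (inverse_coeff A b xs) = norm (b o\<^sub>L ?S)"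
      by (subst inverse_coeff.simps) (use False in simp)
    also have "\<dots> \<le> norm b * norm ?S" by (rule norm_blinfun_compose)
    also have "\<dots> \<le> norm b * (?T * prod_list (map norm xs))" using S by (rule mult_left_mono) simp
    also have "\<dots> = inverse_bound C (norm b) (length xs) * prod_list (map norm xs)"
      by (subst (2) inverse_bound.simps) (use False in simp)
    finally show ?thesis .
  qed
qed

text \<open>Let S be the sum of \<open>C n * r ^ n\<close>. Shrinking \<open>r\<close> to t r
  multiplies every term with n >= 1 by at most t, and t = 1 / (1 + \<beta> S) makes \<beta> t S <=
  1. Induction then keeps \<open>inverse_bound C \<beta> n * s ^ n\<close> below \<beta>, and
  halving \<open>s\<close> once more yields geometric convergence.\<close>

lemma summable_inverse_bound:
  assumes C0: "\<And>n. 0 \<le> C n" and \<beta>: "0 \<le> \<beta>" and r: "0 < r" and sC: "summable (\<lambda>n. C n * r ^ n)"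
  obtains s where "0 < s" "s \<le> r" "summable (\<lambda>n. inverse_bound C \<beta> n * s ^ n)"
proof -
  define S where "S = (\<Sum>n. C n * r ^ n)"
  have S0: "0 \<le> S" unfolding S_def using C0 r by (intro suminf_nonneg sC) auto
  define t where "t = 1 / (1 + \<beta> * S)"
  have t: "0 < t" "t \<le> 1" using \<beta> S0 by (auto simp: t_def add_pos_nonneg)
  have tS: "\<beta> * (t * S) \<le> 1"
    unfolding t_def using \<beta> S0 by (simp add: field_simps add_pos_nonneg)
  define s where "s = t * r"
  have s: "0 < s" "s \<le> r" using t r by (auto simp: s_def mult_le_cancel_right1)
  have bd: "inverse_bound C \<beta> n * s ^ n \<le> \<beta>" for n
  proof (induction n rule: less_induct)
    case (less n)
    show ?case
    proof (cases "n = 0")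
      case False
      have "(\<Sum>k\<in>{1..n}. C k * inverse_bound C \<beta> (n - k)) * s ^ n
          = (\<Sum>k\<in>{1..n}. (C k * s ^ k) * (inverse_bound C \<beta> (n - k) * s ^ (n - k)))"
        unfolding sum_distrib_right
      proof (rule sum.cong[OF refl])
        fix k assume "k \<in> {1..n}"
        then have "s ^ n = s ^ k * s ^ (n - k)" by (simp flip: power_add)
        then show "C k * inverse_bound C \<beta> (n - k) * s ^ n
            = C k * s ^ k * (inverse_bound C \<beta> (n - k) * s ^ (n - k))" by simp
      qed
      also have "\<dots> \<le> (\<Sum>k\<in>{1..n}. (t * (C k * r ^ k)) * \<beta>)"
      proof (rule sum_mono)
        fix k assume k: "k \<in> {1..n}"
        have "t ^ k \<le> t" using power_decreasing[of 1 k t] t k by simp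
        then have "C k * s ^ k \<le> t * (C k * r ^ k)"
          using mult_right_mono[of "t ^ k" t "C k * r ^ k"] C0[of k] r
          by (simp add: s_def power_mult_distrib mult_ac)
        then show "(C k * s ^ k) * (inverse_bound C \<beta> (n - k) * s ^ (n - k)) \<le> (t * (C k * r ^ k)) * \<beta>"
          using k less[of "n - k"] inverse_bound_nonneg[of C \<beta> "n - k"] \<beta> C0 s t C0[of k] r
          by (intro mult_mono[of _ "t * (C k * r ^ k)" _ \<beta>]) (auto intro!: mult_nonneg_nonneg)
      qed
      also have "\<dots> = \<beta> * (t * (\<Sum>k\<in>{1..n}. C k * r ^ k))"
        by (simp add: sum_distrib_left mult_ac)
      also have "\<dots> \<le> \<beta> * (t * S)"
        unfolding S_def using sum_le_suminf[OF sC, of "{1..n}"] C0 r t \<beta>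
        by (intro mult_left_mono) auto
      also have "\<dots> \<le> 1" by (rule tS)
      finally have "\<beta> * ((\<Sum>k\<in>{1..n}. C k * inverse_bound C \<beta> (n - k)) * s ^ n) \<le> \<beta> * 1"
        using \<beta> by (intro mult_left_mono) auto
      then show ?thesis using False by (subst inverse_bound.simps) (simp add: mult.assoc)
    qed (simp add: inverse_bound.simps)
  qed
  have "summable (\<lambda>n. \<beta> * (1/2) ^ n)" by (intro summable_mult summable_geometric) auto
  then have "summable (\<lambda>n. inverse_bound C \<beta> n * (s/2) ^ n)"
  proof (rule summable_comparison_test'[where N = 0])
    fix n
    have "inverse_bound C \<beta> n * s ^ n * (1/2) ^ n \<le> \<beta> * (1/2) ^ n"
      using bd by (intro mult_right_mono) auto
    then show "norm (inverse_bound C \<beta> n * (s/2) ^ n) \<le> \<beta> * (1/2) ^ n"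
      using inverse_bound_nonneg[of C \<beta> n] C0 \<beta> s by (simp add: power_divide)
  qed
  then show ?thesis using s by (intro that[of "s/2"]) auto
qed

lemma analytic_right_inverse:
  fixes f :: "'a::real_normed_vector \<Rightarrow> ('k::banach \<Rightarrow>\<^sub>L 'k)"
  assumes V: "0 \<in> V" and f: "analytic_at_in V f x" and inv: "op_invertible (f x)"
  obtains g s where "analytic_at_in V g x" "s > 0" "g x = op_inv (f x)"
    "\<And>h. h \<in> V \<Longrightarrow> norm h < s \<Longrightarrow> f (x + h) o\<^sub>L g (x + h) = id_blinfun"
proof -
  obtain A C r where "has_series V f x A C r"
    using analytic_at_inE[OF f zero_less_one] by blast
  note A = has_seriesD[OF this]
  define b where "b = op_inv (f x)"
  define B where "B = inverse_coeff A b"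
  define D where "D = inverse_bound C (norm b)"
  \<comment> \<open>A multilinear term with an argument 0 vanishes, so evaluating a series at h = 0
    isolates the coefficient of the empty list; this identifies the constant terms of both
    series.\<close>
  have zero: "multilinear_on V A' \<Longrightarrow> A' (replicate n 0) = (if n = 0 then A' [] else 0)"
    for A' :: "'a list \<Rightarrow> 'k \<Rightarrow>\<^sub>L 'k" and n
    using multilinear_onD[of V A' 0 0 "[]" "replicate (n - 1) 0" 0 0] V
    by (cases n) (auto simp: set_replicate_conv_if)
  have at0: "A' [] = y" if "multilinear_on V A'" "(\<lambda>n. A' (replicate n 0)) sums y" for A' :: "'a list \<Rightarrow> 'k \<Rightarrow>\<^sub>L 'k" and y
  proof -
    have "(\<lambda>n. if n = 0 then A' [] else 0) sums y" using that zero by simp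
    then show ?thesis using sums_single[of 0 "\<lambda>_. A' []"] sums_unique2 by fastforce
  qed
  have A_Nil: "A [] = f x" using at0[OF A(2)] A(5)[OF V] A(1) by simp
  obtain s where s: "0 < s" "s \<le> r" and sD: "summable (\<lambda>n. D n * s ^ n)"
    using summable_inverse_bound[of C "norm b" r] A(1,4,6) unfolding D_def by auto
  have B1: "multilinear_on V B"
    unfolding multilinear_on_def B_def using multilinear_inverse_coeff[OF A(2)] by blast
  have B2: "series_bound V B D"
    unfolding series_bound_def D_def B_def
    using bound_inverse_coeff[OF A(3)] inverse_bound_nonneg[of C "norm b"] A(6) by auto
  \<comment> \<open>Written as a sum at every \<open>y\<close>; only the values near
    \<open>x\<close> in directions of \<open>V\<close> are used.\<close>
  define g where "g y = (\<Sum>n. B (replicate n (y - x)))" for y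
  have B3: "(\<lambda>n. B (replicate n h)) sums g (x + h)" if "h \<in> V" "norm h < s" for h
    unfolding g_def using summable_norm_cancel[OF series_summable_norm[OF B2 sD, of h]] that
    by (simp add: summable_sums)
  have sC: "summable (\<lambda>n. C n * s ^ n)"
    using series_bound_mono_radius[OF A(6,4)] s by auto
  \<comment> \<open>The recursion is designed for this: multiplying it by \<open>A []\<close>
    cancels \<open>b\<close>, so the term k = 0 balances all the others.\<close>
  have coeff: "(\<Sum>k\<le>n. A (replicate k h) o\<^sub>L B (replicate (n - k) h)) = (if n = 0 then id_blinfun else 0)" for n h
  proof (cases "n = 0")
    case True
    then show ?thesis
      using op_inv[OF inv] by (simp add: A_Nil B_def inverse_coeff.simps b_def)
  next
    case False
    let ?S = "\<Sum>k\<in>{1..n}. A (replicate k h) o\<^sub>L B (replicate (n - k) h)"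
    have "B (replicate n h) = - (b o\<^sub>L (\<Sum>k\<in>{1..n}. A (take k (replicate n h)) o\<^sub>L B (drop k (replicate n h))))"
      unfolding B_def by (subst inverse_coeff.simps) (use False in simp)
    also have "(\<Sum>k\<in>{1..n}. A (take k (replicate n h)) o\<^sub>L B (drop k (replicate n h))) = ?S"
      by (intro sum.cong) (auto simp: min_absorb2)
    finally have "A [] o\<^sub>L B (replicate n h) = - ?S"
      by (simp add: A_Nil b_def compose_simps op_inv_assoc[OF inv])
    moreover have "{..n} = insert 0 {1..n}" by auto
    ultimately show ?thesis using False by simp
  qed
  show ?thesis
  proof (rule that[of g s])
    show "analytic_at_in V g x"
      by (rule analytic_at_inI[OF s(1) B1 B2 sD B3])
    have "B [] = g (x + 0)" using at0[OF B1 B3[OF V]] s by simp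
    then show "g x = op_inv (f x)" by (simp add: B_def inverse_coeff.simps b_def)
    fix h assume h: "h \<in> V" "norm h < s"
    have "(\<lambda>n. \<Sum>k\<le>n. A (replicate k h) o\<^sub>L B (replicate (n - k) h)) sums (f (x + h) o\<^sub>L g (x + h))"
      using series_summable_norm[OF A(3) sC, of h] series_summable_norm[OF B2 sD, of h] A(5)[of h] B3[of h] h s
      by (intro sums_bilinear_Cauchy[OF bounded_bilinear_blinfun_compose]) auto
    then have "(\<lambda>n. if n = 0 then id_blinfun else 0) sums (f (x + h) o\<^sub>L g (x + h))"
      by (simp only: coeff)
    then show "f (x + h) o\<^sub>L g (x + h) = id_blinfun"
      using sums_single[of 0 "\<lambda>_. id_blinfun :: 'k \<Rightarrow>\<^sub>L 'k"] sums_unique2 by fastforce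
  qed (use s in auto)
qed

text \<open>A right inverse \<open>g\<close> of \<open>f\<close> near \<open>x\<close> has itself a right inverse, hence both are
  invertible; this also shows that invertibility is an open condition.\<close>

lemma analytic_op_inv:
  fixes f :: "'a::real_normed_vector \<Rightarrow> ('k::banach \<Rightarrow>\<^sub>L 'k)"
  assumes V: "0 \<in> V" and f: "analytic_at_in V f x" and inv: "op_invertible (f x)"
  shows "analytic_at_in V (\<lambda>y. op_inv (f y)) x"
    and "\<exists>s>0. \<forall>h\<in>V. norm h < s \<longrightarrow> op_invertible (f (x + h))"
proof -
  obtain g s where g: "analytic_at_in V g x" "s > 0" "g x = op_inv (f x)"
    and fg: "\<And>h. h \<in> V \<Longrightarrow> norm h < s \<Longrightarrow> f (x + h) o\<^sub>L g (x + h) = id_blinfun"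
    using analytic_right_inverse[OF V f inv] by blast
  have "op_invertible (g x)"
    using op_inv[OF inv] unfolding g(3) op_invertible_def by blast
  from analytic_right_inverse[OF V g(1) this]
  obtain g' t where t: "t > 0"
    and gg: "\<And>h. h \<in> V \<Longrightarrow> norm h < t \<Longrightarrow> g (x + h) o\<^sub>L g' (x + h) = id_blinfun"
    by blast
  have *: "op_invertible (f (x + h)) \<and> op_inv (f (x + h)) = g (x + h)" if "h \<in> V" "norm h < min s t" for h
  proof -
    have fh: "f (x + h) o\<^sub>L g (x + h) = id_blinfun" using fg that by simp
    have gh: "g (x + h) o\<^sub>L g' (x + h) = id_blinfun" using gg that by simp
    have "g (x + h) o\<^sub>L f (x + h) = id_blinfun"
      using op_inv(1)[OF op_inv_unique(1)[OF gh fh]] op_inv_unique(3)[OF gh fh] by simp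
    from op_inv_unique(1,2)[OF fh this] show ?thesis by simp
  qed
  show "\<exists>s>0. \<forall>h\<in>V. norm h < s \<longrightarrow> op_invertible (f (x + h))"
    using * g(2) t by (intro exI[of _ "min s t"]) auto
  show "analytic_at_in V (\<lambda>y. op_inv (f y)) x"
    by (rule analytic_at_in_cong[OF g(1), where s = "min s t"]) (use * g(2) t in auto)
qed

text \<open>Coordinate domains below are described by invertibility of an analytic operator, so this
  is the source of their openness.\<close>

lemma openin_op_invertible:
  fixes f :: "'a::real_normed_vector \<Rightarrow> ('k::banach \<Rightarrow>\<^sub>L 'k)"
  assumes V: "subspace V" and U: "openin (top_of_set V) U"
    and f: "\<And>x. x \<in> U \<Longrightarrow> analytic_at_in V f x"
  shows "openin (top_of_set V) {x \<in> U. op_invertible (f x)}"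
proof (rule openin_subspaceI[OF V])
  show "{x \<in> U. op_invertible (f x)} \<subseteq> V" using openin_imp_subset[OF U] by auto
  fix x assume "x \<in> {x \<in> U. op_invertible (f x)}"
  then have x: "x \<in> U" "op_invertible (f x)" by auto
  obtain s where s: "s > 0" "\<And>h. h \<in> V \<Longrightarrow> norm h < s \<Longrightarrow> x + h \<in> U"
    using openin_subspace_ball[OF U x(1) V] by blast
  obtain t where t: "t > 0" "\<And>h. h \<in> V \<Longrightarrow> norm h < t \<Longrightarrow> op_invertible (f (x + h))"
    using analytic_op_inv(2)[OF subspace_0[OF V] f x(2)] x(1) by blast
  show "\<exists>s>0. \<forall>h\<in>V. norm h < s \<longrightarrow> x + h \<in> {x \<in> U. op_invertible (f x)}"
    using s t by (intro exI[of _ "min s t"]) auto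
qed

section \<open>Bounded projections onto closed complements\<close>

lemma Baire_closed_Union:
  fixes C :: "nat \<Rightarrow> 'a::complete_space set"
  assumes "\<And>n. closed (C n)" "(\<Union>n. C n) = UNIV"
  obtains n where "interior (C n) \<noteq> {}"
proof (rule ccontr)
  assume "\<not> thesis"
  with that have "interior (C n) = {}" for n by blast
  then have "euclidean interior_of \<Union>(range C) = {}"
    using assms(1) by (intro Baire_category_alt) (auto simp: completely_metrizable_space_euclidean)
  then show False using assms(2) by simp
qed

text \<open>By Baire, some closure of {x. norm (f x) <= n} contains a ball. Hence every vector can
  be approximated arbitrarily well by vectors u with norm (f u) controlled linearly. Approximating
  the remainder again and again writes x as a series whose images converge absolutely, and the
  closed graph identifies their sum with f x.\<close>

lemma closed_graph_theorem:
  fixes f :: "'a::banach \<Rightarrow> 'b::banach"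
  assumes lin: "linear f"
    and graph: "\<And>X x y. X \<longlonglongrightarrow> x \<Longrightarrow> (\<lambda>n. f (X n)) \<longlonglongrightarrow> y \<Longrightarrow> f x = y"
  shows "bounded_linear f"
proof -
  interpret linear f by fact
  have "closed (closure {x. norm (f x) \<le> real n})" for n by simp
  moreover have "(\<Union>n. closure {x. norm (f x) \<le> real n}) = UNIV"
  proof safe
    fix x
    obtain n where "norm (f x) \<le> real n" using real_arch_simple by blast
    then show "x \<in> (\<Union>n. closure {x. norm (f x) \<le> real n})"
      by (intro UN_I[of n] subsetD[OF closure_subset]) simp_all
  qed simp
  ultimately obtain n where "interior (closure {x. norm (f x) \<le> real n}) \<noteq> {}"
    by (rule Baire_closed_Union)
  then obtain x0 r where r: "r > 0" and ball: "ball x0 r \<subseteq> closure {x. norm (f x) \<le> real n}"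
    by (metis all_not_in_conv mem_interior)
  \<comment> \<open>The ball is moved to the origin by subtracting approximants of
    \<open>x0 + h\<close> and \<open>x0\<close>, which doubles the bound \<open>n\<close>.\<close>
  have near: "\<exists>u. norm (h - u) < e \<and> norm (f u) \<le> 2 * real n" if "norm h < r" "e > 0" for h e
  proof -
    have "x0 + h \<in> closure {x. norm (f x) \<le> real n}" "x0 \<in> closure {x. norm (f x) \<le> real n}"
      using ball that r by (auto simp: dist_norm)
    then obtain u v where u: "norm (f u) \<le> real n" "dist u (x0 + h) < e/2"
      and v: "norm (f v) \<le> real n" "dist v x0 < e/2"
      using \<open>e > 0\<close> unfolding closure_approachable by (metis half_gt_zero mem_Collect_eq)
    have "norm (h - (u - v)) = norm (((x0 + h) - u) + (v - x0))" by (simp add: algebra_simps)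
    also have "\<dots> < e" using u v norm_triangle_ineq[of "(x0 + h) - u" "v - x0"]
      by (auto simp: dist_norm norm_minus_commute)
    finally have "norm (h - (u - v)) < e" .
    moreover have "norm (f (u - v)) \<le> 2 * real n"
      unfolding diff using norm_triangle_ineq4[of "f u" "f v"] u v by linarith
    ultimately show ?thesis by blast
  qed
  \<comment> \<open>Scaling x by c = r / (2 norm x) brings it into the ball, and dividing the bound
    2 n by c gives (4 n / r) norm x.\<close>
  define M where "M = 4 * real n / r"
  have "\<exists>u. norm (x - u) < e \<and> norm (f u) \<le> M * norm x" if e: "e > 0" for x e
  proof (cases "x = 0")
    case False
    define c where "c = r / (2 * norm x)"
    have c: "c > 0" "norm (c *\<^sub>R x) < r" using False r by (auto simp: c_def)
    obtain u where u: "norm (c *\<^sub>R x - u) < c * e" "norm (f u) \<le> 2 * real n"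
      using near[OF c(2), of "c * e"] c e by auto
    have "x - u /\<^sub>R c = (c *\<^sub>R x - u) /\<^sub>R c" using c by (simp add: scaleR_diff_right)
    then have "norm (x - u /\<^sub>R c) = norm (c *\<^sub>R x - u) / c" using c by (simp add: divide_inverse)
    also have "\<dots> < e" using u(1) c by (simp add: pos_divide_less_eq mult.commute)
    finally have 1: "norm (x - u /\<^sub>R c) < e" .
    have "norm (f (u /\<^sub>R c)) = norm (f u) / c" using c by (simp add: scale divide_inverse)
    also have "\<dots> \<le> 2 * real n / c" using u(2) c by (simp add: divide_right_mono)
    also have "\<dots> = M * norm x" using False r by (simp add: c_def M_def field_simps)
    finally show ?thesis using 1 by blast
  qed (use e zero in \<open>auto intro!: exI[of _ 0]\<close>)
  then have ex: "\<exists>u. e > 0 \<longrightarrow> norm (x - u) < e \<and> norm (f u) \<le> M * norm x" for x e by blast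
  define U where "U x e = (SOME u. e > 0 \<longrightarrow> norm (x - u) < e \<and> norm (f u) \<le> M * norm x)" for x e
  have U: "norm (x - U x e) < e" "norm (f (U x e)) \<le> M * norm x" if "e > 0" for x e
    using someI_ex[OF ex[of e x]] that unfolding U_def by blast+
  have "norm (f x) \<le> norm x * (2 * M)" for x
  proof (cases "x = 0")
    case False
    \<comment> \<open>\<open>X k\<close> is what remains of \<open>x\<close> after k approximations.
      The images of the removed pieces \<open>d k\<close> are dominated by a geometric series of
      ratio 1/2, whence the factor 2 in the final bound.\<close>
    define X where "X = rec_nat x (\<lambda>k y. y - U y (norm x / 2 ^ Suc k))"
    have X0: "X 0 = x" and XS: "X (Suc k) = X k - U (X k) (norm x / 2 ^ Suc k)" for k
      by (simp_all add: X_def)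
    have nX: "norm (X k) \<le> norm x / 2 ^ k" for k
    proof (cases k)
      case (Suc m)
      then show ?thesis using U(1)[of "norm x / 2 ^ Suc m" "X m"] False XS[of m] by simp
    qed (simp add: X0)
    define d where "d k = X k - X (Suc k)" for k
    have fd: "norm (f (d k)) \<le> M * norm x * (1/2) ^ k" for k
    proof -
      have "norm (f (d k)) \<le> M * norm (X k)"
        unfolding d_def XS using U(2)[of "norm x / 2 ^ Suc k" "X k"] False by simp
      also have "\<dots> \<le> M * (norm x / 2 ^ k)" using nX r by (intro mult_left_mono) (auto simp: M_def)
      finally show ?thesis by (simp add: power_one_over)
    qed
    have geo: "(\<lambda>k. M * norm x * (1/2) ^ k) sums (M * norm x * 2)"
      using sums_mult[OF geometric_sums[of "1/2::real"], of "M * norm x"] by simp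
    have s: "summable (\<lambda>k. norm (f (d k)))"
      by (rule summable_comparison_test'[OF sums_summable[OF geo], where N = 0]) (use fd in auto)
    have "X \<longlonglongrightarrow> 0"
    proof (rule Lim_null_comparison[OF always_eventually])
      show "\<forall>k. norm (X k) \<le> norm x * (1/2) ^ k"
        using nX by (simp add: power_one_over)
      show "(\<lambda>k. norm x * (1/2) ^ k) \<longlonglongrightarrow> 0"
        by (intro tendsto_mult_right_zero LIMSEQ_power_zero) simp
    qed
    then have "(\<lambda>n. x - X n) \<longlonglongrightarrow> x" using tendsto_diff[OF tendsto_const, of X 0 _ x] by simp
    moreover have "f (x - X n) = (\<Sum>k<n. f (d k))" for n
      unfolding d_def sum[symmetric] sum_lessThan_telescope' X0 ..
    then have "(\<lambda>n. f (x - X n)) \<longlonglongrightarrow> (\<Sum>k. f (d k))"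
      using summable_LIMSEQ[OF summable_norm_cancel[OF s]] by simp
    ultimately have "f x = (\<Sum>k. f (d k))" by (rule graph)
    then have "norm (f x) \<le> (\<Sum>k. norm (f (d k)))" using summable_norm[OF s] by simp
    also have "\<dots> \<le> M * norm x * 2" by (rule order_trans[OF suminf_le[OF fd s sums_summable[OF geo]]]) (use sums_unique[OF geo] in simp)
    finally show ?thesis by (simp add: mult_ac)
  qed (simp add: zero)
  then show ?thesis by (intro bounded_linear_intro[of f "2 * M"] add scale)
qed

section \<open>Complementary pairs and projections along a complement\<close>

definition complements :: "'a::real_normed_vector set \<Rightarrow> 'a set \<Rightarrow> bool" where
  "complements E F \<longleftrightarrow> subspace E \<and> closed E \<and> subspace F \<and> closed F \<and>
     E \<inter> F = {0} \<and> {x + y |x y. x \<in> E \<and> y \<in> F} = UNIV"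

lemma complements_iff:
  "E \<in> closed_complements_in UNIV F \<and> subspace F \<and> closed F \<longleftrightarrow> complements E F"
  by (auto simp: closed_complements_in_def complements_def)

lemma complementsI:
  assumes "subspace E" "closed E" "subspace F" "closed F"
    "\<And>x. x \<in> E \<Longrightarrow> x \<in> F \<Longrightarrow> x = 0" "\<And>x. \<exists>y\<in>E. x - y \<in> F"
  shows "complements E F"
proof -
  have "\<exists>u v. x = u + v \<and> u \<in> E \<and> v \<in> F" for x
    using assms(6)[of x] by (metis add.commute diff_add_cancel)
  then show ?thesis using assms(1-5) by (auto simp: complements_def subspace_0)
qed

lemma complementsD:
  assumes "complements E F"
  shows "subspace E" "closed E" "subspace F" "closed F"
    and "x \<in> E \<Longrightarrow> x \<in> F \<Longrightarrow> x = 0" and "\<exists>y\<in>E. x - y \<in> F"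
proof -
  show "subspace E" "closed E" "subspace F" "closed F" "x \<in> E \<Longrightarrow> x \<in> F \<Longrightarrow> x = 0"
    using assms by (auto simp: complements_def)
  have "x \<in> {x + y |x y. x \<in> E \<and> y \<in> F}" using assms by (simp add: complements_def)
  then obtain u v where "x = u + v" "u \<in> E" "v \<in> F" by blast
  then show "\<exists>y\<in>E. x - y \<in> F" by (intro bexI[of _ u]) simp_all
qed

lemma complements_sym:
  assumes "complements E F"
  shows "complements F E"
proof (rule complementsI)
  show "\<exists>y\<in>F. x - y \<in> E" for x
    using complementsD(6)[OF assms, of x] by (metis diff_diff_eq2 add_diff_cancel_left')
qed (use complementsD(1-5)[OF assms] in auto)

lemma complements_ex1:
  assumes "complements E F"
  shows "\<exists>!y. y \<in> E \<and> x - y \<in> F"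
proof -
  obtain y where y: "y \<in> E" "x - y \<in> F" using complementsD(6)[OF assms] by blast
  moreover have "z = y" if "z \<in> E" "x - z \<in> F" for z
  proof -
    have "z - y \<in> E" using that y complementsD(1)[OF assms] by (simp add: subspace_diff)
    moreover have "(x - y) - (x - z) \<in> F"
      by (rule subspace_diff[OF complementsD(3)[OF assms] y(2) that(2)])
    then have "z - y \<in> F" by simp
    ultimately show ?thesis using complementsD(5)[OF assms] by fastforce
  qed
  ultimately show ?thesis by blast
qed

text \<open>The oblique projection onto \<open>E\<close> along \<open>F\<close>;
  \<open>obl E F\<close> is meaningful for complementary pairs.\<close>

definition obl :: "'a::real_normed_vector set \<Rightarrow> 'a set \<Rightarrow> ('a \<Rightarrow>\<^sub>L 'a)" where
  "obl E F = Blinfun (\<lambda>x. THE y. y \<in> E \<and> x - y \<in> F)"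

text \<open>If x_n tends to x and the projections tend to y, then y stays in the closed set
  \<open>E\<close> and x - y in the closed set \<open>F\<close>, so y is the projection of x. This
  is the closed graph.\<close>

lemma bounded_linear_complement_projection:
  fixes E :: "'a::banach set"
  assumes c: "complements E F"
  shows "bounded_linear (\<lambda>x. THE y. y \<in> E \<and> x - y \<in> F)" (is "bounded_linear ?f")
proof (rule closed_graph_theorem)
  have f: "?f x \<in> E" "x - ?f x \<in> F" for x
    using theI'[OF complements_ex1[OF c, of x]] by auto
  have eq: "?f x = y" if "y \<in> E" "x - y \<in> F" for x y
    using the1_equality[OF complements_ex1[OF c, of x]] that by auto
  note E = complementsD(1,2)[OF c] and F = complementsD(3,4)[OF c]
  show "linear ?f"
  proof (rule linearI)
    fix x y
    have "(x - ?f x) + (y - ?f y) \<in> F" by (rule subspace_add[OF F(1) f(2) f(2)])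
    then have "x + y - (?f x + ?f y) \<in> F" by (simp add: algebra_simps)
    then show "?f (x + y) = ?f x + ?f y"
      by (rule eq[OF subspace_add[OF E(1) f(1) f(1)]])
  next
    fix a x
    have "a *\<^sub>R (x - ?f x) \<in> F" by (rule subspace_scale[OF F(1) f(2)])
    then have "a *\<^sub>R x - a *\<^sub>R ?f x \<in> F" by (simp add: scaleR_diff_right)
    then show "?f (a *\<^sub>R x) = a *\<^sub>R ?f x"
      by (rule eq[OF subspace_scale[OF E(1) f(1)]])
  qed
  fix X x y assume X: "X \<longlonglongrightarrow> x" "(\<lambda>n. ?f (X n)) \<longlonglongrightarrow> y"
  show "?f x = y"
  proof (rule eq)
    show "y \<in> E" using closed_sequentially[OF E(2) f(1) X(2)] .
    show "x - y \<in> F" by (rule closed_sequentially[OF F(2) f(2) tendsto_diff[OF X]])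
  qed
qed

lemma
  fixes E :: "'a::banach set"
  assumes c: "complements E F"
  shows obl_in: "obl E F x \<in> E" and obl_diff_in: "x - obl E F x \<in> F"
    and obl_eqI: "y \<in> E \<Longrightarrow> x - y \<in> F \<Longrightarrow> obl E F x = y"
proof -
  have *: "blinfun_apply (obl E F) x = (THE y. y \<in> E \<and> x - y \<in> F)"
    unfolding obl_def by (simp add: bounded_linear_Blinfun_apply[OF bounded_linear_complement_projection[OF c]])
  show "obl E F x \<in> E" "x - obl E F x \<in> F"
    using theI'[OF complements_ex1[OF c, of x]] unfolding * by auto
  show "y \<in> E \<Longrightarrow> x - y \<in> F \<Longrightarrow> obl E F x = y"
    using the1_equality[OF complements_ex1[OF c, of x]] unfolding * by auto
qed

lemma obl_id: "complements E F \<Longrightarrow> x \<in> E \<Longrightarrow> obl E F x = x" for E :: "'a::banach set"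
  using obl_eqI[of E F x x] complementsD(3)[of E F] by (simp add: subspace_0)

lemma obl_zero: "complements E F \<Longrightarrow> obl E F x = 0 \<longleftrightarrow> x \<in> F" for E :: "'a::banach set"
  using obl_eqI[of E F 0 x] obl_diff_in[of E F x] complementsD(1)[of E F] by (auto simp: subspace_0)

lemma obl_range: "complements E F \<Longrightarrow> range (obl E F) = E" for E :: "'a::banach set"
  using obl_in obl_id by (metis (no_types, lifting) UNIV_I image_subset_iff rangeI subsetI subset_antisym)

text \<open>With a common range the right factor survives, with a common kernel (next lemma) the
  left one. These two absorption rules carry most of the later operator algebra.\<close>

lemma obl_same_range:
  fixes E :: "'a::banach set"
  assumes "complements E F" "complements E G"
  shows "obl E F o\<^sub>L obl E G = obl E G"
  using assms by (intro blinfun_eqI) (simp add: obl_id obl_in)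

lemma obl_same_kernel:
  fixes E :: "'a::banach set"
  assumes "complements E F" "complements G F"
  shows "obl E F o\<^sub>L obl G F = obl E F"
proof (rule blinfun_eqI)
  fix x
  have "obl E F (x - obl G F x) = 0"
    using obl_zero[OF assms(1)] obl_diff_in[OF assms(2)] by blast
  then show "(obl E F o\<^sub>L obl G F) x = obl E F x" by (simp add: blinfun.diff_right)
qed

lemma obl_idem: "complements E F \<Longrightarrow> obl E F o\<^sub>L obl E F = obl E F" for E :: "'a::banach set"
  by (rule obl_same_range)

lemma obl_swap: "complements E F \<Longrightarrow> obl F E = id_blinfun - obl E F" for E :: "'a::banach set"
proof (rule blinfun_eqI)
  fix x assume c: "complements E F"
  have "obl F E x = x - obl E F x"
    by (rule obl_eqI[OF complements_sym[OF c]]) (use obl_in[OF c] obl_diff_in[OF c] in auto)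
  then show "obl F E x = (id_blinfun - obl E F) x" by (simp add: blinfun.diff_left)
qed

lemma
  fixes Q :: "'a::banach \<Rightarrow>\<^sub>L 'a"
  assumes "Q o\<^sub>L Q = Q"
  shows idem_complements: "complements (range Q) {x. Q x = 0}"
    and idem_eq_obl: "Q = obl (range Q) {x. Q x = 0}"
proof -
  have QQ: "Q (Q x) = Q x" for x using assms by (metis blinfun_apply_blinfun_compose)
  \<comment> \<open>The range as a set of fixed points is visibly closed.\<close>
  have range: "range Q = {x. Q x = x}" using QQ by auto (metis rangeI)
  show c: "complements (range Q) {x. Q x = 0}"
  proof (rule complementsI)
    show "closed (range Q)" unfolding range
      by (intro closed_Collect_eq continuous_intros)
    show "closed {x. Q x = 0}" by (intro closed_Collect_eq continuous_intros)
    show "\<exists>y\<in>range Q. x - y \<in> {x. Q x = 0}" for x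
      by (rule bexI[of _ "Q x"]) (auto simp: blinfun.diff_right QQ)
  qed (auto simp: range subspace_def blinfun.add_right blinfun.scaleR_right blinfun.zero_right)
  show "Q = obl (range Q) {x. Q x = 0}"
    by (rule blinfun_eqI, rule sym, rule obl_eqI[OF c]) (auto simp: blinfun.diff_right QQ)
qed

lemma obl_unique:
  fixes Q :: "'a::banach \<Rightarrow>\<^sub>L 'a"
  assumes "Q o\<^sub>L Q = Q" "range Q = E" "\<And>x. Q x = 0 \<longleftrightarrow> x \<in> F"
  shows "complements E F" "Q = obl E F"
proof -
  have "F = {x. Q x = 0}" using assms(3) by auto
  then show "complements E F" "Q = obl E F"
    using idem_complements[OF assms(1)] idem_eq_obl[OF assms(1)] assms(2) by auto
qed

section \<open>Orthogonal projections and adjoints\<close>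

lemma orth_comp_iff: "x \<in> E\<^sup>\<bottom> \<longleftrightarrow> (\<forall>y\<in>E. x \<bullet> y = 0)"
  by (auto simp: orthogonal_comp_def orthogonal_def inner_commute)

lemma closed_orthogonal_comp: "closed (E\<^sup>\<bottom>)"
proof -
  have "E\<^sup>\<bottom> = (\<Inter>y\<in>E. {x. x \<bullet> y = 0})" by (auto simp: orth_comp_iff)
  then show ?thesis by (auto intro!: closed_INT closed_Collect_eq continuous_intros)
qed

text \<open>A nearest point \<open>a\<close> of \<open>E\<close> is found as the common point of the
  nested closed sets of almost nearest points, whose diameters shrink by the parallelogram law.
  Minimality of the distance forces x - a to be orthogonal to \<open>E\<close>.\<close>

lemma complements_orthogonal:
  fixes E :: "'k::{real_inner,banach} set"
  assumes E: "subspace E" "closed E"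
  shows "complements E (E\<^sup>\<bottom>)"
proof (rule complementsI)
  show "x = 0" if "x \<in> E" "x \<in> E\<^sup>\<bottom>" for x
    using that by (auto simp: orth_comp_iff)
  fix x :: 'k
  define d where "d = infdist x E"
  have ne: "E \<noteq> {}" using subspace_0[OF E(1)] by auto
  have d0: "0 \<le> d" by (simp add: d_def infdist_nonneg)
  have d: "d \<le> norm (x - y)" if "y \<in> E" for y
    using infdist_le[OF that, of x] by (simp add: d_def dist_norm)
  define S where "S n = E \<inter> cball x (d + inverse (real (Suc n)))" for n
  obtain a where a: "\<And>n. a \<in> S n"
  proof (rule decreasing_closed_nest[of S])
    show "closed (S n)" for n unfolding S_def using E(2) by (intro closed_Int closed_cball)
    show "S n \<noteq> {}" for n
    proof -
      have "infdist x E < d + inverse (real (Suc n))" by (simp add: d_def)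
      then obtain y where "y \<in> E" "dist x y < d + inverse (real (Suc n))"
        unfolding infdist_notempty[OF ne] by (subst (asm) cINF_less_iff) (use ne in auto)
      then show ?thesis unfolding S_def by (auto intro!: exI[of _ y])
    qed
    show "S n \<subseteq> S m" if "m \<le> n" for m n
    proof -
      have "inverse (real (Suc n)) \<le> inverse (real (Suc m))"
        using that by (intro le_imp_inverse_le) auto
      then show ?thesis unfolding S_def by (intro Int_mono order_refl subset_cball add_left_mono)
    qed
    fix e :: real assume e: "e > 0"
    \<comment> \<open>For two points of \<open>S n\<close> the parallelogram law bounds the squared
      distance by 4 (d + \<epsilon>)^2 - 4 d^2 = 8 d \<epsilon> + 4 \<epsilon>^2.\<close>
    have "(\<lambda>n. 8 * d * inverse (real (Suc n)) + 4 * (inverse (real (Suc n)))\<^sup>2) \<longlonglongrightarrow> 8 * d * 0 + 4 * 0\<^sup>2"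
      by (intro tendsto_intros LIMSEQ_inverse_real_of_nat)
    then have "\<forall>\<^sub>F n in sequentially. 8 * d * inverse (real (Suc n)) + 4 * (inverse (real (Suc n)))\<^sup>2 < e\<^sup>2"
      by (rule order_tendstoD(2)) (use e in simp)
    then obtain n where n: "8 * d * inverse (real (Suc n)) + 4 * (inverse (real (Suc n)))\<^sup>2 < e\<^sup>2"
      using eventually_happens'[OF sequentially_bot] by blast
    define \<epsilon> where "\<epsilon> = inverse (real (Suc n))"
    have "dist y z < e" if "y \<in> S n" "z \<in> S n" for y z
    proof -
      have *: "norm (x - y) \<le> d + \<epsilon>" "norm (x - z) \<le> d + \<epsilon>" "y \<in> E" "z \<in> E"
        using that by (auto simp: S_def dist_norm \<epsilon>_def)
      have "(1/2) *\<^sub>R (y + z) \<in> E" using * E(1) by (intro subspace_scale subspace_add)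
      then have "d\<^sup>2 \<le> (norm (x - (1/2) *\<^sub>R (y + z)))\<^sup>2" using d d0 by (intro power_mono) auto
      moreover have "(norm (y - z))\<^sup>2 =
          2 * (norm (x - y))\<^sup>2 + 2 * (norm (x - z))\<^sup>2 - 4 * (norm (x - (1/2) *\<^sub>R (y + z)))\<^sup>2"
        unfolding power2_norm_eq_inner by (simp add: inner_simps inner_commute algebra_simps)
      moreover have "(norm (x - y))\<^sup>2 \<le> (d + \<epsilon>)\<^sup>2" "(norm (x - z))\<^sup>2 \<le> (d + \<epsilon>)\<^sup>2"
        using * by (auto intro!: power_mono)
      ultimately have "(norm (y - z))\<^sup>2 \<le> 4 * (d + \<epsilon>)\<^sup>2 - 4 * d\<^sup>2" by linarith
      also have "\<dots> = 8 * d * \<epsilon> + 4 * \<epsilon>\<^sup>2" by (simp add: power2_eq_square algebra_simps)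
      also have "\<dots> < e\<^sup>2" using n by (simp add: \<epsilon>_def)
      finally show ?thesis using e by (simp add: dist_norm power2_less_imp_less)
    qed
    then show "\<exists>n. \<forall>x\<in>S n. \<forall>y\<in>S n. dist x y < e" by blast
  qed (blast intro: that)
  have aE: "a \<in> E" using a[of 0] by (simp add: S_def)
  have "norm (x - a) \<le> d"
  proof (rule LIMSEQ_le_const)
    show "(\<lambda>n. d + inverse (real (Suc n))) \<longlonglongrightarrow> d"
      using tendsto_add[OF tendsto_const LIMSEQ_inverse_real_of_nat, of d] by simp
    show "\<exists>N. \<forall>n\<ge>N. norm (x - a) \<le> d + inverse (real (Suc n))"
      using a by (auto simp: S_def dist_norm)
  qed
  have "(x - a) \<bullet> z = 0" if z: "z \<in> E" for z
  proof (cases "z = 0")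
    case False
    \<comment> \<open>\<open>a + t *\<^sub>R z\<close> is the point nearest to \<open>x\<close> on
      the line through \<open>a\<close> in direction \<open>z\<close>. Passing to it would reduce
      the squared distance by ((x - a) \<bullet> z)^2 / (z \<bullet> z), so this quantity must
      vanish.\<close>
    define t where "t = ((x - a) \<bullet> z) / (z \<bullet> z)"
    have "a + t *\<^sub>R z \<in> E" using aE z E(1) by (intro subspace_add subspace_scale)
    then have "norm (x - a) \<le> norm (x - (a + t *\<^sub>R z))" using d \<open>norm (x - a) \<le> d\<close> by force
    then have "(norm (x - a))\<^sup>2 \<le> (norm ((x - a) - t *\<^sub>R z))\<^sup>2"
      by (intro power_mono) (auto simp: algebra_simps)
    also have "\<dots> = (norm (x - a))\<^sup>2 - 2 * t * ((x - a) \<bullet> z) + t * (t * (z \<bullet> z))"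
      unfolding power2_norm_eq_inner by (simp add: inner_simps inner_commute algebra_simps)
    also have "t * (z \<bullet> z) = (x - a) \<bullet> z" using False by (simp add: t_def)
    finally have "t * ((x - a) \<bullet> z) \<le> 0" by simp
    then have "t * ((x - a) \<bullet> z) * (z \<bullet> z) \<le> 0" by (rule mult_nonpos_nonneg) simp
    moreover have "t * ((x - a) \<bullet> z) * (z \<bullet> z) = ((x - a) \<bullet> z)\<^sup>2"
      using False by (simp add: t_def power2_eq_square)
    ultimately show ?thesis by simp
  qed simp
  then show "\<exists>y\<in>E. x - y \<in> E\<^sup>\<bottom>" using aE by (auto simp: orth_comp_iff)
qed (use E in \<open>auto simp: subspace_orthogonal_comp closed_orthogonal_comp\<close>)

definition proj :: "'k::real_inner set \<Rightarrow> ('k \<Rightarrow>\<^sub>L 'k)" where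
  "proj E = obl E (E\<^sup>\<bottom>)"

lemma proj_apply:
  fixes E :: "'k::{real_inner,banach} set"
  assumes "subspace E" "closed E"
  shows "blinfun_apply (proj E) = orth_proj E"
  unfolding proj_def obl_def orth_proj_def[abs_def]
  using bounded_linear_Blinfun_apply[OF bounded_linear_complement_projection[OF complements_orthogonal[OF assms]]] .

lemma orthogonal_comp_comp:
  fixes E :: "'k::{real_inner,banach} set"
  assumes "subspace E" "closed E"
  shows "E\<^sup>\<bottom>\<^sup>\<bottom> = E"
proof
  show "E\<^sup>\<bottom>\<^sup>\<bottom> \<subseteq> E"
  proof
    fix x assume x: "x \<in> E\<^sup>\<bottom>\<^sup>\<bottom>"
    obtain y where y: "y \<in> E" "x - y \<in> E\<^sup>\<bottom>"
      using complementsD(6)[OF complements_orthogonal[OF assms]] by blast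
    have "x - y \<in> E\<^sup>\<bottom>\<^sup>\<bottom>"
      using x y orthogonal_comp_subset[of E] by (intro subspace_diff subspace_orthogonal_comp) auto
    with y(2) have "(x - y) \<bullet> (x - y) = 0" by (auto simp: orth_comp_iff)
    then show "x \<in> E" using y by simp
  qed
qed (rule orthogonal_comp_subset)

lemma proj_orthogonal_comp:
  fixes E :: "'k::{real_inner,banach} set"
  assumes "subspace E" "closed E"
  shows "proj (E\<^sup>\<bottom>) = id_blinfun - proj E"
  using obl_swap[OF complements_orthogonal[OF assms]] assms
  by (simp add: proj_def orthogonal_comp_comp)

section \<open>Riesz representation and Hilbert space adjoints\<close>

lemma riesz_representation:
  fixes f :: "'k::{real_inner,banach} \<Rightarrow> real"
  assumes "bounded_linear f"
  obtains a where "\<And>x. f x = x \<bullet> a"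
proof (cases "\<exists>x. f x \<noteq> 0")
  case True
  interpret bounded_linear f by fact
  obtain u where u: "f u \<noteq> 0" using True by blast
  let ?N = "{x. f x = 0}"
  have N: "subspace ?N" "closed ?N"
    by (auto simp: subspace_def add scale zero intro!: closed_Collect_eq continuous_intros linear_continuous_on[OF assms])
  obtain y where y: "f y = 0" "u - y \<in> ?N\<^sup>\<bottom>"
    using complementsD(6)[OF complements_orthogonal[OF N], of u] by blast
  \<comment> \<open>The component of \<open>u\<close> orthogonal to the kernel of \<open>f\<close>.
    Subtracting (f x / f z) z from x lands in the kernel, so pairing x with z computes f x up to the
    factor f z / (z \<bullet> z).\<close>
  define z where "z = u - y"
  have fz: "f z \<noteq> 0" using u y by (simp add: z_def diff)
  then have z0: "z \<noteq> 0" using zero by auto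
  have "f x = x \<bullet> ((f z / (z \<bullet> z)) *\<^sub>R z)" for x
  proof -
    have "x - (f x / f z) *\<^sub>R z \<in> ?N" using fz by (simp add: diff scale)
    then have "z \<bullet> (x - (f x / f z) *\<^sub>R z) = 0"
      using y(2) unfolding z_def orth_comp_iff by blast
    then have "z \<bullet> x = (f x / f z) * (z \<bullet> z)" by (simp add: inner_diff_right)
    then show ?thesis using fz z0 by (simp add: inner_commute)
  qed
  then show ?thesis by (rule that)
qed (use that[of 0] in auto)

text \<open>\<open>adjoint\<close> is defined by choice, so its characteristic identity is available
  only once some adjoint exists; the Riesz vectors of the functionals x to
  \<open>Q x \<bullet> y\<close> provide one.\<close>

lemma adjoint_hilbert:
  fixes Q :: "'k::{real_inner,banach} \<Rightarrow>\<^sub>L 'k"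
  shows "x \<bullet> adjoint Q y = Q x \<bullet> y"
proof -
  have "\<exists>a. \<forall>x. Q x \<bullet> y = x \<bullet> a" for y
  proof -
    have "bounded_linear (\<lambda>x. Q x \<bullet> y)"
      by (intro bounded_linear_inner_left_comp blinfun.bounded_linear_right)
    then show ?thesis using riesz_representation by metis
  qed
  then obtain g where "\<forall>x y. Q x \<bullet> y = x \<bullet> g y" by metis
  then have "\<exists>g. \<forall>x y. Q x \<bullet> y = x \<bullet> g y" by blast
  from someI_ex[OF this, rule_format] show ?thesis unfolding adjoint_def by (rule sym)
qed

definition adj :: "('k::real_inner \<Rightarrow>\<^sub>L 'k) \<Rightarrow> ('k \<Rightarrow>\<^sub>L 'k)" where
  "adj Q = Blinfun (adjoint Q)"

lemma
  fixes Q :: "'k::{real_inner,banach} \<Rightarrow>\<^sub>L 'k"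
  shows adj_apply: "blinfun_apply (adj Q) = adjoint Q" and norm_adj_le: "norm (adj Q) \<le> norm Q"
proof -
  have bound: "norm (adjoint Q y) \<le> norm Q * norm y" for y
  proof (cases "adjoint Q y = 0")
    case False
    have "(norm (adjoint Q y))\<^sup>2 = Q (adjoint Q y) \<bullet> y"
      by (simp add: power2_norm_eq_inner adjoint_hilbert)
    also have "\<dots> \<le> norm (Q (adjoint Q y)) * norm y" by (rule norm_cauchy_schwarz)
    also have "\<dots> \<le> (norm Q * norm (adjoint Q y)) * norm y"
      by (intro mult_right_mono norm_blinfun) auto
    finally show ?thesis using False by (simp add: power2_eq_square mult_ac)
  qed simp
  have "bounded_linear (adjoint Q)"
  proof (rule bounded_linear_intro[of _ "norm Q"])
    show "adjoint Q (x + y) = adjoint Q x + adjoint Q y" for x y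
      by (rule vector_eq_ldot[THEN iffD1]) (simp add: adjoint_hilbert inner_add_right)
    show "adjoint Q (c *\<^sub>R x) = c *\<^sub>R adjoint Q x" for c x
      by (rule vector_eq_ldot[THEN iffD1]) (simp add: adjoint_hilbert)
    show "norm (adjoint Q x) \<le> norm x * norm Q" for x using bound by (simp add: mult.commute)
  qed
  then show *: "blinfun_apply (adj Q) = adjoint Q" by (simp add: adj_def bounded_linear_Blinfun_apply)
  show "norm (adj Q) \<le> norm Q" by (rule norm_blinfun_bound) (auto simp: * bound)
qed

lemma inner_adj: "x \<bullet> adj Q y = Q x \<bullet> y" for Q :: "'k::{real_inner,banach} \<Rightarrow>\<^sub>L 'k"
  by (simp add: adj_apply adjoint_hilbert)

lemma adj_eqI:
  fixes Q R :: "'k::{real_inner,banach} \<Rightarrow>\<^sub>L 'k"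
  assumes "\<And>x y. x \<bullet> R y = Q x \<bullet> y"
  shows "adj Q = R"
proof (rule blinfun_eqI)
  show "adj Q y = R y" for y
    by (rule vector_eq_ldot[THEN iffD1]) (simp add: inner_adj assms)
qed

lemma
  fixes A B :: "'k::{real_inner,banach} \<Rightarrow>\<^sub>L 'k"
  shows adj_add: "adj (A + B) = adj A + adj B" and adj_diff: "adj (A - B) = adj A - adj B"
    and adj_scaleR: "adj (c *\<^sub>R A) = c *\<^sub>R adj A" and adj_compose: "adj (A o\<^sub>L B) = adj B o\<^sub>L adj A"
    and adj_adj: "adj (adj A) = A" and adj_id: "adj id_blinfun = (id_blinfun :: 'k \<Rightarrow>\<^sub>L 'k)"
  by (auto intro!: adj_eqI simp: blinfun.bilinear_simps inner_adj inner_simps)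
     (metis inner_adj inner_commute)

lemma bounded_linear_adj: "bounded_linear (adj :: ('k::{real_inner,banach} \<Rightarrow>\<^sub>L 'k) \<Rightarrow> _)"
  by (rule bounded_linear_intro[of _ 1]) (auto simp: adj_add adj_scaleR norm_adj_le)

text \<open>Over the reals adjunction is a bounded linear map of L(K), so it may occur freely in
  analytic expressions.\<close>

lemma analytic_at_in_adj:
  fixes f :: "'a::real_normed_vector \<Rightarrow> ('k::{real_inner,banach} \<Rightarrow>\<^sub>L 'k)"
  assumes "analytic_at_in V f x"
  shows "analytic_at_in V (\<lambda>y. adj (f y)) x"
  by (rule analytic_at_in_linear_compose[OF bounded_linear_adj assms])

lemma adj_proj:
  fixes E :: "'k::{real_inner,banach} set"
  assumes E: "subspace E" "closed E"
  shows "adj (proj E) = proj E"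
proof (rule adj_eqI)
  note c = complements_orthogonal[OF E]
  fix x y
  have 1: "proj E x \<bullet> (y - proj E y) = 0" "proj E y \<bullet> (x - proj E x) = 0"
    using obl_in[OF c] obl_diff_in[OF c] unfolding proj_def
    by (metis orth_comp_iff inner_commute)+
  have "x \<bullet> proj E y = proj E x \<bullet> proj E y" using 1(2) by (simp add: inner_diff_right inner_commute)
  also have "\<dots> = proj E x \<bullet> y" using 1(1) by (simp add: inner_diff_right)
  finally show "x \<bullet> proj E y = proj E x \<bullet> y" .
qed

text \<open>The lower bound gives injectivity and a closed range. If y is orthogonal to the range,
  then 0 = y \<bullet> S (S y) = S y \<bullet> S y, so y = 0 by the bound and \<open>S\<close> is
  onto. The bound also makes the inverse bounded.\<close>

lemma selfadjoint_invertible: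
  fixes S :: "'k::{real_inner,banach} \<Rightarrow>\<^sub>L 'k"
  assumes sa: "adj S = S" and bd: "\<And>x. norm x \<le> norm (S x)"
  shows "op_invertible S"
proof -
  have inj: "inj S"
  proof (rule injI)
    fix x y assume "S x = S y"
    then have "S (x - y) = 0" by (simp add: blinfun.diff_right)
    then show "x = y" using bd[of "x - y"] by simp
  qed
  have "subspace (range S)"
    by (intro linear_subspace_image bounded_linear.linear[OF blinfun.bounded_linear_right]) simp
  moreover have "closed (range S)"
    by (intro complete_imp_closed complete_isometric_image[of 1] blinfun.bounded_linear_right)
       (use bd in \<open>auto simp: complete_UNIV\<close>)
  ultimately have c: "complements (range S) ((range S)\<^sup>\<bottom>)" by (rule complements_orthogonal)
  have orth: "y = 0" if "y \<in> (range S)\<^sup>\<bottom>" for y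
  proof -
    have "y \<bullet> S (S y) = 0" using that by (simp add: orth_comp_iff)
    then have "S y \<bullet> S y = 0" by (metis inner_adj sa)
    then show ?thesis using bd[of y] by simp
  qed
  have surj: "surj S"
  proof (rule UNIV_eq_I[symmetric])
    fix x
    obtain y where y: "y \<in> range S" "x - y \<in> (range S)\<^sup>\<bottom>" using complementsD(6)[OF c] by blast
    show "x \<in> range S" using y(1) orth[OF y(2)] by simp
  qed
  have SS: "S (inv S x) = x" "inv S (S x) = x" for x
    using surj inj by (auto simp: surj_f_inv_f)
  have "bounded_linear (inv S)"
  proof (rule bounded_linear_intro[of _ 1])
    show "inv S (x + y) = inv S x + inv S y" for x y
      by (rule injD[OF inj]) (simp add: SS blinfun.add_right)
    show "inv S (c *\<^sub>R x) = c *\<^sub>R inv S x" for c x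
      by (rule injD[OF inj]) (simp add: SS blinfun.scaleR_right)
    show "norm (inv S x) \<le> norm x * 1" for x using bd[of "inv S x"] by (simp add: SS)
  qed
  then have "blinfun_apply (Blinfun (inv S)) = inv S" by (rule bounded_linear_Blinfun_apply)
  then have "S o\<^sub>L Blinfun (inv S) = id_blinfun" "Blinfun (inv S) o\<^sub>L S = id_blinfun"
    by (auto intro!: blinfun_eqI simp: SS)
  then show ?thesis unfolding op_invertible_def by blast
qed

section \<open>Oblique versus orthogonal projections\<close>

text \<open>For S = Q + \<open>adj Q\<close> - I and N = Q - \<open>adj Q\<close> one has S S = I -
  N N. As N is skew, norm (S x)^2 = norm x ^2 + norm (N x)^2, which is the lower bound that
  \<open>selfadjoint_invertible\<close> asks for.\<close>

lemma idem_selfadjoint_invertible: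
  fixes Q :: "'k::{real_inner,banach} \<Rightarrow>\<^sub>L 'k"
  assumes QQ: "Q o\<^sub>L Q = Q"
  shows "op_invertible (Q + adj Q - id_blinfun)"
proof (rule selfadjoint_invertible)
  let ?S = "Q + adj Q - id_blinfun" and ?N = "Q - adj Q"
  show sa: "adj ?S = ?S" by (simp add: adj_add adj_diff adj_adj adj_id)
  fix x
  have AA: "adj Q o\<^sub>L adj Q = adj Q" using adj_compose[of Q Q] QQ by simp
  have "?S o\<^sub>L ?S = id_blinfun - (?N o\<^sub>L ?N)"
    by (simp add: compose_simps QQ AA algebra_simps)
  then have "?S (?S x) = x - ?N (?N x)"
    by (metis (mono_tags) blinfun_apply_blinfun_compose blinfun.diff_left blinfun_apply_id_blinfun id_apply)
  then have "?S x \<bullet> ?S x = x \<bullet> x - x \<bullet> ?N (?N x)"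
    by (metis inner_adj inner_diff_right sa)
  also have "x \<bullet> ?N (?N x) = - (?N x \<bullet> ?N x)"
  proof -
    have "adj ?N = - ?N" by (simp add: adj_diff adj_adj)
    then have "x \<bullet> (- ?N) (?N x) = ?N x \<bullet> ?N x" by (metis inner_adj)
    then show ?thesis unfolding blinfun.minus_left inner_minus_right by linarith
  qed
  finally have "x \<bullet> x \<le> ?S x \<bullet> ?S x" by simp
  then show "norm x \<le> norm (?S x)" by (simp add: norm_le)
qed

text \<open>Write P for \<open>proj (range Q)\<close>. A common range gives P Q = Q and Q P = P, and
  the adjoint of the latter is P \<open>adj Q\<close> = P. Hence P (Q + \<open>adj Q\<close> - I) =
  Q + P - P = Q.\<close>

lemma proj_idem:
  fixes Q :: "'k::{real_inner,banach} \<Rightarrow>\<^sub>L 'k"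
  assumes QQ: "Q o\<^sub>L Q = Q"
  shows "proj (range Q) o\<^sub>L (Q + adj Q - id_blinfun) = Q"
    and "proj (range Q) = Q o\<^sub>L op_inv (Q + adj Q - id_blinfun)"
proof -
  let ?P = "proj (range Q)"
  note c = idem_complements[OF QQ]
  note E = complementsD(1,2)[OF c]
  have PQ: "?P o\<^sub>L Q = Q" and QP: "Q o\<^sub>L ?P = ?P"
    using obl_same_range[OF complements_orthogonal[OF E] c] obl_same_range[OF c complements_orthogonal[OF E]]
    unfolding proj_def idem_eq_obl[OF QQ, symmetric] by auto
  have "?P o\<^sub>L adj Q = adj (Q o\<^sub>L ?P)" by (simp add: adj_compose adj_proj[OF E])
  then have PA: "?P o\<^sub>L adj Q = ?P" by (simp add: QP adj_proj[OF E])
  show 1: "?P o\<^sub>L (Q + adj Q - id_blinfun) = Q"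
    by (simp add: compose_simps PQ PA)
  show "?P = Q o\<^sub>L op_inv (Q + adj Q - id_blinfun)"
    using op_inv[OF idem_selfadjoint_invertible[OF QQ]] by (subst 1[symmetric]) (simp add: compose_assoc)
qed

text \<open>If Q projects onto \<open>E\<close> along \<open>F\<close>, then I - Q projects onto
  \<open>F\<close> along \<open>E\<close>, and S = Q + \<open>adj Q\<close> - I changes sign under
  this exchange. By \<open>proj_idem\<close>, P_E S = Q and P_F S = Q - I, so S inverts P_E - P_F.
  Conversely P_E - P_F kills every common vector of \<open>E\<close> and \<open>F\<close>, and
  solving x = (P_E - P_F) y decomposes x.\<close>

lemma complements_iff_invertible:
  fixes E F :: "'k::{real_inner,banach} set"
  assumes E: "subspace E" "closed E" and F: "subspace F" "closed F"
  shows "complements E F \<longleftrightarrow> op_invertible (proj E - proj F)"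
    and "complements E F \<Longrightarrow> obl E F = proj E o\<^sub>L op_inv (proj E - proj F)"
proof -
  have c: "op_invertible (proj E - proj F) \<and> obl E F = proj E o\<^sub>L op_inv (proj E - proj F)"
    if c: "complements E F"
  proof -
    let ?Q = "obl E F" let ?S = "?Q + adj ?Q - id_blinfun"
    have QQ: "?Q o\<^sub>L ?Q = ?Q" using obl_idem[OF c] .
    have inv: "op_invertible ?S" by (rule idem_selfadjoint_invertible[OF QQ])
    have PS: "proj E o\<^sub>L ?S = ?Q" using proj_idem(1)[OF QQ] by (simp add: obl_range[OF c])
    have "proj F o\<^sub>L (obl F E + adj (obl F E) - id_blinfun) = obl F E"
      using proj_idem(1)[OF obl_idem[OF complements_sym[OF c]]]
      by (simp add: obl_range[OF complements_sym[OF c]])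
    also have "obl F E + adj (obl F E) - id_blinfun = - ?S"
      by (simp add: obl_swap[OF c] adj_diff adj_id)
    finally have RS: "proj F o\<^sub>L ?S = - (id_blinfun - ?Q)"
      by (simp add: compose_simps obl_swap[OF c] algebra_simps)
    have S: "(proj E - proj F) o\<^sub>L ?S = id_blinfun"
      unfolding bounded_bilinear.diff_left[OF bounded_bilinear_blinfun_compose] PS RS by simp
    have "op_inv ?S = proj E - proj F"
      using op_inv_unique(3)[OF op_inv(1)[OF inv] S] .
    then have L: "?S o\<^sub>L (proj E - proj F) = id_blinfun" using op_inv(1)[OF inv] by simp
    show ?thesis using op_inv_unique(1,2)[OF S L] PS by simp
  qed
  have "complements E F" if "op_invertible (proj E - proj F)"
  proof (rule complementsI[OF E F])
    note cE = complements_orthogonal[OF E] and cF = complements_orthogonal[OF F]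
    show "x = 0" if "x \<in> E" "x \<in> F" for x
    proof -
      have "(proj E - proj F) x = 0"
        using that by (simp add: blinfun.diff_left proj_def obl_id[OF cE] obl_id[OF cF])
      then show ?thesis
        using op_inv(2)[OF \<open>op_invertible (proj E - proj F)\<close>]
        by (metis blinfun.zero_right blinfun_apply_blinfun_compose blinfun_apply_id_blinfun id_apply)
    qed
    fix x
    define y where "y = op_inv (proj E - proj F) x"
    have "x = (proj E - proj F) y"
      unfolding y_def using op_inv(1)[OF that]
      by (metis blinfun_apply_blinfun_compose blinfun_apply_id_blinfun id_apply)
    then have "x - proj E y = - proj F y" by (simp add: blinfun.diff_left)
    then show "\<exists>y\<in>E. x - y \<in> F"
      using obl_in[OF cE, of y] obl_in[OF cF, of y] F(1)
      by (intro bexI[of _ "proj E y"]) (auto simp: proj_def subspace_neg)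
  qed
  then show "complements E F \<longleftrightarrow> op_invertible (proj E - proj F)" using c by blast
  show "complements E F \<Longrightarrow> obl E F = proj E o\<^sub>L op_inv (proj E - proj F)" using c by blast
qed

section \<open>Charts of the Grassmannian\<close>

text \<open>Turns an identity for a product of two factors into a rewrite rule inside products
  nested to the right, the normal form produced by \<open>compose_assoc\<close>.\<close>

lemma compose_eq_assoc: "A o\<^sub>L B = C \<Longrightarrow> A o\<^sub>L (B o\<^sub>L X) = C o\<^sub>L X"
  by (simp flip: compose_assoc)

lemma grassmannianD: "E \<in> grassmannian \<Longrightarrow> subspace E" "E \<in> grassmannian \<Longrightarrow> closed E"
  by (auto simp: grassmannian_def)

lemma complements_grassmannian:
  assumes "complements E F" "F \<in> grassmannian"
  shows "E \<in> grassmannian"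
  using assms unfolding grassmannian_def complements_def by auto

lemma orthogonal_comp_grassmannian:
  fixes E :: "'k::{real_inner,banach} set"
  assumes "E \<in> grassmannian"
  shows "E\<^sup>\<bottom> \<in> grassmannian"
proof -
  have "complements E (E\<^sup>\<bottom>)" using complements_orthogonal assms by (auto simp: grassmannian_def)
  from complements_grassmannian[OF complements_sym[OF this] assms] show ?thesis .
qed

lemma closed_complements_eq:
  assumes "F \<in> grassmannian"
  shows "closed_complements_in UNIV F = {G. complements G F}"
  using complements_iff[of _ F] assms by (auto simp: grassmannian_def)

lemma gr_atlas_eq:
  "gr_atlas = {({G. complements G F}, gr_coord E F, gr_model E F) |E F. F \<in> grassmannian \<and> complements E F}"
  unfolding gr_atlas_def
  by (intro Collect_cong ex_cong1) (auto simp: closed_complements_eq)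

lemma comp_proj_apply:
  fixes E :: "'k::{real_inner,banach} set"
  assumes E: "subspace E" "closed E" and T: "T \<in> bops E F"
  shows "blinfun_apply (comp_proj E T) x = T (proj E x)"
proof -
  note c = complements_orthogonal[OF E]
  have PE: "proj E x \<in> E" for x using obl_in[OF c] by (simp add: proj_def)
  obtain C where C: "\<forall>x\<in>E. norm (T x) \<le> C * norm x" using T by (auto simp: bops_def)
  have "bounded_linear (\<lambda>x. T (proj E x))"
  proof (rule bounded_linear_intro[of _ "\<bar>C\<bar> * norm (proj E)"])
    show "T (proj E (x + y)) = T (proj E x) + T (proj E y)" for x y
      using T PE by (simp add: bops_def blinfun.add_right)
    show "T (proj E (r *\<^sub>R x)) = r *\<^sub>R T (proj E x)" for r x
      using T PE by (simp add: bops_def blinfun.scaleR_right)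
    fix x
    have "norm (T (proj E x)) \<le> C * norm (proj E x)" using C PE by blast
    also have "\<dots> \<le> \<bar>C\<bar> * (norm (proj E) * norm x)"
      by (intro mult_mono norm_blinfun) auto
    finally show "norm (T (proj E x)) \<le> norm x * (\<bar>C\<bar> * norm (proj E))" by (simp add: mult_ac)
  qed
  then show ?thesis
    unfolding comp_proj_def o_def proj_apply[OF E, symmetric] by (simp add: bounded_linear_Blinfun_apply)
qed

lemma bops_restrict:
  fixes E :: "'k::{real_inner,banach} set"
  assumes E: "subspace E" "closed E" and A: "A o\<^sub>L proj E = A" "range A \<subseteq> F"
  shows "restrict A E \<in> bops E F" "comp_proj E (restrict A E) = A"
proof -
  show *: "restrict A E \<in> bops E F"
    using E A(2) norm_blinfun[of A]
    by (auto simp: bops_def subspace_add subspace_scale blinfun.add_right blinfun.scaleR_right)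
  show "comp_proj E (restrict A E) = A"
  proof (rule blinfun_eqI)
    fix x
    have "proj E x \<in> E" using obl_in[OF complements_orthogonal[OF E]] by (simp add: proj_def)
    then have "comp_proj E (restrict A E) x = (A o\<^sub>L proj E) x"
      by (simp add: comp_proj_apply[OF E *])
    then show "comp_proj E (restrict A E) x = A x" by (simp add: A(1))
  qed
qed

lemma bops_comp_proj:
  fixes E :: "'k::{real_inner,banach} set"
  assumes E: "subspace E" "closed E" and T: "T \<in> bops E F"
  shows "comp_proj E T o\<^sub>L proj E = comp_proj E T" "range (comp_proj E T) \<subseteq> F"
    "restrict (comp_proj E T) E = T"
proof -
  note c = complements_orthogonal[OF E]
  have PE: "proj E x \<in> E" for x using obl_in[OF c] by (simp add: proj_def)
  have PP: "proj E x = x" if "x \<in> E" for x using obl_id[OF c that] by (simp add: proj_def)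
  show "comp_proj E T o\<^sub>L proj E = comp_proj E T"
    by (rule blinfun_eqI) (simp add: comp_proj_apply[OF E T] PP PE)
  show "range (comp_proj E T) \<subseteq> F"
    using T PE by (auto simp: comp_proj_apply[OF E T] bops_def)
  show "restrict (comp_proj E T) E = T"
    using T by (intro ext) (auto simp: comp_proj_apply[OF E T] PP bops_def restrict_def PiE_def extensional_def)
qed

lemma gr_model_iff_range:
  fixes E :: "'k::{real_inner,banach} set"
  assumes E: "subspace E" "closed E"
  shows "A \<in> gr_model E F \<longleftrightarrow> A o\<^sub>L proj E = A \<and> range A \<subseteq> F"
proof
  assume "A \<in> gr_model E F"
  then obtain T where "T \<in> bops E F" "A = comp_proj E T" by (auto simp: gr_model_def)
  then show "A o\<^sub>L proj E = A \<and> range A \<subseteq> F" using bops_comp_proj[OF E] by blast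
next
  assume "A o\<^sub>L proj E = A \<and> range A \<subseteq> F"
  then show "A \<in> gr_model E F"
    unfolding gr_model_def using bops_restrict[OF E, of A F] by (metis image_eqI)
qed

text \<open>Two linear operator equations describe the model space, so its closedness and membership
  in it become algebra with projections.\<close>

lemma gr_model_iff:
  fixes E :: "'k::{real_inner,banach} set"
  assumes c: "complements E F"
  shows "A \<in> gr_model E F \<longleftrightarrow> A o\<^sub>L proj E = A \<and> obl E F o\<^sub>L A = 0"
proof -
  have "range A \<subseteq> F \<longleftrightarrow> obl E F o\<^sub>L A = 0"
  proof
    assume "range A \<subseteq> F"
    then show "obl E F o\<^sub>L A = 0"
      using obl_zero[OF c] by (intro blinfun_eqI) (simp add: image_subset_iff)
  next
    assume *: "obl E F o\<^sub>L A = 0"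
    have "obl E F (A x) = 0" for x
      using arg_cong[OF *, of "\<lambda>B. blinfun_apply B x"] by simp
    then show "range A \<subseteq> F" using obl_zero[OF c] by blast
  qed
  then show ?thesis using gr_model_iff_range[OF complementsD(1,2)[OF c]] by blast
qed

lemma
  fixes E :: "'k::{real_inner,banach} set"
  assumes c: "complements E F"
  shows subspace_gr_model: "subspace (gr_model E F)" and closed_gr_model: "closed (gr_model E F)"
proof -
  have eq: "gr_model E F = {A. A o\<^sub>L proj E = A \<and> obl E F o\<^sub>L A = 0}"
    using gr_model_iff[OF c] by blast
  show "subspace (gr_model E F)"
    unfolding eq by (auto simp: subspace_def compose_simps)
  have "closed {A. A o\<^sub>L proj E = A}" "closed {A. obl E F o\<^sub>L A = 0}"
    by (intro closed_Collect_eq continuous_intros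
        bounded_bilinear.continuous_on[OF bounded_bilinear_blinfun_compose])+
  then show "closed (gr_model E F)" unfolding eq Collect_conj_eq by (rule closed_Int)
qed

text \<open>Let Q project onto \<open>G\<close> along \<open>F\<close>. For x in \<open>E\<close>, Q
  x = x + (Q - I) x with (Q - I) x in \<open>F\<close>, and Q maps \<open>E\<close> onto
  \<open>G\<close> because the projections onto \<open>E\<close> and \<open>G\<close> have the same
  kernel. So \<open>G\<close> is the graph of Q - I over \<open>E\<close>; graphs determine their
  operators since \<open>E\<close> and \<open>F\<close> meet only in 0.\<close>

lemma gr_coord_eq:
  fixes E F G :: "'k::{real_inner,banach} set"
  assumes E: "complements E F" and G: "complements G F"
  shows "gr_coord E F G = (obl G F - id_blinfun) o\<^sub>L proj E"
proof -
  let ?A = "(obl G F - id_blinfun) o\<^sub>L proj E"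
  note cE = complementsD(1,2)[OF E]
  note cO = complements_orthogonal[OF cE]
  have PE: "proj E x = x" if "x \<in> E" for x using obl_id[OF cO that] by (simp add: proj_def)
  have "?A o\<^sub>L proj E = ?A" using obl_idem[OF cO] by (simp add: compose_assoc proj_def)
  moreover have "range ?A \<subseteq> F"
  proof safe
    fix x
    have "- (proj E x - obl G F (proj E x)) \<in> F"
      using obl_diff_in[OF G] complementsD(3)[OF E] by (intro subspace_neg)
    then show "?A x \<in> F" by (simp add: blinfun.diff_left)
  qed
  ultimately have T: "restrict ?A E \<in> bops E F" "comp_proj E (restrict ?A E) = ?A"
    using bops_restrict[OF cE] by blast+
  have "gr_q E (restrict ?A E) = obl G F ` E"
    unfolding gr_q_def by (intro image_cong) (auto simp: blinfun.diff_left PE)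
  also have "\<dots> = G"
  proof
    show "obl G F ` E \<subseteq> G" using obl_in[OF G] by auto
    show "G \<subseteq> obl G F ` E"
    proof
      fix g assume g: "g \<in> G"
      have "obl G F (obl E F g) = obl G F g"
        using obl_same_kernel[OF G E] by (metis blinfun_apply_blinfun_compose)
      then show "g \<in> obl G F ` E" using obl_id[OF G g] obl_in[OF E, of g] by (metis image_eqI)
    qed
  qed
  finally have q: "gr_q E (restrict ?A E) = G" .
  have "inj_on (gr_q E) (bops E F)"
  proof (rule inj_onI)
    fix S T assume S: "S \<in> bops E F" and T: "T \<in> bops E F" and eq: "gr_q E S = gr_q E T"
    have "S x = T x" for x
    proof (cases "x \<in> E")
      case True
      then have "x + S x \<in> gr_q E T" using eq by (auto simp: gr_q_def)
      then obtain y where y: "y \<in> E" "x + S x = y + T y" by (auto simp: gr_q_def)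
      have "S x \<in> F" "T y \<in> F" using S T True y by (auto simp: bops_def)
      then have "T y - S x \<in> F" using complementsD(3)[OF E] by (simp add: subspace_diff)
      moreover have "x - y = T y - S x" using y(2) by (simp add: algebra_simps)
      moreover have "x - y \<in> E" using True y cE by (simp add: subspace_diff)
      ultimately have "x - y = 0" using complementsD(5)[OF E] by metis
      then show ?thesis using y(2) by simp
    next
      case False
      then show ?thesis using S T by (auto simp: bops_def PiE_def extensional_def)
    qed
    then show "S = T" by blast
  qed
  from inv_into_f_f[OF this T(1)] have "gr_p E F G = restrict ?A E"
    unfolding gr_p_def q .
  then show ?thesis by (simp add: gr_coord_def T(2))
qed

text \<open>The point of the chart \<open>p\<^sub>E\<^sub>,\<^sub>F\<close> with coordinate \<open>A\<close>; \<open>(I + A)\<close> composed with the projection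
  onto \<open>E\<close> along \<open>F\<close> is the projection onto it along \<open>F\<close>.\<close>

definition gr_point :: "'k::real_normed_vector set \<Rightarrow> 'k set \<Rightarrow> ('k \<Rightarrow>\<^sub>L 'k) \<Rightarrow> 'k set" where
  "gr_point E F A = range ((id_blinfun + A) o\<^sub>L obl E F)"

lemma
  fixes E F :: "'k::{real_inner,banach} set"
  assumes E: "complements E F" and A: "A \<in> gr_model E F"
  shows complements_gr_point: "complements (gr_point E F A) F"
    and obl_gr_point: "obl (gr_point E F A) F = (id_blinfun + A) o\<^sub>L obl E F"
    and gr_coord_gr_point: "gr_coord E F (gr_point E F A) = A"
proof -
  let ?Q = "obl E F"
  have A: "A o\<^sub>L proj E = A" "?Q o\<^sub>L A = 0" using A gr_model_iff[OF E] by auto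
  note cO = complements_orthogonal[OF complementsD(1,2)[OF E]]
  have QQ: "?Q o\<^sub>L ?Q = ?Q" by (rule obl_idem[OF E])
  have QP: "?Q o\<^sub>L proj E = proj E" unfolding proj_def by (rule obl_same_range[OF E cO])
  let ?R = "(id_blinfun + A) o\<^sub>L ?Q"
  have 1: "?R o\<^sub>L ?R = ?R"
    by (simp add: compose_simps compose_assoc A A[THEN compose_eq_assoc] QQ)
  have 2: "?R x = 0 \<longleftrightarrow> x \<in> F" for x
  proof
    assume "?R x = 0"
    then have "(?Q o\<^sub>L ?R) x = 0" by (simp add: blinfun.zero_right)
    moreover have "?Q o\<^sub>L ?R = ?Q" by (simp add: compose_simps A A[THEN compose_eq_assoc] QQ)
    ultimately show "x \<in> F" using obl_zero[OF E] by simp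
  next
    assume "x \<in> F"
    then show "?R x = 0" using obl_zero[OF E, of x] by (simp add: blinfun.zero_right)
  qed
  show c: "complements (gr_point E F A) F" and o: "obl (gr_point E F A) F = ?R"
    unfolding gr_point_def
    by (rule obl_unique(1)[OF 1 refl 2], rule obl_unique(2)[OF 1 refl 2, symmetric])
  show "gr_coord E F (gr_point E F A) = A"
    by (simp add: gr_coord_eq[OF E c] o compose_simps compose_assoc QP A)
qed

lemma
  fixes E F G :: "'k::{real_inner,banach} set"
  assumes E: "complements E F" and G: "complements G F"
  shows gr_coord_in: "gr_coord E F G \<in> gr_model E F"
    and gr_point_gr_coord: "gr_point E F (gr_coord E F G) = G"
proof -
  note cO = complements_orthogonal[OF complementsD(1,2)[OF E]]
  have PQ: "proj E o\<^sub>L obl E F = obl E F" unfolding proj_def by (rule obl_same_range[OF cO E])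
  show "gr_coord E F G \<in> gr_model E F"
    unfolding gr_model_iff[OF E] gr_coord_eq[OF E G]
    using obl_idem[OF cO]
    by (simp add: proj_def compose_simps obl_same_kernel[OF E G, THEN compose_eq_assoc] compose_assoc)
  have "(id_blinfun + gr_coord E F G) o\<^sub>L obl E F = obl G F"
    by (simp add: gr_coord_eq[OF E G] compose_simps compose_assoc PQ obl_same_kernel[OF G E])
  then show "gr_point E F (gr_coord E F G) = G"
    unfolding gr_point_def by (simp add: obl_range[OF G])
qed

lemma inj_on_gr_coord:
  fixes E F :: "'k::{real_inner,banach} set"
  assumes E: "complements E F"
  shows "inj_on (gr_coord E F) {G. complements G F}"
  using gr_point_gr_coord[OF E] by (intro inj_on_inverseI[of _ "gr_point E F"]) simp

lemma inv_into_gr_coord: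
  fixes E F :: "'k::{real_inner,banach} set"
  assumes E: "complements E F" and A: "A \<in> gr_model E F"
  shows "inv_into {G. complements G F} (gr_coord E F) A = gr_point E F A"
  using inv_into_f_f[OF inj_on_gr_coord[OF E], of "gr_point E F A"]
  by (simp add: complements_gr_point[OF E A] gr_coord_gr_point[OF E A])

lemma proj_gr_point:
  fixes E F :: "'k::{real_inner,banach} set"
  assumes E: "complements E F" and A: "A \<in> gr_model E F"
  defines "Q \<equiv> (id_blinfun + A) o\<^sub>L obl E F"
  shows "op_invertible (Q + adj Q - id_blinfun)"
    and "proj (gr_point E F A) = Q o\<^sub>L op_inv (Q + adj Q - id_blinfun)"
proof -
  have "Q o\<^sub>L Q = Q"
    using obl_idem[OF complements_gr_point[OF E A]] by (simp add: obl_gr_point[OF E A] Q_def)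
  from idem_selfadjoint_invertible[OF this] proj_idem(2)[OF this]
  show "op_invertible (Q + adj Q - id_blinfun)"
    and "proj (gr_point E F A) = Q o\<^sub>L op_inv (Q + adj Q - id_blinfun)"
    by (simp_all add: gr_point_def Q_def)
qed

lemma analytic_op_inv_at:
  fixes f :: "'a::real_normed_vector \<Rightarrow> ('k::banach \<Rightarrow>\<^sub>L 'k)"
  assumes "subspace V" "analytic_at_in V f x" "op_invertible (f x)"
  shows "analytic_at_in V (\<lambda>y. op_inv (f y)) x"
  using analytic_op_inv(1)[OF subspace_0[OF assms(1)] assms(2,3)] .

text \<open>The inverse of a chart takes values in subspaces; this is the step to an operator-valued
  function, through which all later expressions depend on the base point.\<close>

lemma analytic_proj_gr_point:
  fixes E F :: "'k::{real_inner,banach} set"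
  assumes E: "complements E F" and W: "subspace W" "p \<in> W"
    and f: "analytic_at_in W f p" "\<And>y. y \<in> W \<Longrightarrow> f y \<in> gr_model E F"
  shows "analytic_at_in W (\<lambda>y. proj (gr_point E F (f y))) p"
proof -
  define Q where "Q y = (id_blinfun + f y) o\<^sub>L obl E F" for y
  have Q: "analytic_at_in W Q p"
    unfolding Q_def by (intro analytic_intros f)
  have "analytic_at_in W (\<lambda>y. Q y o\<^sub>L op_inv (Q y + adj (Q y) - id_blinfun)) p"
    using proj_gr_point(1)[OF E f(2)[OF W(2)]]
    by (intro analytic_intros Q analytic_op_inv_at analytic_at_in_adj W) (simp add: Q_def)
  \<comment> \<open>The radius 1 is arbitrary, the formula being valid at every point of
    \<open>W\<close>.\<close>
  then show ?thesis
    by (rule analytic_at_in_cong[where s = 1])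
       (use proj_gr_point(2)[OF E f(2)] W in \<open>auto simp: Q_def subspace_add\<close>)
qed

lemma obl_via_proj:
  fixes G F :: "'k::{real_inner,banach} set"
  assumes "complements G F"
  shows "op_invertible (proj G - proj F)" "obl G F = proj G o\<^sub>L op_inv (proj G - proj F)"
  using complements_iff_invertible[of G F] complementsD(1-4)[OF assms] assms by auto

lemma complements_proj_iff:
  fixes G F :: "'k::{real_inner,banach} set"
  assumes "G \<in> grassmannian" "F \<in> grassmannian"
  shows "complements G F \<longleftrightarrow> op_invertible (proj G - proj F)"
  using complements_iff_invertible(1)[of G F] assms by (auto simp: grassmannian_def)

section \<open>Coordinates of tangent vectors\<close>

text \<open>\<open>frechet_derivative\<close> chooses some derivative, and within a subspace a
  derivative is determined only in directions of that subspace. Pulling back along the line x + t v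
  in \<open>V\<close> reduces the claim to uniqueness for functions of a real variable.\<close>

lemma frechet_derivative_within_subspace:
  assumes V: "subspace V" "x \<in> V" and D: "(f has_derivative D) (at x within V)" and v: "v \<in> V"
  shows "frechet_derivative f (at x within V) v = D v"
proof -
  let ?D' = "frechet_derivative f (at x within V)"
  have D': "(f has_derivative ?D') (at x within V)"
    using D by (meson differentiableI frechet_derivative_works)
  define g where "g t = x + t *\<^sub>R v" for t :: real
  have g: "(g has_derivative (\<lambda>t. t *\<^sub>R v)) (at 0)"
    unfolding g_def by (auto intro!: derivative_eq_intros)
  have gV: "g t \<in> V" for t using V v by (auto simp: g_def subspace_add subspace_scale)
  have "((\<lambda>t. f (g t)) has_derivative (\<lambda>t. L (t *\<^sub>R v))) (at 0)"
    if "(f has_derivative L) (at x within V)" for L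
  proof -
    have "(f has_derivative L) (at (g 0) within range g)"
      using has_derivative_subset[OF that, of "range g"] gV by (auto simp: g_def)
    from has_derivative_in_compose[OF g this] show ?thesis .
  qed
  from has_derivative_unique[OF this[OF D'] this[OF D]]
  show ?thesis by (metis scaleR_one)
qed

text \<open>Let H have coordinate A, and let R and Q project onto H and \<open>G\<close> along
  \<open>F\<close>. As (I + A) P_G maps into H, R fixes its values; with R Q = R this gives R - Q =
  (I - R) A Q. Therefore R - Q = (I - Q) A Q - (R - Q) A Q, and the last term is quadratic in A
  because R - Q is of first order.\<close>

lemma chart_change_derivative:
  fixes E F G :: "'k::{real_inner,banach} set"
  assumes E: "complements E F" and G: "complements G F"
  shows "((\<lambda>A. gr_coord E F (gr_point G (G\<^sup>\<bottom>) A)) has_derivative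
     (\<lambda>A. (id_blinfun - obl G F) o\<^sub>L A o\<^sub>L obl G F o\<^sub>L proj E)) (at 0 within gr_model G (G\<^sup>\<bottom>))"
proof -
  let ?V = "gr_model G (G\<^sup>\<bottom>)" let ?Q = "obl G F" let ?P = "proj E"
  let ?f = "\<lambda>A. gr_coord E F (gr_point G (G\<^sup>\<bottom>) A)"
  let ?L = "\<lambda>A. (id_blinfun - ?Q) o\<^sub>L A o\<^sub>L ?Q o\<^sub>L ?P"
  note sG = complementsD(1,2)[OF G] and sF = complementsD(3,4)[OF G]
  note cG = complements_orthogonal[OF sG]
  note V = subspace_gr_model[OF cG]
  have "gr_coord G (G\<^sup>\<bottom>) G = 0"
    using obl_idem[OF cG] by (simp add: gr_coord_eq[OF cG cG] proj_def compose_simps)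
  then have G0: "gr_point G (G\<^sup>\<bottom>) 0 = G" using gr_point_gr_coord[OF cG cG] by simp
  \<comment> \<open>Complementarity to \<open>F\<close> is open, so subspaces with small coordinate
    still lie in the domain of the second chart.\<close>
  have "\<exists>s>0. \<forall>A\<in>?V. norm A < s \<longrightarrow> op_invertible (proj (gr_point G (G\<^sup>\<bottom>) (0 + A)) - proj F)"
    using V obl_via_proj(1)[OF G]
    by (intro analytic_op_inv(2) analytic_intros analytic_proj_gr_point[OF cG]) (auto simp: subspace_0 G0)
  then obtain s where s: "s > 0"
      "\<And>A. A \<in> ?V \<Longrightarrow> norm A < s \<Longrightarrow> op_invertible (proj (gr_point G (G\<^sup>\<bottom>) A) - proj F)"
    by auto
  define q k where "q = norm ?Q" and "k = norm (id_blinfun - ?Q)"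
  have qk: "0 \<le> q" "0 \<le> k" by (simp_all add: q_def k_def)
  have est: "norm (?f A - ?f 0 - ?L A) \<le> 2 * k * (norm A * q) * (norm A * q) * norm ?P"
    if A: "A \<in> ?V" "norm A < s" "norm A * q \<le> 1/2" for A
  proof -
    let ?H = "gr_point G (G\<^sup>\<bottom>) A" let ?R = "obl ?H F"
    have cH: "complements ?H (G\<^sup>\<bottom>)" by (rule complements_gr_point[OF cG A(1)])
    have H: "complements ?H F"
      using complements_iff_invertible(1)[OF complementsD(1,2)[OF cH] sF] s(2)[OF A(1,2)] by blast
    have PQ: "proj G o\<^sub>L ?Q = ?Q" unfolding proj_def by (rule obl_same_range[OF cG G])
    have "?R o\<^sub>L obl ?H (G\<^sup>\<bottom>) = obl ?H (G\<^sup>\<bottom>)" by (rule obl_same_range[OF H cH])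
    then have "?R o\<^sub>L (id_blinfun + A) o\<^sub>L proj G = (id_blinfun + A) o\<^sub>L proj G"
      by (simp add: obl_gr_point[OF cG A(1)] proj_def compose_assoc)
    then have "?R o\<^sub>L (id_blinfun + A) o\<^sub>L (proj G o\<^sub>L ?Q) = (id_blinfun + A) o\<^sub>L (proj G o\<^sub>L ?Q)"
      by (metis compose_assoc)
    then have "(?R o\<^sub>L ?Q) + (?R o\<^sub>L (A o\<^sub>L ?Q)) = ?Q + (A o\<^sub>L ?Q)"
      unfolding PQ by (simp add: compose_simps compose_assoc)
    then have rel: "?R + (?R o\<^sub>L (A o\<^sub>L ?Q)) = ?Q + (A o\<^sub>L ?Q)"
      by (simp add: obl_same_kernel[OF H G])
    then have d1: "?R - ?Q = (id_blinfun - ?R) o\<^sub>L (A o\<^sub>L ?Q)"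
      by (simp add: compose_simps algebra_simps)
    have AQ: "norm (A o\<^sub>L ?Q) \<le> norm A * q" unfolding q_def by (rule norm_blinfun_compose)
    have "id_blinfun - ?R = (id_blinfun - ?Q) - (?R - ?Q)" by simp
    then have n: "norm (id_blinfun - ?R) \<le> k + norm (?R - ?Q)"
      unfolding k_def using norm_triangle_ineq4 by metis
    have "norm (?R - ?Q) \<le> norm (id_blinfun - ?R) * norm (A o\<^sub>L ?Q)"
      unfolding d1 by (rule norm_blinfun_compose)
    also have "\<dots> \<le> (k + norm (?R - ?Q)) * (norm A * q)"
      using n AQ qk by (intro mult_mono) auto
    \<comment> \<open>The unknown norm stands on both sides; since
      \<open>norm A * q \<le> 1/2\<close>, half of it is absorbed on the left, which doubles the
      constant.\<close>
    also have "\<dots> \<le> k * (norm A * q) + norm (?R - ?Q) * (1/2)"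
      using mult_left_mono[OF A(3), of "norm (?R - ?Q)"] by (simp add: distrib_right)
    finally have d2: "norm (?R - ?Q) \<le> 2 * k * (norm A * q)" by simp
    have "?f A - ?f 0 - ?L A = ((?R - ?Q) - ((id_blinfun - ?Q) o\<^sub>L (A o\<^sub>L ?Q))) o\<^sub>L ?P"
      by (simp add: G0 gr_coord_eq[OF E H] gr_coord_eq[OF E G] compose_simps compose_assoc)
    also have "(?R - ?Q) - ((id_blinfun - ?Q) o\<^sub>L (A o\<^sub>L ?Q)) = - ((?R - ?Q) o\<^sub>L (A o\<^sub>L ?Q))"
    proof -
      have "?R - ?Q = (A o\<^sub>L ?Q) - (?R o\<^sub>L (A o\<^sub>L ?Q))" by (simp add: d1 compose_simps)
      then have "(?R - ?Q) - ((id_blinfun - ?Q) o\<^sub>L (A o\<^sub>L ?Q))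
          = - ((?R o\<^sub>L (A o\<^sub>L ?Q)) - (?Q o\<^sub>L (A o\<^sub>L ?Q)))"
        by (simp add: compose_simps)
      then show ?thesis by (simp only: compose_simps)
    qed
    finally have "norm (?f A - ?f 0 - ?L A) \<le> norm ((?R - ?Q) o\<^sub>L (A o\<^sub>L ?Q)) * norm ?P"
      by (metis norm_blinfun_compose norm_minus_cancel)
    also have "\<dots> \<le> (norm (?R - ?Q) * norm (A o\<^sub>L ?Q)) * norm ?P"
      by (intro mult_right_mono norm_blinfun_compose) auto
    also have "\<dots> \<le> (2 * k * (norm A * q) * (norm A * q)) * norm ?P"
      using d2 AQ qk by (intro mult_right_mono mult_mono) auto
    finally show ?thesis .
  qed
  show ?thesis
    unfolding has_derivative_within_alt
  proof (intro conjI allI impI)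
    have "bounded_linear (\<lambda>A. (id_blinfun - ?Q) o\<^sub>L A)"
      by (rule bounded_bilinear.bounded_linear_right[OF bounded_bilinear_blinfun_compose])
    from bounded_linear_compose[OF bounded_bilinear.bounded_linear_left[OF bounded_bilinear_blinfun_compose, of "?Q o\<^sub>L ?P"] this]
    show "bounded_linear ?L" by (simp add: compose_assoc)
    fix e :: real assume e: "e > 0"
    define c where "c = 2 * k * q * q * norm ?P"
    have c: "0 \<le> c" using qk by (simp add: c_def)
    \<comment> \<open>The three bounds ensure complementarity to \<open>F\<close>, the absorption
      condition \<open>norm A * q \<le> 1/2\<close>, and that the remainder c norm A ^2 stays below
      e norm A. Adding 1 keeps the denominators positive.\<close>
    define d where "d = min s (min (1 / (2 * q + 1)) (e / (c + 1)))"
    have "d > 0" using s(1) e c qk by (simp add: d_def)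
    moreover have "norm (?f A - ?f 0 - ?L (A - 0)) \<le> e * norm (A - 0)" if A: "A \<in> ?V" "norm (A - 0) < d" for A
    proof -
      have s': "norm A < s" and q': "norm A < 1 / (2 * q + 1)" and c': "norm A < e / (c + 1)"
        using A(2) by (auto simp: d_def)
      have "norm A * (2 * q + 1) < 1" using q' qk by (simp add: pos_less_divide_eq)
      moreover have "norm A * (2 * q + 1) = 2 * (norm A * q) + norm A" by (simp add: algebra_simps)
      ultimately have "norm A * q \<le> 1/2" using norm_ge_zero[of A] by linarith
      then have "norm (?f A - ?f 0 - ?L A) \<le> 2 * k * (norm A * q) * (norm A * q) * norm ?P"
        using est[OF A(1) s'] by blast
      also have "\<dots> = (norm A * c) * norm A" by (simp add: c_def mult_ac)
      also have "\<dots> \<le> e * norm A"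
      proof (rule mult_right_mono)
        have "norm A * (c + 1) < e" using c' c by (simp add: pos_less_divide_eq)
        moreover have "norm A * (c + 1) = norm A * c + norm A" by (simp add: algebra_simps)
        ultimately show "norm A * c \<le> e" using norm_ge_zero[of A] by linarith
      qed simp
      finally show ?thesis by simp
    qed
    ultimately show "\<exists>d>0. \<forall>A\<in>?V. norm (A - 0) < d \<longrightarrow> norm (?f A - ?f 0 - ?L (A - 0)) \<le> e * norm (A - 0)"
      by blast
  qed
qed

lemma gr_tangent_rep_eq:
  fixes E F G :: "'k::{real_inner,banach} set"
  assumes E: "complements E F" and G: "complements G F" and g: "G \<in> grassmannian"
    and T: "T \<in> bops G (G\<^sup>\<bottom>)"
  shows "gr_tangent_rep (gr_coord E F) G T
    = (id_blinfun - obl G F) o\<^sub>L comp_proj G T o\<^sub>L obl G F o\<^sub>L proj E"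
proof -
  let ?V = "gr_model G (G\<^sup>\<bottom>)"
  have cG: "complements G (G\<^sup>\<bottom>)" using complements_orthogonal complementsD(1,2)[OF G] .
  note V = subspace_gr_model[OF cG]
  have 0: "gr_coord G (G\<^sup>\<bottom>) G = 0"
    using obl_idem[OF cG] by (simp add: gr_coord_eq[OF cG cG] proj_def compose_simps)
  have "((gr_coord E F \<circ> inv_into {H. complements H (G\<^sup>\<bottom>)} (gr_coord G (G\<^sup>\<bottom>))) has_derivative
     (\<lambda>A. (id_blinfun - obl G F) o\<^sub>L A o\<^sub>L obl G F o\<^sub>L proj E)) (at 0 within ?V)"
    by (rule has_derivative_transform[OF subspace_0[OF V] _ chart_change_derivative[OF E G]])
       (simp add: inv_into_gr_coord[OF cG])
  from frechet_derivative_within_subspace[OF V subspace_0[OF V] this, of "comp_proj G T"]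
  show ?thesis
    unfolding gr_tangent_rep_def 0 closed_complements_eq[OF orthogonal_comp_grassmannian[OF g]]
    using T by (simp add: gr_model_def)
qed

section \<open>Maps in charts\<close>

text \<open>Carries an explicit inverse with each chart, so that \<open>inv_into\<close> and the
  images in the manifold definitions can be replaced by formulas and set comprehensions.\<close>

definition inverse_maps :: "('a \<Rightarrow> 'b) \<Rightarrow> ('b \<Rightarrow> 'a) \<Rightarrow> 'a set \<Rightarrow> 'b set \<Rightarrow> bool" where
  "inverse_maps f g U D \<longleftrightarrow> (\<forall>x\<in>U. f x \<in> D \<and> g (f x) = x) \<and> (\<forall>y\<in>D. g y \<in> U \<and> f (g y) = y)"

lemma inverse_mapsD:
  assumes "inverse_maps f g U D"
  shows "x \<in> U \<Longrightarrow> f x \<in> D" "x \<in> U \<Longrightarrow> g (f x) = x" "y \<in> D \<Longrightarrow> g y \<in> U" "y \<in> D \<Longrightarrow> f (g y) = y"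
    "inj_on f U" "f ` U = D" "y \<in> D \<Longrightarrow> inv_into U f y = g y" "bij_betw f U D"
    "f ` (U \<inter> N) = {y \<in> D. g y \<in> N}"
proof -
  show 1: "x \<in> U \<Longrightarrow> f x \<in> D" "x \<in> U \<Longrightarrow> g (f x) = x" "y \<in> D \<Longrightarrow> g y \<in> U" "y \<in> D \<Longrightarrow> f (g y) = y" for x y
    using assms by (auto simp: inverse_maps_def)
  show inj: "inj_on f U" using 1(2) by (rule inj_on_inverseI)
  show 2: "f ` (U \<inter> N) = {y \<in> D. g y \<in> N}" for N
  proof
    show "f ` (U \<inter> N) \<subseteq> {y \<in> D. g y \<in> N}" using 1 by auto
    show "{y \<in> D. g y \<in> N} \<subseteq> f ` (U \<inter> N)"
    proof
      fix y assume "y \<in> {y \<in> D. g y \<in> N}"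
      then show "y \<in> f ` (U \<inter> N)" using 1(3,4)[of y] by (intro image_eqI[of _ _ "g y"]) auto
    qed
  qed
  show im: "f ` U = D" using 2[of UNIV] by simp
  show "bij_betw f U D" using inj im by (simp add: bij_betw_def)
  show "y \<in> D \<Longrightarrow> inv_into U f y = g y"
    using inv_into_f_f[OF inj 1(3)] 1(4) by metis
qed

lemma inverse_maps_restrict:
  assumes "inverse_maps f g U D" "\<And>y. y \<in> D \<Longrightarrow> g y \<in> N \<longleftrightarrow> y \<in> Y"
  shows "inverse_maps f g (U \<inter> N) (D \<inter> Y)"
  unfolding inverse_maps_def using inverse_mapsD(1-4)[OF assms(1)] assms(2) by (metis IntD1 IntD2 IntI)

lemma chart_compatibleI:
  assumes \<phi>: "inverse_maps \<phi> k U D" and \<psi>: "inverse_maps \<psi> l W D'"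
    and V: "subspace V" "subspace Z"
    and 1: "analytic_on_in V {y \<in> D. k y \<in> W} (\<lambda>y. \<psi> (k y))"
    and 2: "analytic_on_in Z {y \<in> D'. l y \<in> U} (\<lambda>y. \<phi> (l y))"
  shows "chart_compatible (U, \<phi>, V) (W, \<psi>, Z)"
proof -
  have "analytic_on_in V (\<phi> ` (U \<inter> W)) (\<psi> \<circ> inv_into U \<phi>)"
    by (rule analytic_on_in_cong[OF 1 V(1) inverse_mapsD(9)[OF \<phi>]])
       (simp add: inverse_mapsD(7)[OF \<phi>])
  moreover have "analytic_on_in Z (\<psi> ` (W \<inter> U)) (\<phi> \<circ> inv_into W \<psi>)"
    by (rule analytic_on_in_cong[OF 2 V(2) inverse_mapsD(9)[OF \<psi>]])
       (simp add: inverse_mapsD(7)[OF \<psi>])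
  ultimately show ?thesis by (simp add: chart_compatible_def Int_commute)
qed

text \<open>The second function \<open>f'\<close> accommodates \<open>inv_into\<close> in the definition of \<open>bianalytic\<close>.\<close>

lemma analytic_mapI:
  assumes f: "\<And>p. p \<in> M \<Longrightarrow> f p \<in> N" "\<And>p. p \<in> M \<Longrightarrow> f' p = f p"
    and charts: "\<And>p. p \<in> M \<Longrightarrow> \<exists>U \<phi> V W \<psi> Z k D. (U, \<phi>, V) \<in> \<A> \<and> (W, \<psi>, Z) \<in> \<B> \<and> p \<in> U \<and> f p \<in> W \<and>
      subspace V \<and> inverse_maps \<phi> k U D \<and>
      analytic_on_in V {y \<in> D. k y \<in> M \<and> f (k y) \<in> W} (\<lambda>y. \<psi> (f (k y)))"
  shows "analytic_map M \<A> N \<B> f'"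
  unfolding analytic_map_def
proof (intro conjI ballI)
  show "f' ` M \<subseteq> N" using f by auto
  fix p assume p: "p \<in> M"
  from charts[OF p] obtain U \<phi> V W \<psi> Z k D where *: "(U, \<phi>, V) \<in> \<A>" "(W, \<psi>, Z) \<in> \<B>" "p \<in> U" "f p \<in> W"
    and V: "subspace V" and i: "inverse_maps \<phi> k U D"
    and an: "analytic_on_in V {y \<in> D. k y \<in> M \<and> f (k y) \<in> W} (\<lambda>y. \<psi> (f (k y)))" by blast
  have eq: "U \<inter> M \<inter> f' -` W = U \<inter> {x \<in> M. f x \<in> W}" using f(2) by auto
  have an': "analytic_on_in V (\<phi> ` (U \<inter> M \<inter> f' -` W)) (\<psi> \<circ> f' \<circ> inv_into U \<phi>)"
  proof (rule analytic_on_in_cong[OF an V])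
    show "\<phi> ` (U \<inter> M \<inter> f' -` W) = {y \<in> D. k y \<in> M \<and> f (k y) \<in> W}"
      unfolding eq inverse_mapsD(9)[OF i] by simp
    show "(\<psi> \<circ> f' \<circ> inv_into U \<phi>) x = \<psi> (f (k x))" if "x \<in> {y \<in> D. k y \<in> M \<and> f (k y) \<in> W}" for x
      using that f(2) by (simp add: inverse_mapsD(7)[OF i])
  qed
  show "\<exists>(U, \<phi>, V)\<in>\<A>. \<exists>(W, \<psi>, Z)\<in>\<B>. p \<in> U \<and> f' p \<in> W \<and>
      analytic_on_in V (\<phi> ` (U \<inter> M \<inter> f' -` W)) (\<psi> \<circ> f' \<circ> inv_into U \<phi>)"
    by (rule bexI[OF _ *(1)], unfold prod.case, rule bexI[OF _ *(2)]) (simp add: * f(2)[OF p] an')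
qed

lemma bianalyticI:
  assumes i: "inverse_maps f g M N" and f: "analytic_map M \<A> N \<B> f"
    and g: "analytic_map N \<B> M \<A> (inv_into M f)"
  shows "bianalytic M \<A> N \<B> f"
  using assms inverse_mapsD(8)[OF i] by (simp add: bianalytic_def)

section \<open>The vanishing bundle and tangent charts\<close>

lemma proj_proj:
  fixes E :: "'k::{real_inner,banach} set"
  assumes "subspace E" "closed E"
  shows "proj E o\<^sub>L proj E = proj E"
  using obl_idem[OF complements_orthogonal[OF assms]] by (simp add: proj_def)

lemma gr_model_orthogonal_iff:
  fixes E :: "'k::{real_inner,banach} set"
  assumes "subspace E" "closed E"
  shows "S \<in> gr_model E (E\<^sup>\<bottom>) \<longleftrightarrow> S o\<^sub>L proj E = S \<and> proj E o\<^sub>L S = 0"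
  using gr_model_iff[OF complements_orthogonal[OF assms]] by (simp add: proj_def)

text \<open>Vanishing on \<open>E\<^sup>\<bottom>\<close> means absorbing P_E on the right. The
  fibre over \<open>E\<close> is thus the model space of the chart at \<open>E\<close> with kernel
  \<open>E\<^sup>\<bottom>\<close>, which is why one space \<open>model E\<close> serves for base,
  tangent and fibre coordinates.\<close>

lemma ops_vanishing_eq:
  fixes E :: "'k::{real_inner,banach} set"
  assumes E: "subspace E" "closed E"
  shows "ops_vanishing (E\<^sup>\<bottom>) = gr_model E (E\<^sup>\<bottom>)"
proof -
  note c = complements_orthogonal[OF E]
  have "S ` (E\<^sup>\<bottom>) = {0} \<longleftrightarrow> S o\<^sub>L proj E = S" for S :: "'k \<Rightarrow>\<^sub>L 'k"
  proof
    assume S: "S ` (E\<^sup>\<bottom>) = {0}"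
    have "S (x - proj E x) = 0" for x
      using S obl_diff_in[OF c, of x] unfolding proj_def by blast
    then show "S o\<^sub>L proj E = S" by (intro blinfun_eqI) (simp add: blinfun.diff_right)
  next
    assume S: "S o\<^sub>L proj E = S"
    have "S x = 0" if "x \<in> E\<^sup>\<bottom>" for x
    proof -
      have "proj E x = 0" using obl_zero[OF c] that by (simp add: proj_def)
      then show ?thesis using arg_cong[OF S, of "\<lambda>B. blinfun_apply B x"] by (simp add: blinfun.zero_right)
    qed
    moreover have "0 \<in> E\<^sup>\<bottom>" using subspace_orthogonal_comp by (rule subspace_0)
    ultimately show "S ` (E\<^sup>\<bottom>) = {0}" by force
  qed
  then show ?thesis
    unfolding ops_vanishing_def using gr_model_iff_range[OF E] by blast
qed

lemma vanishing_bundle_iff: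
  fixes G :: "'k::{real_inner,banach} set"
  shows "(G, S) \<in> vanishing_bundle \<longleftrightarrow>
    G \<in> grassmannian \<and> S o\<^sub>L proj G = S \<and> proj G o\<^sub>L S = 0"
  using ops_vanishing_eq[of G] gr_model_orthogonal_iff[of G S] grassmannianD[of G]
  by (auto simp: vanishing_bundle_def)

lemma gr_tangent_iff: "(G, T) \<in> gr_tangent \<longleftrightarrow> G \<in> grassmannian \<and> T \<in> bops G (G\<^sup>\<bottom>)"
  by (auto simp: gr_tangent_def)

definition bundle_to_tangent ::
    "'k::real_normed_vector set \<times> ('k \<Rightarrow>\<^sub>L 'k) \<Rightarrow> 'k set \<times> ('k \<Rightarrow> 'k)" where
  "bundle_to_tangent = (\<lambda>(G, S). (G, restrict S G))"

lemma bundle_to_tangent: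
  fixes G :: "'k::{real_inner,banach} set"
  assumes "(G, S) \<in> vanishing_bundle"
  shows "(G, restrict S G) \<in> gr_tangent" "comp_proj G (restrict S G) = S"
proof -
  have G: "G \<in> grassmannian" and S: "S o\<^sub>L proj G = S" "proj G o\<^sub>L S = 0"
    using assms by (auto simp: vanishing_bundle_iff)
  note E = grassmannianD[OF G]
  have "range S \<subseteq> G\<^sup>\<bottom>"
    using S gr_model_orthogonal_iff[OF E] gr_model_iff_range[OF E] by blast
  from bops_restrict[OF E S(1) this] G
  show "(G, restrict S G) \<in> gr_tangent" "comp_proj G (restrict S G) = S"
    by (simp_all add: gr_tangent_iff)
qed

lemma tangent_to_bundle:
  fixes G :: "'k::{real_inner,banach} set"
  assumes "(G, T) \<in> gr_tangent"
  shows "(G, comp_proj G T) \<in> vanishing_bundle" "restrict (comp_proj G T) G = T"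
proof -
  have G: "G \<in> grassmannian" and T: "T \<in> bops G (G\<^sup>\<bottom>)" using assms by (auto simp: gr_tangent_iff)
  note E = grassmannianD[OF G]
  have "comp_proj G T \<in> gr_model G (G\<^sup>\<bottom>)" using T by (simp add: gr_model_def)
  then show "(G, comp_proj G T) \<in> vanishing_bundle"
    using G by (simp add: vanishing_bundle_iff gr_model_orthogonal_iff[OF E])
  show "restrict (comp_proj G T) G = T" by (rule bops_comp_proj(3)[OF E T])
qed

lemma inverse_maps_tangent_to_trivial:
  "inverse_maps tangent_to_trivial bundle_to_tangent
     (gr_tangent :: ('k::{real_inner,banach} set \<times> ('k \<Rightarrow> 'k)) set) vanishing_bundle"
  unfolding inverse_maps_def tangent_to_trivial_def bundle_to_tangent_def
  using tangent_to_bundle bundle_to_tangent by auto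

lemma inverse_maps_gr_coord:
  fixes E F :: "'k::{real_inner,banach} set"
  assumes "complements E F"
  shows "inverse_maps (gr_coord E F) (gr_point E F) {G. complements G F} (gr_model E F)"
  unfolding inverse_maps_def
  using gr_point_gr_coord[OF assms] gr_coord_in[OF assms] gr_coord_gr_point[OF assms]
    complements_gr_point[OF assms] by auto

section \<open>Tangent charts attached to orthogonal complements\<close>

definition tangent_chart ::
    "'k::{real_inner,banach} set \<Rightarrow> 'k set \<times> ('k \<Rightarrow> 'k) \<Rightarrow> ('k \<Rightarrow>\<^sub>L 'k) \<times> ('k \<Rightarrow>\<^sub>L 'k)" where
  "tangent_chart E = (\<lambda>(G, T). (gr_coord E (E\<^sup>\<bottom>) G, gr_tangent_rep (gr_coord E (E\<^sup>\<bottom>)) G T))"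

definition tangent_chart_dom :: "'k::{real_inner,banach} set \<Rightarrow> ('k set \<times> ('k \<Rightarrow> 'k)) set" where
  "tangent_chart_dom E = gr_tangent \<inter> ({G. complements G (E\<^sup>\<bottom>)} \<times> UNIV)"

text \<open>Recovers B = T P_G from its coordinate W = (I - Q) B Q. Since Q and P_G have the same
  range, (I - P_G)(I - Q) = I - P_G and Q P_G = P_G, so (I - P_G) W P_G = (I - P_G) B P_G =
  B.\<close>

definition tangent_op :: "'k::{real_inner,banach} set \<Rightarrow> ('k \<Rightarrow>\<^sub>L 'k) \<times> ('k \<Rightarrow>\<^sub>L 'k) \<Rightarrow> ('k \<Rightarrow>\<^sub>L 'k)" where
  "tangent_op E = (\<lambda>(A, W). (id_blinfun - proj (gr_point E (E\<^sup>\<bottom>) A)) o\<^sub>L W o\<^sub>L proj (gr_point E (E\<^sup>\<bottom>) A))"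

definition tangent_point ::
    "'k::{real_inner,banach} set \<Rightarrow> ('k \<Rightarrow>\<^sub>L 'k) \<times> ('k \<Rightarrow>\<^sub>L 'k) \<Rightarrow> 'k set \<times> ('k \<Rightarrow> 'k)" where
  "tangent_point E = (\<lambda>(A, W). bundle_to_tangent (gr_point E (E\<^sup>\<bottom>) A, tangent_op E (A, W)))"

abbreviation model :: "'k::{real_inner,banach} set \<Rightarrow> ('k \<Rightarrow>\<^sub>L 'k) set" where
  "model E \<equiv> gr_model E (E\<^sup>\<bottom>)"

lemma tangent_chart_in_atlas:
  fixes E :: "'k::{real_inner,banach} set"
  assumes E: "E \<in> grassmannian"
  shows "(tangent_chart_dom E, tangent_chart E, model E \<times> model E) \<in> gr_tangent_atlas"
proof -
  have "({G. complements G (E\<^sup>\<bottom>)}, gr_coord E (E\<^sup>\<bottom>), model E) \<in> gr_atlas"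
    unfolding gr_atlas_eq
    using orthogonal_comp_grassmannian[OF E] complements_orthogonal[OF grassmannianD[OF E]] by blast
  then show ?thesis
    unfolding gr_tangent_atlas_def tangent_chart_dom_def tangent_chart_def by blast
qed

text \<open>\<open>Q\<close> shares its range with P_G and its kernel with P_E; this table drives
  the cancellations between tangent vectors and their coordinates.\<close>

lemma orthogonal_chart_relations:
  fixes E G :: "'k::{real_inner,banach} set"
  assumes E: "subspace E" "closed E" and G: "complements G (E\<^sup>\<bottom>)"
  defines "Q \<equiv> obl G (E\<^sup>\<bottom>)"
  shows "Q o\<^sub>L proj G = proj G" "proj G o\<^sub>L Q = Q" "Q o\<^sub>L proj E = Q" "proj E o\<^sub>L Q = proj E"
    "Q o\<^sub>L Q = Q" "proj G o\<^sub>L proj G = proj G" "proj E o\<^sub>L proj E = proj E"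
proof -
  note cE = complements_orthogonal[OF E] and cG = complements_orthogonal[OF complementsD(1,2)[OF G]]
  show "Q o\<^sub>L proj G = proj G" "proj G o\<^sub>L Q = Q" "Q o\<^sub>L proj E = Q" "proj E o\<^sub>L Q = proj E"
    "Q o\<^sub>L Q = Q" "proj G o\<^sub>L proj G = proj G" "proj E o\<^sub>L proj E = proj E"
    unfolding Q_def proj_def
    using obl_same_range[OF G cG] obl_same_range[OF cG G] obl_same_kernel[OF G cE] obl_same_kernel[OF cE G]
      obl_idem[OF G] obl_idem[OF cG] obl_idem[OF cE] by blast+
qed

text \<open>The trailing factor P_E in \<open>gr_tangent_rep_eq\<close> is absorbed because the
  projection along \<open>E\<^sup>\<bottom>\<close> has the kernel of P_E.\<close>

lemma tangent_chart_eq: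
  fixes E G :: "'k::{real_inner,banach} set"
  assumes E: "E \<in> grassmannian" and G: "complements G (E\<^sup>\<bottom>)" and T: "(G, T) \<in> gr_tangent"
  shows "tangent_chart E (G, T) = (gr_coord E (E\<^sup>\<bottom>) G,
     (id_blinfun - obl G (E\<^sup>\<bottom>)) o\<^sub>L comp_proj G T o\<^sub>L obl G (E\<^sup>\<bottom>))"
proof -
  note sE = grassmannianD[OF E]
  have "G \<in> grassmannian" "T \<in> bops G (G\<^sup>\<bottom>)" using T by (auto simp: gr_tangent_iff)
  from gr_tangent_rep_eq[OF complements_orthogonal[OF sE] G this]
  show ?thesis
    by (simp add: tangent_chart_def compose_assoc orthogonal_chart_relations[OF sE G])
qed

lemma tangent_op_vanishing:
  fixes E :: "'k::{real_inner,banach} set"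
  assumes E: "E \<in> grassmannian" and A: "A \<in> model E"
  shows "(gr_point E (E\<^sup>\<bottom>) A, tangent_op E (A, W)) \<in> vanishing_bundle"
proof -
  note sE = grassmannianD[OF E]
  let ?G = "gr_point E (E\<^sup>\<bottom>) A"
  have G: "complements ?G (E\<^sup>\<bottom>)" using complements_gr_point[OF complements_orthogonal[OF sE] A] .
  note R = orthogonal_chart_relations[OF sE G]
  show ?thesis
    unfolding vanishing_bundle_iff tangent_op_def
    using complements_grassmannian[OF G orthogonal_comp_grassmannian[OF E]]
    by (simp add: compose_simps compose_assoc R R[THEN compose_eq_assoc])
qed

lemma inverse_maps_tangent_chart:
  fixes E :: "'k::{real_inner,banach} set"
  assumes E: "E \<in> grassmannian"
  shows "inverse_maps (tangent_chart E) (tangent_point E) (tangent_chart_dom E) (model E \<times> model E)"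
proof -
  note sE = grassmannianD[OF E]
  note cE = complements_orthogonal[OF sE]
  have 1: "tangent_chart E (G, T) \<in> model E \<times> model E \<and> tangent_point E (tangent_chart E (G, T)) = (G, T)"
    if "(G, T) \<in> tangent_chart_dom E" for G T
  proof -
    have T: "(G, T) \<in> gr_tangent" and G: "complements G (E\<^sup>\<bottom>)"
      using that by (auto simp: tangent_chart_dom_def)
    note R = orthogonal_chart_relations[OF sE G]
    let ?B = "comp_proj G T" let ?Q = "obl G (E\<^sup>\<bottom>)"
    have B: "?B o\<^sub>L proj G = ?B" "proj G o\<^sub>L ?B = 0"
      using tangent_to_bundle(1)[OF T] by (auto simp: vanishing_bundle_iff)
    have W: "(id_blinfun - ?Q) o\<^sub>L ?B o\<^sub>L ?Q \<in> model E"
      unfolding gr_model_orthogonal_iff[OF sE]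
      by (simp add: compose_simps compose_assoc R R[THEN compose_eq_assoc])
    have "tangent_op E (gr_coord E (E\<^sup>\<bottom>) G, (id_blinfun - ?Q) o\<^sub>L ?B o\<^sub>L ?Q) = ?B"
      unfolding tangent_op_def
      by (simp add: gr_point_gr_coord[OF cE G] compose_simps compose_assoc R R[THEN compose_eq_assoc]
            B B[THEN compose_eq_assoc])
    then show ?thesis
      using W gr_coord_in[OF cE G] tangent_to_bundle(2)[OF T]
      by (simp add: tangent_chart_eq[OF E G T] tangent_point_def gr_point_gr_coord[OF cE G] bundle_to_tangent_def)
  qed
  have 2: "tangent_point E (A, W) \<in> tangent_chart_dom E \<and> tangent_chart E (tangent_point E (A, W)) = (A, W)"
    if A: "A \<in> model E" and W: "W \<in> model E" for A W
  proof -
    let ?G = "gr_point E (E\<^sup>\<bottom>) A" let ?B = "tangent_op E (A, W)" let ?Q = "obl ?G (E\<^sup>\<bottom>)"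
    have G: "complements ?G (E\<^sup>\<bottom>)" using complements_gr_point[OF cE A] .
    note R = orthogonal_chart_relations[OF sE G]
    note B = bundle_to_tangent[OF tangent_op_vanishing[OF E A, of W]]
    have W: "W o\<^sub>L proj E = W" "proj E o\<^sub>L W = 0"
      using W by (auto simp: gr_model_orthogonal_iff[OF sE])
    \<comment> \<open>\<open>W\<close> vanishes on the common kernel of \<open>?Q\<close> and P_E
      and also maps into it; hence W Q = W and Q W = 0.\<close>
    have "W o\<^sub>L ?Q = (W o\<^sub>L proj E) o\<^sub>L ?Q" by (simp add: W)
    also have "\<dots> = W" unfolding compose_assoc R by (rule W(1))
    finally have WQ: "W o\<^sub>L ?Q = W" .
    have "?Q o\<^sub>L W = (?Q o\<^sub>L proj E) o\<^sub>L W" by (simp add: R)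
    also have "\<dots> = 0" unfolding compose_assoc W by simp
    finally have QW: "?Q o\<^sub>L W = 0" .
    have "(id_blinfun - ?Q) o\<^sub>L ?B o\<^sub>L ?Q = W"
      unfolding tangent_op_def
      by (simp add: compose_simps compose_assoc R R[THEN compose_eq_assoc] WQ QW QW[THEN compose_eq_assoc])
    then show ?thesis
      using B(1) G
      by (simp add: tangent_point_def bundle_to_tangent_def tangent_chart_dom_def
          tangent_chart_eq[OF E G B(1)] B(2) gr_coord_gr_point[OF cE A])
  qed
  show ?thesis
    unfolding inverse_maps_def using 1 2 by auto
qed

section \<open>Idempotents and tangent vectors\<close>

definition tangent_to_idem :: "'k::{real_inner,banach} set \<times> ('k \<Rightarrow> 'k) \<Rightarrow> ('k \<Rightarrow>\<^sub>L 'k)" where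
  "tangent_to_idem = (\<lambda>(G, T). proj G + adj (comp_proj G T))"

lemma idempotentsD:
  fixes Q :: "'k::{real_inner,banach} \<Rightarrow>\<^sub>L 'k"
  assumes "Q \<in> idempotents"
  shows "Q o\<^sub>L Q = Q" "range Q \<in> grassmannian"
    "Q o\<^sub>L proj (range Q) = proj (range Q)" "proj (range Q) o\<^sub>L Q = Q"
proof -
  show QQ: "Q o\<^sub>L Q = Q" using assms by (simp add: idempotents_def)
  note c = idem_complements[OF QQ]
  note cO = complements_orthogonal[OF complementsD(1,2)[OF c]]
  have "range Q \<noteq> {0}" using assms by (auto simp: idempotents_def intro!: blinfun_eqI)
  moreover have "range Q \<noteq> UNIV"
  proof
    assume "range Q = UNIV"
    then have "Q x = x" for x
      using arg_cong[OF QQ, of "\<lambda>B. blinfun_apply B y" for y] by (metis UNIV_I blinfun_apply_blinfun_compose rangeE)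
    then have "Q = id_blinfun" by (intro blinfun_eqI) simp
    then show False using assms by (simp add: idempotents_def)
  qed
  ultimately show "range Q \<in> grassmannian"
    using complementsD(1,2)[OF c] by (simp add: grassmannian_def)
  show "Q o\<^sub>L proj (range Q) = proj (range Q)" "proj (range Q) o\<^sub>L Q = Q"
    using obl_same_range[OF c cO] obl_same_range[OF cO c]
    unfolding idem_eq_obl[OF QQ, symmetric] proj_def by auto
qed

lemma idem_to_tangent_eq:
  fixes Q :: "'k::{real_inner,banach} \<Rightarrow>\<^sub>L 'k"
  assumes Q: "Q \<in> idempotents"
  shows "idem_to_tangent Q = bundle_to_tangent
     (range Q, (id_blinfun - proj (range Q)) o\<^sub>L adj Q o\<^sub>L proj (range Q))"
    and "(range Q, (id_blinfun - proj (range Q)) o\<^sub>L adj Q o\<^sub>L proj (range Q)) \<in> vanishing_bundle"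
proof -
  let ?E = "range Q"
  note E = grassmannianD[OF idempotentsD(2)[OF Q]]
  have E': "subspace (?E\<^sup>\<bottom>)" "closed (?E\<^sup>\<bottom>)"
    by (rule subspace_orthogonal_comp, rule closed_orthogonal_comp)
  have "proj ?E x = x" if "x \<in> ?E" for x
    using obl_id[OF complements_orthogonal[OF E] that] by (simp add: proj_def)
  then show "idem_to_tangent Q = bundle_to_tangent
     (range Q, (id_blinfun - proj (range Q)) o\<^sub>L adj Q o\<^sub>L proj (range Q))"
    unfolding idem_to_tangent_def Let_def bundle_to_tangent_def
    by (auto intro!: restrict_ext simp: adj_apply simp flip: proj_apply[OF E'] proj_orthogonal_comp[OF E])
  show "(range Q, (id_blinfun - proj (range Q)) o\<^sub>L adj Q o\<^sub>L proj (range Q)) \<in> vanishing_bundle"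
    unfolding vanishing_bundle_iff using idempotentsD(2)[OF Q] proj_proj[OF E]
    by (simp add: compose_simps compose_assoc proj_proj[OF E, THEN compose_eq_assoc])
qed

text \<open>The quadratic equation Q Q = Q is traded for two conditions affine in \<open>Q\<close>:
  it fixes \<open>G\<close> pointwise and takes values in \<open>G\<close>. Affineness of the fibre
  can then be read off.\<close>

lemma idempotents_onto_iff:
  fixes G :: "'k::{real_inner,banach} set"
  assumes G: "G \<in> grassmannian"
  shows "Q \<in> idempotents_onto G \<longleftrightarrow> Q o\<^sub>L proj G = proj G \<and> proj G o\<^sub>L Q = Q"
proof
  assume "Q \<in> idempotents_onto G"
  then show "Q o\<^sub>L proj G = proj G \<and> proj G o\<^sub>L Q = Q"
    using idempotentsD(3,4) by (auto simp: idempotents_onto_def)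
next
  assume *: "Q o\<^sub>L proj G = proj G \<and> proj G o\<^sub>L Q = Q"
  then have QP: "Q o\<^sub>L proj G = proj G" and PQ: "proj G o\<^sub>L Q = Q" by auto
  note c = complements_orthogonal[OF grassmannianD[OF G]]
  have r: "range Q = G"
  proof
    show "range Q \<subseteq> G"
    proof safe
      fix x
      have "proj G (Q x) = Q x" using arg_cong[OF PQ, of "\<lambda>B. blinfun_apply B x"] by simp
      then show "Q x \<in> G" using obl_in[OF c, of "Q x"] by (simp add: proj_def)
    qed
    show "G \<subseteq> range Q"
    proof
      fix x assume "x \<in> G"
      then have "proj G x = x" using obl_id[OF c] by (simp add: proj_def)
      then have "Q x = x" using arg_cong[OF QP, of "\<lambda>B. blinfun_apply B x"] by simp
      then show "x \<in> range Q" by (metis rangeI)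
    qed
  qed
  have "Q \<noteq> 0" using r G by (auto simp: grassmannian_def)
  moreover have "Q \<noteq> id_blinfun"
  proof
    assume "Q = id_blinfun"
    then have "range Q = UNIV" by simp
    then show False using r G by (simp add: grassmannian_def)
  qed
  moreover have "Q o\<^sub>L Q = Q" by (metis QP PQ compose_assoc)
  ultimately show "Q \<in> idempotents_onto G" using r by (simp add: idempotents_def idempotents_onto_def)
qed

text \<open>\<open>S\<close> maps \<open>G\<close> into its orthogonal complement and kills that
  complement; so \<open>adj S\<close> maps the complement into \<open>G\<close> and kills
  \<open>G\<close>. Adding it to P_G alters neither the range nor the action on
  \<open>G\<close>.\<close>

lemma tangent_to_idem:
  fixes G :: "'k::{real_inner,banach} set"
  assumes "(G, S) \<in> vanishing_bundle"
  defines "Q \<equiv> proj G + adj S"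
  shows "Q \<in> idempotents" "range Q = G" "(id_blinfun - proj G) o\<^sub>L adj Q o\<^sub>L proj G = S"
proof -
  have G: "G \<in> grassmannian" and S: "S o\<^sub>L proj G = S" "proj G o\<^sub>L S = 0"
    using assms by (auto simp: vanishing_bundle_iff)
  note E = grassmannianD[OF G]
  note PP = proj_proj[OF E]
  have S': "proj G o\<^sub>L adj S = adj S" "adj S o\<^sub>L proj G = 0"
    using arg_cong[OF S(1), of adj] arg_cong[OF S(2), of adj] adj_scaleR[of 0 S]
    by (simp_all add: adj_compose adj_proj[OF E])
  have "Q o\<^sub>L proj G = proj G \<and> proj G o\<^sub>L Q = Q"
    unfolding Q_def by (simp_all add: compose_simps PP S')
  then have "Q \<in> idempotents_onto G" unfolding idempotents_onto_iff[OF G] by simp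
  then show "Q \<in> idempotents" "range Q = G" by (simp_all add: idempotents_onto_def)
  show "(id_blinfun - proj G) o\<^sub>L adj Q o\<^sub>L proj G = S"
    unfolding Q_def by (simp add: adj_add adj_adj adj_proj[OF E] compose_simps compose_assoc PP S
        S[THEN compose_eq_assoc])
qed

lemma inverse_maps_idem_to_tangent:
  "inverse_maps idem_to_tangent tangent_to_idem
     (idempotents :: ('k::{real_inner,banach} \<Rightarrow>\<^sub>L 'k) set) gr_tangent"
proof -
  have 1: "idem_to_tangent Q \<in> gr_tangent \<and> tangent_to_idem (idem_to_tangent Q) = Q"
    if Q: "Q \<in> idempotents" for Q :: "'k \<Rightarrow>\<^sub>L 'k"
  proof -
    let ?P = "proj (range Q)" let ?B = "(id_blinfun - ?P) o\<^sub>L adj Q o\<^sub>L ?P"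
    note E = grassmannianD[OF idempotentsD(2)[OF Q]]
    note B = bundle_to_tangent[OF idem_to_tangent_eq(2)[OF Q]]
    have "adj ?B = ?P o\<^sub>L Q o\<^sub>L (id_blinfun - ?P)"
      by (simp add: adj_compose adj_diff adj_id adj_adj adj_proj[OF E] compose_assoc)
    \<comment> \<open>P Q = Q and Q P = P: an idempotent differs from the orthogonal projection onto
      its range by an operator killing that range, and the adjoint of this difference is the tangent
      vector.\<close>
    also have "\<dots> = Q - ?P"
      by (simp add: compose_simps compose_assoc idempotentsD(3,4)[OF Q] idempotentsD(4)[OF Q, THEN compose_eq_assoc])
    finally have "?P + adj ?B = Q" by simp
    then show ?thesis
      using B by (simp add: idem_to_tangent_eq(1)[OF Q] bundle_to_tangent_def tangent_to_idem_def)
  qed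
  have 2: "tangent_to_idem (G, T) \<in> idempotents \<and> idem_to_tangent (tangent_to_idem (G, T)) = (G, T)"
    if T: "(G, T) \<in> gr_tangent" for G :: "'k set" and T
  proof -
    note * = tangent_to_idem[OF tangent_to_bundle(1)[OF T]]
    show ?thesis
      unfolding tangent_to_idem_def
      using *(1) tangent_to_bundle(2)[OF T]
      by (simp add: idem_to_tangent_eq(1)[OF *(1)] *(2,3) bundle_to_tangent_def)
  qed
  show ?thesis unfolding inverse_maps_def using 1 2 by auto
qed

section \<open>A submanifold chart at an idempotent\<close>

text \<open>For the symmetry \<open>J = 2 P - I\<close>, the parts of an operator commuting and anticommuting with
  \<open>J\<close> are its diagonal and off-diagonal parts with respect to the decomposition given by \<open>P\<close>.\<close>

definition dg :: "('k::real_normed_vector \<Rightarrow>\<^sub>L 'k) \<Rightarrow> ('k \<Rightarrow>\<^sub>L 'k) \<Rightarrow> ('k \<Rightarrow>\<^sub>L 'k)" where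
  "dg J A = (1/2) *\<^sub>R (A + (J o\<^sub>L A o\<^sub>L J))"

definition off :: "('k::real_normed_vector \<Rightarrow>\<^sub>L 'k) \<Rightarrow> ('k \<Rightarrow>\<^sub>L 'k) \<Rightarrow> ('k \<Rightarrow>\<^sub>L 'k)" where
  "off J A = (1/2) *\<^sub>R (A - (J o\<^sub>L A o\<^sub>L J))"

lemma half_double: "(1/2) *\<^sub>R (x + x) = (x :: 'a::real_vector)"
  by (metis scaleR_half_double)

lemma dg_plus_off: "dg J A + off J A = A"
  unfolding dg_def off_def scaleR_add_right[symmetric] by (simp add: half_double)

lemma
  shows dg_linear: "dg J (A + B) = dg J A + dg J B" "dg J (A - B) = dg J A - dg J B"
      "dg J (c *\<^sub>R A) = c *\<^sub>R dg J A" "dg J 0 = 0" "dg J (- A) = - dg J A"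
    and off_linear: "off J (A + B) = off J A + off J B" "off J (A - B) = off J A - off J B"
      "off J (c *\<^sub>R A) = c *\<^sub>R off J A" "off J 0 = 0" "off J (- A) = - off J A"
  by (simp_all add: dg_def off_def compose_simps algebra_simps)

context
  fixes J :: "'k::real_normed_vector \<Rightarrow>\<^sub>L 'k"
  assumes JJ: "J o\<^sub>L J = id_blinfun"
begin

lemma JJ_assoc: "J o\<^sub>L (J o\<^sub>L A) = A"
  by (simp add: JJ flip: compose_assoc)

lemma dg_commute: "J o\<^sub>L dg J A = dg J A o\<^sub>L J"
  by (simp add: dg_def compose_simps compose_assoc JJ JJ_assoc add.commute)

lemma off_anticommute: "J o\<^sub>L off J A = - (off J A o\<^sub>L J)"
  by (simp add: off_def compose_simps compose_assoc JJ JJ_assoc flip: scaleR_minus_right)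

lemma
  assumes "J o\<^sub>L A = A o\<^sub>L J"
  shows dg_commuting: "dg J A = A" and off_commuting: "off J A = 0"
proof -
  have "J o\<^sub>L A o\<^sub>L J = A" unfolding assms compose_assoc JJ by simp
  then show "dg J A = A" "off J A = 0" by (simp_all add: dg_def off_def half_double)
qed

lemma
  assumes "J o\<^sub>L A = - (A o\<^sub>L J)"
  shows dg_anticommuting: "dg J A = 0" and off_anticommuting: "off J A = A"
proof -
  have "J o\<^sub>L A o\<^sub>L J = - A" unfolding assms by (simp add: compose_simps compose_assoc JJ)
  then show "dg J A = 0" "off J A = A" by (simp_all add: dg_def off_def half_double)
qed

lemma dg_dg: "dg J (dg J A) = dg J A" and off_dg: "off J (dg J A) = 0"
  using dg_commuting[OF dg_commute] off_commuting[OF dg_commute] by blast+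

lemma
  assumes "J o\<^sub>L X = - (X o\<^sub>L J)" "J o\<^sub>L D = D o\<^sub>L J"
  shows off_sum: "off J (X + D) = X" and dg_sum: "dg J (X + D) = D"
  by (simp_all add: off_linear dg_linear dg_anticommuting[OF assms(1)] off_anticommuting[OF assms(1)]
      dg_commuting[OF assms(2)] off_commuting[OF assms(2)])

text \<open>Conjugation by \<open>J\<close> grades operators by parity: a product of two odd factors
  is even, and in the next lemma odd times even is odd.\<close>

lemma compose_anticommute:
  assumes "J o\<^sub>L A = - (A o\<^sub>L J)" "J o\<^sub>L B = - (B o\<^sub>L J)"
  shows "J o\<^sub>L (A o\<^sub>L B) = A o\<^sub>L B o\<^sub>L J"
proof -
  have "J o\<^sub>L (A o\<^sub>L B) = - (A o\<^sub>L (J o\<^sub>L B))"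
    unfolding compose_assoc[symmetric] assms(1) by (simp add: compose_simps)
  then show ?thesis by (simp add: assms(2) compose_simps compose_assoc)
qed

lemma compose_anticommute_commute:
  assumes "J o\<^sub>L A = - (A o\<^sub>L J)" "J o\<^sub>L B = B o\<^sub>L J"
  shows "J o\<^sub>L (A o\<^sub>L B) = - (A o\<^sub>L B o\<^sub>L J)"
proof -
  have "J o\<^sub>L (A o\<^sub>L B) = - (A o\<^sub>L (J o\<^sub>L B))"
    unfolding compose_assoc[symmetric] assms(1) by (simp add: compose_simps)
  then show ?thesis by (simp add: assms(2) compose_assoc)
qed

lemma op_inv_commute:
  assumes "op_invertible N" "J o\<^sub>L N = N o\<^sub>L J"
  shows "J o\<^sub>L op_inv N = op_inv N o\<^sub>L J"
proof -
  have "op_inv N o\<^sub>L ((J o\<^sub>L N) o\<^sub>L op_inv N) = op_inv N o\<^sub>L J"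
    by (simp add: compose_assoc op_inv[OF assms(1)])
  then show ?thesis
    unfolding assms(2) by (simp add: compose_assoc op_inv_assoc[OF assms(1)])
qed

end

lemma op_invertible_op_inv:
  assumes "op_invertible N"
  shows "op_invertible (op_inv N)" "op_inv (op_inv N) = N"
  using op_inv_unique[OF op_inv(2,1)[OF assms]] by auto

definition symmetry :: "('k::real_normed_vector \<Rightarrow>\<^sub>L 'k) \<Rightarrow> ('k \<Rightarrow>\<^sub>L 'k)" where
  "symmetry P = 2 *\<^sub>R P - id_blinfun"

text \<open>Near \<open>P\<close> write \<open>Q = I - P + J (I - X) M\<close> with \<open>M\<close> invertible and diagonal and \<open>X\<close>
  off-diagonal.  Then \<open>Q\<close> is idempotent iff \<open>M\<^sup>-\<^sup>1 = I - X\<^sup>2\<close>, so that \<open>X\<close> together with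
  \<open>M\<^sup>-\<^sup>1 - I + X\<^sup>2\<close> are coordinates straightening the idempotents.\<close>

definition idem_arg :: "('k::real_normed_vector \<Rightarrow>\<^sub>L 'k) \<Rightarrow> ('k \<Rightarrow>\<^sub>L 'k) \<Rightarrow> ('k \<Rightarrow>\<^sub>L 'k)" where
  "idem_arg P Q = symmetry P o\<^sub>L (Q - (id_blinfun - P))"

text \<open>\<open>idem_arg P Q\<close> equals (I - X) M. Its diagonal part is M and its
  off-diagonal part -X M, from which X is solved.\<close>

definition idem_off :: "('k::real_normed_vector \<Rightarrow>\<^sub>L 'k) \<Rightarrow> ('k \<Rightarrow>\<^sub>L 'k) \<Rightarrow> ('k \<Rightarrow>\<^sub>L 'k)" where
  "idem_off P Q = - (off (symmetry P) (idem_arg P Q) o\<^sub>L op_inv (dg (symmetry P) (idem_arg P Q)))"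

definition idem_chart :: "('k::real_normed_vector \<Rightarrow>\<^sub>L 'k) \<Rightarrow> ('k \<Rightarrow>\<^sub>L 'k) \<Rightarrow> ('k \<Rightarrow>\<^sub>L 'k)" where
  "idem_chart P Q = idem_off P Q + op_inv (dg (symmetry P) (idem_arg P Q)) - id_blinfun
     + (idem_off P Q o\<^sub>L idem_off P Q)"

text \<open>The inverse of M in terms of the coordinate A, whose off-diagonal part is X and whose
  diagonal part is M^-1 - I + X^2.\<close>

definition idem_denom :: "('k::real_normed_vector \<Rightarrow>\<^sub>L 'k) \<Rightarrow> ('k \<Rightarrow>\<^sub>L 'k) \<Rightarrow> ('k \<Rightarrow>\<^sub>L 'k)" where
  "idem_denom P A = id_blinfun + dg (symmetry P) A - (off (symmetry P) A o\<^sub>L off (symmetry P) A)"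

definition idem_point :: "('k::real_normed_vector \<Rightarrow>\<^sub>L 'k) \<Rightarrow> ('k \<Rightarrow>\<^sub>L 'k) \<Rightarrow> ('k \<Rightarrow>\<^sub>L 'k)" where
  "idem_point P A = (id_blinfun - P) +
     (symmetry P o\<^sub>L (id_blinfun - off (symmetry P) A) o\<^sub>L op_inv (idem_denom P A))"

definition idem_dom :: "('k::real_normed_vector \<Rightarrow>\<^sub>L 'k) \<Rightarrow> ('k \<Rightarrow>\<^sub>L 'k) set" where
  "idem_dom P = {Q. op_invertible (dg (symmetry P) (idem_arg P Q))}"

definition idem_image :: "('k::real_normed_vector \<Rightarrow>\<^sub>L 'k) \<Rightarrow> ('k \<Rightarrow>\<^sub>L 'k) set" where
  "idem_image P = {A. op_invertible (idem_denom P A)}"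

text \<open>At an idempotent P these are the operators H with P H + H P = H, the tangent directions
  to the set of idempotents.\<close>

definition idem_model :: "('k::real_normed_vector \<Rightarrow>\<^sub>L 'k) \<Rightarrow> ('k \<Rightarrow>\<^sub>L 'k) set" where
  "idem_model P = {A. dg (symmetry P) A = 0}"

lemma symmetry_involution: "P o\<^sub>L P = P \<Longrightarrow> symmetry P o\<^sub>L symmetry P = id_blinfun"
  by (simp add: symmetry_def compose_simps scaleR_2)

text \<open>X is odd and M^-1 - I + X^2 is even, so \<open>off\<close> and \<open>dg\<close> recover
  both from their sum, and with them M and \<open>Q\<close>. The bijection concerns all
  \<open>Q\<close> with invertible M, since the ambient space has to be straightened as
  well.\<close>

lemma inverse_maps_idem_chart:
  assumes PP: "P o\<^sub>L P = P"
  shows "inverse_maps (idem_chart P) (idem_point P) (idem_dom P) (idem_image P)"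
proof -
  define J where "J = symmetry P"
  have JJ: "J o\<^sub>L J = id_blinfun" unfolding J_def by (rule symmetry_involution[OF PP])
  note c = dg_commute[OF JJ] and a = off_anticommute[OF JJ]
  have 1: "idem_chart P Q \<in> idem_image P \<and> idem_point P (idem_chart P Q) = Q"
    if Q: "Q \<in> idem_dom P" for Q
  proof -
    let ?Y = "idem_arg P Q" let ?N = "op_inv (dg J ?Y)" let ?X = "idem_off P Q" let ?A = "idem_chart P Q"
    have inv: "op_invertible (dg J ?Y)" using Q by (simp add: idem_dom_def J_def)
    have N: "J o\<^sub>L ?N = ?N o\<^sub>L J" by (rule op_inv_commute[OF JJ inv c])
    have X: "?X = - (off J ?Y o\<^sub>L ?N)" by (simp add: idem_off_def J_def)
    have aX: "J o\<^sub>L ?X = - (?X o\<^sub>L J)"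
      unfolding X using compose_anticommute_commute[OF JJ a N, of ?Y] by (simp add: compose_simps)
    have D: "J o\<^sub>L (?N - id_blinfun + (?X o\<^sub>L ?X)) = (?N - id_blinfun + (?X o\<^sub>L ?X)) o\<^sub>L J"
      by (simp add: compose_simps N compose_anticommute[OF JJ aX aX])
    have A: "?A = ?X + (?N - id_blinfun + (?X o\<^sub>L ?X))"
      by (simp add: idem_chart_def J_def)
    have offA: "off J ?A = ?X" and dgA: "dg J ?A = ?N - id_blinfun + (?X o\<^sub>L ?X)"
      unfolding A by (rule off_sum[OF JJ aX D], rule dg_sum[OF JJ aX D])
    have N': "idem_denom P ?A = ?N"
      unfolding idem_denom_def J_def[symmetric] offA dgA by simp
    have "?X o\<^sub>L dg J ?Y = - off J ?Y"
      unfolding X by (simp add: compose_simps compose_assoc op_inv[OF inv])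
    then have "(id_blinfun - ?X) o\<^sub>L dg J ?Y = ?Y"
      using dg_plus_off[of J ?Y] by (simp add: compose_simps)
    then have "J o\<^sub>L (id_blinfun - ?X) o\<^sub>L dg J ?Y = Q - (id_blinfun - P)"
      by (simp add: compose_assoc idem_arg_def J_def[symmetric] JJ_assoc[OF JJ])
    then have "idem_point P ?A = Q"
      unfolding idem_point_def J_def[symmetric] offA N' op_invertible_op_inv(2)[OF inv] by simp
    then show ?thesis using op_invertible_op_inv(1)[OF inv] by (simp add: idem_image_def N')
  qed
  have 2: "idem_point P A \<in> idem_dom P \<and> idem_chart P (idem_point P A) = A"
    if A: "A \<in> idem_image P" for A
  proof -
    let ?N = "idem_denom P A" let ?M = "op_inv ?N" let ?X = "off J A" let ?Q = "idem_point P A"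
    have inv: "op_invertible ?N" using A by (simp add: idem_image_def)
    have N: "?N = id_blinfun + dg J A - (?X o\<^sub>L ?X)" by (simp add: idem_denom_def J_def)
    have "J o\<^sub>L ?N = ?N o\<^sub>L J"
      unfolding N by (simp add: compose_simps c compose_anticommute[OF JJ a a])
    then have M: "J o\<^sub>L ?M = ?M o\<^sub>L J" by (rule op_inv_commute[OF JJ inv])
    have XM: "J o\<^sub>L (?X o\<^sub>L ?M) = - (?X o\<^sub>L ?M o\<^sub>L J)"
      by (rule compose_anticommute_commute[OF JJ a M])
    have Y: "idem_arg P ?Q = ?M - (?X o\<^sub>L ?M)"
      by (simp add: idem_arg_def idem_point_def J_def[symmetric] compose_assoc JJ_assoc[OF JJ] compose_simps)
    have dgY: "dg J (idem_arg P ?Q) = ?M" and offY: "off J (idem_arg P ?Q) = - (?X o\<^sub>L ?M)"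
      unfolding Y dg_linear off_linear dg_commuting[OF JJ M] off_commuting[OF JJ M]
        dg_anticommuting[OF JJ XM] off_anticommuting[OF JJ XM] by simp_all
    have X: "idem_off P ?Q = ?X"
      unfolding idem_off_def J_def[symmetric] dgY offY
      by (simp add: compose_simps compose_assoc op_inv[OF op_invertible_op_inv(1)[OF inv]])
    have "idem_chart P ?Q = ?X + dg J A"
      unfolding idem_chart_def X J_def[symmetric] dgY op_invertible_op_inv(2)[OF inv] by (simp add: N)
    then have "idem_chart P ?Q = A" using dg_plus_off[of J A] by (simp add: add.commute)
    then show ?thesis
      using op_invertible_op_inv(1)[OF inv] by (simp add: idem_dom_def J_def[symmetric] dgY)
  qed
  show ?thesis unfolding inverse_maps_def using 1 2 by blast
qed

text \<open>For Z = J (I - X) M = (I + X) M J one has J Z + Z J = 2 M, hence P Z + Z P = Z + M, and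
  I - P + Z is idempotent iff Z Z = M, that is, (I + X) M (I - X) = I. Its even and odd parts read M
  - X M X = I and X M = M X; together they say M^-1 = I - X^2.\<close>

lemma idem_point_idempotent_iff:
  assumes PP: "P o\<^sub>L P = P" and P: "P \<noteq> 0" "P \<noteq> id_blinfun" and A: "A \<in> idem_image P"
  shows "idem_point P A \<in> idempotents \<longleftrightarrow> A \<in> idem_model P"
proof -
  define J where "J = symmetry P"
  have JJ: "J o\<^sub>L J = id_blinfun" unfolding J_def by (rule symmetry_involution[OF PP])
  note c = dg_commute[OF JJ] and a = off_anticommute[OF JJ]
  let ?N = "idem_denom P A" let ?M = "op_inv ?N" let ?X = "off J A" let ?Q = "idem_point P A"
  have inv: "op_invertible ?N" using A by (simp add: idem_image_def)
  have invM: "op_invertible ?M" by (rule op_invertible_op_inv(1)[OF inv])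
  have N: "?N = id_blinfun + dg J A - (?X o\<^sub>L ?X)" by (simp add: idem_denom_def J_def)
  have "J o\<^sub>L ?N = ?N o\<^sub>L J"
    unfolding N by (simp add: compose_simps c compose_anticommute[OF JJ a a])
  then have M: "J o\<^sub>L ?M = ?M o\<^sub>L J" by (rule op_inv_commute[OF JJ inv])
  define Z where "Z = J o\<^sub>L (id_blinfun - ?X) o\<^sub>L ?M"
  have Q: "?Q = (id_blinfun - P) + Z"
    by (simp add: idem_point_def Z_def J_def)
  have XJ: "J o\<^sub>L (id_blinfun - ?X) = (id_blinfun + ?X) o\<^sub>L J"
    by (simp add: compose_simps a)
  have Z': "Z = (id_blinfun + ?X) o\<^sub>L ?M o\<^sub>L J"
    unfolding Z_def XJ compose_assoc M ..
  have JZ: "J o\<^sub>L Z = ?M - (?X o\<^sub>L ?M)"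
    unfolding Z_def by (simp add: compose_assoc JJ_assoc[OF JJ] compose_simps)
  have ZJ: "Z o\<^sub>L J = ?M + (?X o\<^sub>L ?M)"
    unfolding Z' by (simp add: compose_assoc JJ compose_simps)
  have ZZ: "Z o\<^sub>L Z = (id_blinfun + ?X) o\<^sub>L ?M o\<^sub>L (id_blinfun - ?X) o\<^sub>L ?M"
  proof -
    have "Z o\<^sub>L Z = ((id_blinfun + ?X) o\<^sub>L ?M o\<^sub>L J) o\<^sub>L (J o\<^sub>L (id_blinfun - ?X) o\<^sub>L ?M)"
      by (subst (1) Z', subst (1) Z_def, rule refl)
    then show ?thesis by (simp add: compose_assoc JJ_assoc[OF JJ])
  qed
  have P_J: "P = (1/2) *\<^sub>R (id_blinfun + J)" by (simp add: J_def symmetry_def)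
  have "(P o\<^sub>L Z) + (Z o\<^sub>L P) = Z + (1/2) *\<^sub>R ((J o\<^sub>L Z) + (Z o\<^sub>L J))"
    by (subst (1 2) P_J) (simp add: compose_simps scaleR_add_right algebra_simps flip: scaleR_add_left)
  also have "\<dots> = Z + ?M" unfolding JZ ZJ by (simp add: half_double)
  finally have PZ: "(P o\<^sub>L Z) + (Z o\<^sub>L P) = Z + ?M" .
  have "?Q o\<^sub>L ?Q = (id_blinfun - P) + 2 *\<^sub>R Z - ((P o\<^sub>L Z) + (Z o\<^sub>L P)) + (Z o\<^sub>L Z)"
    unfolding Q by (simp add: compose_simps PP scaleR_2 algebra_simps)
  also have "\<dots> = ?Q - ?M + (Z o\<^sub>L Z)" unfolding PZ Q by (simp add: scaleR_2)
  finally have QQ: "?Q o\<^sub>L ?Q = ?Q \<longleftrightarrow> Z o\<^sub>L Z = ?M" by (auto simp: algebra_simps)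
  have ZM: "Z o\<^sub>L Z = ?M \<longleftrightarrow> (id_blinfun + ?X) o\<^sub>L ?M o\<^sub>L (id_blinfun - ?X) = id_blinfun"
    unfolding ZZ using op_inv_cancel(2)[OF invM, of _ id_blinfun] by simp
  have QQ_dg: "?Q o\<^sub>L ?Q = ?Q \<longleftrightarrow> dg J A = 0"
  proof
    assume "?Q o\<^sub>L ?Q = ?Q"
    then have eq: "?M - (?X o\<^sub>L ?M o\<^sub>L ?X) + ((?X o\<^sub>L ?M) - (?M o\<^sub>L ?X)) = id_blinfun"
      unfolding QQ ZM by (simp add: compose_simps compose_assoc algebra_simps)
    have 1: "J o\<^sub>L (?X o\<^sub>L ?M) = - (?X o\<^sub>L ?M o\<^sub>L J)"
      by (rule compose_anticommute_commute[OF JJ a M])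
    have 2: "J o\<^sub>L (?M o\<^sub>L ?X) = - (?M o\<^sub>L ?X o\<^sub>L J)"
      unfolding compose_assoc[symmetric] M unfolding compose_assoc a by (simp add: compose_simps)
    have 3: "J o\<^sub>L (?X o\<^sub>L ?M o\<^sub>L ?X) = ?X o\<^sub>L ?M o\<^sub>L ?X o\<^sub>L J"
      by (rule compose_anticommute[OF JJ 1 a])
    have 4: "J o\<^sub>L id_blinfun = id_blinfun o\<^sub>L J" by simp
    have d: "?M - (?X o\<^sub>L ?M o\<^sub>L ?X) = id_blinfun"
      using arg_cong[OF eq, of "dg J"]
      by (simp add: dg_linear dg_commuting[OF JJ M] dg_commuting[OF JJ 3] dg_commuting[OF JJ 4]
          dg_anticommuting[OF JJ 1] dg_anticommuting[OF JJ 2])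
    with eq have o: "?X o\<^sub>L ?M = ?M o\<^sub>L ?X" by simp
    have "(?X o\<^sub>L ?X) o\<^sub>L ?M = (?X o\<^sub>L ?M) o\<^sub>L ?X" unfolding compose_assoc by (simp only: o)
    then have "(id_blinfun - (?X o\<^sub>L ?X)) o\<^sub>L ?M = id_blinfun"
      using d by (simp add: compose_simps)
    also have "\<dots> = ?N o\<^sub>L ?M" by (simp add: op_inv[OF inv])
    finally have "id_blinfun - (?X o\<^sub>L ?X) = ?N" using op_inv_cancel(2)[OF invM] by blast
    then show "dg J A = 0" unfolding N by simp
  next
    assume "dg J A = 0"
    then have N': "?N = id_blinfun - (?X o\<^sub>L ?X)" unfolding N by simp
    have "?X o\<^sub>L ?N = ?N o\<^sub>L ?X" unfolding N' by (simp add: compose_simps compose_assoc)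
    then have "?M o\<^sub>L (?X o\<^sub>L ?N) o\<^sub>L ?M = ?M o\<^sub>L (?N o\<^sub>L ?X) o\<^sub>L ?M" by simp
    then have o: "?M o\<^sub>L ?X = ?X o\<^sub>L ?M"
      by (simp add: compose_assoc op_inv[OF inv] op_inv_assoc[OF inv])
    have "(id_blinfun + ?X) o\<^sub>L ?M o\<^sub>L (id_blinfun - ?X) = (id_blinfun - (?X o\<^sub>L ?X)) o\<^sub>L ?M"
      by (simp add: compose_simps compose_assoc o)
    also have "\<dots> = ?N o\<^sub>L ?M" by (simp only: N')
    finally show "?Q o\<^sub>L ?Q = ?Q" unfolding QQ ZM by (simp add: op_inv[OF inv])
  qed
  \<comment> \<open>If the point were 0 or I, then M = Z Z would be I - P or P. An invertible
    idempotent is the identity, so P itself would be 0 or I.\<close>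
  have idem1: "B = id_blinfun" if "op_invertible B" "B o\<^sub>L B = B" for B :: "'a \<Rightarrow>\<^sub>L 'a"
    using op_inv_cancel(1)[OF that(1), of B id_blinfun] that(2) by simp
  have "?Q \<noteq> 0 \<and> ?Q \<noteq> id_blinfun" if q: "?Q o\<^sub>L ?Q = ?Q"
  proof -
    have ZM: "Z o\<^sub>L Z = ?M" using q QQ by blast
    have "?Q \<noteq> 0"
    proof
      assume "?Q = 0"
      then have Z: "Z = - (id_blinfun - P)" unfolding Q by (simp add: add_eq_0_iff)
      have "?M = id_blinfun - P" unfolding ZM[symmetric] Z by (simp add: compose_simps PP)
      then have "id_blinfun - P = id_blinfun"
        using idem1[of "id_blinfun - P"] invM by (simp add: compose_simps PP)
      then show False using P by simp
    qed
    moreover have "?Q \<noteq> id_blinfun"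
    proof
      assume "?Q = id_blinfun"
      then have Z: "Z = P" unfolding Q by (simp add: algebra_simps)
      have "?M = P" unfolding ZM[symmetric] Z by (rule PP)
      then have "P = id_blinfun" using idem1[of P] invM PP by simp
      then show False using P by simp
    qed
    ultimately show ?thesis by blast
  qed
  then show ?thesis
    using QQ_dg by (auto simp: idempotents_def idem_model_def J_def)
qed

section \<open>Analyticity of the straightening and the resulting submanifold chart\<close>

lemma analytic_at_in_scaleR:
  assumes "analytic_at_in V f x"
  shows "analytic_at_in V (\<lambda>y. c *\<^sub>R f y) x"
  by (rule analytic_at_in_linear_compose[OF bounded_linear_scaleR_right assms])

lemma
  assumes "analytic_at_in V f x"
  shows analytic_dg: "analytic_at_in V (\<lambda>y. dg J (f y)) x"
    and analytic_off: "analytic_at_in V (\<lambda>y. off J (f y)) x"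
    and analytic_idem_arg: "analytic_at_in V (\<lambda>y. idem_arg P (f y)) x"
  unfolding dg_def off_def idem_arg_def
  by (intro analytic_intros analytic_at_in_scaleR assms)+

lemma analytic_idem_chart:
  fixes f :: "'a::real_normed_vector \<Rightarrow> ('k::banach \<Rightarrow>\<^sub>L 'k)"
  assumes "subspace V" "analytic_at_in V f x" "f x \<in> idem_dom P"
  shows "analytic_at_in V (\<lambda>y. idem_chart P (f y)) x"
  unfolding idem_chart_def idem_off_def using assms(3)
  by (intro analytic_intros analytic_dg analytic_off analytic_idem_arg analytic_op_inv_at assms(1,2))
    (auto simp: idem_dom_def)

lemma analytic_idem_point:
  fixes P :: "'k::banach \<Rightarrow>\<^sub>L 'k"
  assumes "subspace V" "A \<in> idem_image P"
  shows "analytic_at_in V (idem_point P) A"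
  unfolding idem_point_def[abs_def] using assms(2)
  by (intro analytic_intros analytic_dg analytic_off analytic_op_inv_at assms(1))
    (auto simp: idem_image_def idem_denom_def intro!: analytic_intros analytic_dg analytic_off)

lemma openin_idem_dom:
  fixes f :: "'a::real_normed_vector \<Rightarrow> ('k::banach \<Rightarrow>\<^sub>L 'k)"
  assumes "subspace V" "openin (top_of_set V) U" "\<And>x. x \<in> U \<Longrightarrow> analytic_at_in V f x"
  shows "openin (top_of_set V) {x \<in> U. f x \<in> idem_dom P}"
  unfolding idem_dom_def mem_Collect_eq
  by (intro openin_op_invertible assms analytic_dg analytic_idem_arg)

lemma openin_idem_image:
  fixes P :: "'k::banach \<Rightarrow>\<^sub>L 'k"
  assumes "subspace V"
  shows "openin (top_of_set V) (idem_image P \<inter> V)"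
proof -
  have "openin (top_of_set V) {A \<in> V. op_invertible (idem_denom P A)}"
    unfolding idem_denom_def
    by (intro openin_op_invertible assms analytic_intros analytic_dg analytic_off openin_subtopology_self)
  then show ?thesis by (simp add: idem_image_def Collect_conj_eq Int_commute)
qed

lemma
  fixes P :: "'k::banach \<Rightarrow>\<^sub>L 'k"
  assumes PP: "P o\<^sub>L P = P"
  shows banach_model_idem_model: "banach_model (idem_model P)"
    and complement_idem_model: "closed_complements_in UNIV (idem_model P) \<noteq> {}"
proof -
  have JJ: "symmetry P o\<^sub>L symmetry P = id_blinfun" by (rule symmetry_involution[OF PP])
  have closed: "closed {A. dg (symmetry P) A = 0}" "closed {A. off (symmetry P) A = 0}"
    unfolding dg_def off_def
    by (intro closed_Collect_eq continuous_intros
        bounded_bilinear.continuous_on[OF bounded_bilinear_blinfun_compose])+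
  then show "banach_model (idem_model P)"
    by (auto simp: banach_model_def idem_model_def subspace_def dg_linear)
  have "complements {A. off (symmetry P) A = 0} (idem_model P)"
  proof (rule complementsI)
    fix A
    show "\<exists>B\<in>{A. off (symmetry P) A = 0}. A - B \<in> idem_model P"
      by (rule bexI[of _ "dg (symmetry P) A"]) (simp_all add: idem_model_def dg_linear dg_dg[OF JJ] off_dg[OF JJ])
    show "A \<in> {A. off (symmetry P) A = 0} \<Longrightarrow> A \<in> idem_model P \<Longrightarrow> A = 0"
      using dg_plus_off[of "symmetry P" A] by (simp add: idem_model_def)
  qed (use closed in \<open>auto simp: idem_model_def subspace_def dg_linear off_linear\<close>)
  then show "closed_complements_in UNIV (idem_model P) \<noteq> {}"
    using complements_iff[of "{A. off (symmetry P) A = 0}" "idem_model P"] by blast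
qed

lemma idem_in_idem_dom:
  assumes PP: "P o\<^sub>L P = P"
  shows "P \<in> idem_dom P"
proof -
  have JJ: "symmetry P o\<^sub>L symmetry P = id_blinfun" by (rule symmetry_involution[OF PP])
  have "P - (id_blinfun - P) = symmetry P" by (simp add: symmetry_def scaleR_2)
  then have "idem_arg P P = id_blinfun" by (simp add: idem_arg_def JJ)
  moreover have "dg (symmetry P) id_blinfun = id_blinfun" by (rule dg_commuting[OF JJ]) simp
  ultimately show ?thesis
    unfolding idem_dom_def op_invertible_def by (auto intro!: exI[of _ id_blinfun])
qed

text \<open>The flat atlas consists of the identity chart alone, so membership in its maximal atlas
  amounts to analyticity of \<open>idem_chart P\<close> and \<open>idem_point P\<close> on open
  domains.\<close>

lemma idem_chart_in_submanifold_atlas: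
  fixes P :: "'k::banach \<Rightarrow>\<^sub>L 'k"
  assumes P: "P \<in> idempotents"
  shows "(idem_dom P \<inter> idempotents, idem_chart P, idem_model P) \<in> submanifold_atlas flat_atlas idempotents"
    and "inverse_maps (idem_chart P) (idem_point P) (idem_dom P \<inter> idempotents) (idem_image P \<inter> idem_model P)"
proof -
  have PP: "P o\<^sub>L P = P" and P0: "P \<noteq> 0" "P \<noteq> id_blinfun" using P by (auto simp: idempotents_def)
  note i = inverse_maps_idem_chart[OF PP]
  show 1: "inverse_maps (idem_chart P) (idem_point P) (idem_dom P \<inter> idempotents) (idem_image P \<inter> idem_model P)"
    by (rule inverse_maps_restrict[OF i idem_point_idempotent_iff[OF PP P0]])
  have openD: "openin (top_of_set UNIV) (idem_image P)"
    using openin_idem_image[of UNIV P] by simp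
  have openU: "openin (top_of_set UNIV) (idem_dom P)"
    using openin_idem_dom[of UNIV UNIV "\<lambda>x. x" P] by (simp add: analytic_intros)
  have ch: "is_chart (idem_dom P, idem_chart P, UNIV)"
    using inverse_mapsD(5,6)[OF i] openD by (simp add: is_chart_def banach_model_def)
  have "chart_compatible (idem_dom P, idem_chart P, UNIV) (UNIV, id, UNIV)"
  proof (rule chart_compatibleI[OF i, where l = id and D' = UNIV])
    show "analytic_on_in UNIV {y \<in> idem_image P. idem_point P y \<in> UNIV} (\<lambda>y. id (idem_point P y))"
      unfolding analytic_on_in_def using openD by (auto intro: analytic_idem_point)
    show "analytic_on_in UNIV {y \<in> UNIV. id y \<in> idem_dom P} (\<lambda>y. idem_chart P (id y))"
      unfolding analytic_on_in_def using openU by (auto intro!: analytic_idem_chart analytic_intros)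
  qed (auto simp: inverse_maps_def)
  then have "(idem_dom P, idem_chart P, UNIV) \<in> max_atlas flat_atlas"
    using ch by (simp add: max_atlas_def flat_atlas_def)
  moreover have "idem_chart P ` (idem_dom P \<inter> idempotents) = idem_chart P ` idem_dom P \<inter> idem_model P"
    by (simp add: inverse_mapsD(6)[OF 1] inverse_mapsD(6)[OF i])
  ultimately show "(idem_dom P \<inter> idempotents, idem_chart P, idem_model P) \<in> submanifold_atlas flat_atlas idempotents"
    unfolding submanifold_atlas_def
    using banach_model_idem_model[OF PP] complement_idem_model[OF PP] by blast
qed

section \<open>Bi-analyticity of the correspondence with the tangent bundle\<close>

text \<open>The tangent chart at \<open>E\<close> as a rational function of the orthogonal projection \<open>P\<close> onto the base
  point and of the operator \<open>S\<close> representing the tangent vector.\<close>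

definition oblique_of :: "'k::{real_inner,banach} set \<Rightarrow> ('k \<Rightarrow>\<^sub>L 'k) \<Rightarrow> ('k \<Rightarrow>\<^sub>L 'k)" where
  "oblique_of F P = P o\<^sub>L op_inv (P - proj F)"

definition bundle_coord ::
    "'k::{real_inner,banach} set \<Rightarrow> ('k \<Rightarrow>\<^sub>L 'k) \<Rightarrow> ('k \<Rightarrow>\<^sub>L 'k) \<Rightarrow> ('k \<Rightarrow>\<^sub>L 'k) \<times> ('k \<Rightarrow>\<^sub>L 'k)" where
  "bundle_coord E P S = ((oblique_of (E\<^sup>\<bottom>) P - id_blinfun) o\<^sub>L proj E,
     (id_blinfun - oblique_of (E\<^sup>\<bottom>) P) o\<^sub>L S o\<^sub>L oblique_of (E\<^sup>\<bottom>) P)"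

lemma gr_coord_proj:
  fixes E F G :: "'k::{real_inner,banach} set"
  assumes "complements E F" "complements G F"
  shows "gr_coord E F G = (oblique_of F (proj G) - id_blinfun) o\<^sub>L proj E"
  by (simp add: gr_coord_eq[OF assms] oblique_of_def obl_via_proj(2)[OF assms(2)])

lemma tangent_chart_bundle:
  fixes E G :: "'k::{real_inner,banach} set"
  assumes E: "E \<in> grassmannian" and G: "complements G (E\<^sup>\<bottom>)" and S: "(G, S) \<in> vanishing_bundle"
  shows "tangent_chart E (bundle_to_tangent (G, S)) = bundle_coord E (proj G) S"
  using tangent_chart_eq[OF E G bundle_to_tangent(1)[OF S]]
  by (simp add: bundle_to_tangent_def bundle_to_tangent(2)[OF S] bundle_coord_def oblique_of_def
      obl_via_proj(2)[OF G] gr_coord_proj[OF complements_orthogonal[OF grassmannianD[OF E]] G])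

lemma analytic_oblique_of:
  fixes f :: "'a::real_normed_vector \<Rightarrow> ('k::{real_inner,banach} \<Rightarrow>\<^sub>L 'k)"
  assumes "subspace V" "analytic_at_in V f x" "op_invertible (f x - proj F)"
  shows "analytic_at_in V (\<lambda>y. oblique_of F (f y)) x"
  unfolding oblique_of_def using assms by (intro analytic_intros analytic_op_inv_at)

lemma analytic_bundle_coord:
  fixes f g :: "'a::real_normed_vector \<Rightarrow> ('k::{real_inner,banach} \<Rightarrow>\<^sub>L 'k)"
  assumes "subspace V" "analytic_at_in V f x" "analytic_at_in V g x" "op_invertible (f x - proj (E\<^sup>\<bottom>))"
  shows "analytic_at_in V (\<lambda>y. bundle_coord E (f y) (g y)) x"
  unfolding bundle_coord_def using assms by (intro analytic_intros analytic_oblique_of)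

lemma subspace_model:
  fixes E :: "'k::{real_inner,banach} set"
  assumes "E \<in> grassmannian"
  shows "subspace (model E)" "closed (model E)"
  using subspace_gr_model closed_gr_model complements_orthogonal[OF grassmannianD[OF assms]] by blast+

lemma grassmannian_orthogonal_refl:
  fixes E :: "'k::{real_inner,banach} set"
  assumes "E \<in> grassmannian"
  shows "complements E (E\<^sup>\<bottom>)"
  by (rule complements_orthogonal[OF grassmannianD[OF assms]])

lemma proj_range_idem:
  fixes Q :: "'k::{real_inner,banach} \<Rightarrow>\<^sub>L 'k"
  assumes "Q \<in> idempotents"
  shows "op_invertible (Q + adj Q - id_blinfun)"
    "proj (range Q) = Q o\<^sub>L op_inv (Q + adj Q - id_blinfun)"
  using idem_selfadjoint_invertible proj_idem(2) idempotentsD(1)[OF assms] by blast+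

lemma analytic_map_idem_to_tangent:
  "analytic_map (idempotents :: ('k::{real_inner,banach} \<Rightarrow>\<^sub>L 'k) set) (submanifold_atlas flat_atlas idempotents)
     gr_tangent gr_tangent_atlas idem_to_tangent"
proof (rule analytic_mapI[where f = idem_to_tangent])
  fix P :: "'k \<Rightarrow>\<^sub>L 'k" assume P: "P \<in> idempotents"
  show "idem_to_tangent P \<in> gr_tangent" using inverse_mapsD(1)[OF inverse_maps_idem_to_tangent P] .
  define E where "E = range P"
  have E: "E \<in> grassmannian" unfolding E_def by (rule idempotentsD(2)[OF P])
  note E' = orthogonal_comp_grassmannian[OF E]
  have PP: "P o\<^sub>L P = P" by (rule idempotentsD(1)[OF P])
  have V: "subspace (idem_model P)" using banach_model_idem_model[OF PP] by (simp add: banach_model_def)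
  note i = idem_chart_in_submanifold_atlas(2)[OF P]
  let ?D = "idem_image P \<inter> idem_model P"
  define Q where "Q = idem_point P"
  \<comment> \<open>The orthogonal projection onto the range of \<open>Q y\<close>, in a form that
    shows its analyticity.\<close>
  define R where "R y = Q y o\<^sub>L op_inv (Q y + adj (Q y) - id_blinfun)" for y
  have Q: "Q y \<in> idempotents" if "y \<in> ?D" for y using inverse_mapsD(3)[OF i that] by (simp add: Q_def)
  have R: "proj (range (Q y)) = R y" if "y \<in> ?D" for y
    using proj_range_idem(2)[OF Q[OF that]] by (simp add: R_def)
  have anQ: "analytic_at_in (idem_model P) Q y" if "y \<in> ?D" for y
    unfolding Q_def by (rule analytic_idem_point[OF V]) (use that in auto)
  have anR: "analytic_at_in (idem_model P) R y" if "y \<in> ?D" for y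
    unfolding R_def[abs_def] using proj_range_idem(1)[OF Q[OF that]] anQ[OF that]
    by (intro analytic_intros analytic_op_inv_at analytic_at_in_adj V)
  \<comment> \<open>Lying in the domain of the tangent chart concerns only the base point
    \<open>range (Q y)\<close>, and its complementarity to \<open>E\<^sup>\<bottom>\<close> is
    invertibility.\<close>
  have cond: "Q y \<in> idempotents \<and> idem_to_tangent (Q y) \<in> tangent_chart_dom E
      \<longleftrightarrow> op_invertible (R y - proj (E\<^sup>\<bottom>))" if y: "y \<in> ?D" for y
    using Q[OF y] inverse_mapsD(1)[OF inverse_maps_idem_to_tangent Q[OF y]]
      complements_proj_iff[OF idempotentsD(2)[OF Q[OF y]] E']
    by (simp add: tangent_chart_dom_def R[OF y] idem_to_tangent_def Let_def)
  let ?S = "{y \<in> ?D. Q y \<in> idempotents \<and> idem_to_tangent (Q y) \<in> tangent_chart_dom E}"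
  have S: "?S = {y \<in> ?D. op_invertible (R y - proj (E\<^sup>\<bottom>))}" using cond by blast
  have "analytic_on_in (idem_model P) ?S
     (\<lambda>y. bundle_coord E (R y) ((id_blinfun - R y) o\<^sub>L adj (Q y) o\<^sub>L R y))"
    unfolding analytic_on_in_def S
  proof (intro conjI ballI)
    show "openin (top_of_set (idem_model P)) {y \<in> ?D. op_invertible (R y - proj (E\<^sup>\<bottom>))}"
      by (intro openin_op_invertible V openin_idem_image analytic_intros anR)
  next
    fix y assume "y \<in> {y \<in> ?D. op_invertible (R y - proj (E\<^sup>\<bottom>))}"
    then show "analytic_at_in (idem_model P) (\<lambda>y. bundle_coord E (R y) ((id_blinfun - R y) o\<^sub>L adj (Q y) o\<^sub>L R y)) y"
      by (intro analytic_bundle_coord analytic_intros analytic_at_in_adj anR anQ V) auto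
  qed
  then have an: "analytic_on_in (idem_model P) ?S (\<lambda>y. tangent_chart E (idem_to_tangent (Q y)))"
  proof (rule analytic_on_in_cong[OF _ V refl])
    fix y assume y: "y \<in> ?S"
    then have yD: "y \<in> ?D" by blast
    have G: "complements (range (Q y)) (E\<^sup>\<bottom>)"
      using y by (auto simp: tangent_chart_dom_def idem_to_tangent_def Let_def)
    show "tangent_chart E (idem_to_tangent (Q y)) = bundle_coord E (R y) ((id_blinfun - R y) o\<^sub>L adj (Q y) o\<^sub>L R y)"
      unfolding idem_to_tangent_eq(1)[OF Q[OF yD]]
      by (rule trans[OF tangent_chart_bundle[OF E G idem_to_tangent_eq(2)[OF Q[OF yD]]]]) (simp add: R[OF yD])
  qed
  have P1: "P \<in> idem_dom P \<inter> idempotents" using P idem_in_idem_dom[OF PP] by blast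
  have "idem_to_tangent P \<in> tangent_chart_dom E"
    using inverse_mapsD(1)[OF inverse_maps_idem_to_tangent P] grassmannian_orthogonal_refl[OF E]
    by (simp add: tangent_chart_dom_def idem_to_tangent_def Let_def E_def)
  then show "\<exists>U \<phi> V W \<psi> Z k D. (U, \<phi>, V) \<in> submanifold_atlas flat_atlas idempotents \<and>
      (W, \<psi>, Z) \<in> gr_tangent_atlas \<and> P \<in> U \<and> idem_to_tangent P \<in> W \<and> subspace V \<and> inverse_maps \<phi> k U D \<and>
      analytic_on_in V {y \<in> D. k y \<in> idempotents \<and> idem_to_tangent (k y) \<in> W} (\<lambda>y. \<psi> (idem_to_tangent (k y)))"
    using idem_chart_in_submanifold_atlas(1)[OF P] tangent_chart_in_atlas[OF E] P1 V i an
    unfolding Q_def by blast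
qed simp

lemma analytic_tangent_op:
  fixes E :: "'k::{real_inner,banach} set"
  assumes E: "E \<in> grassmannian" and y: "y \<in> model E \<times> model E"
  shows "analytic_at_in (model E \<times> model E) (\<lambda>y. proj (gr_point E (E\<^sup>\<bottom>) (fst y))) y"
    and "analytic_at_in (model E \<times> model E) (tangent_op E) y"
proof -
  show 1: "analytic_at_in (model E \<times> model E) (\<lambda>y. proj (gr_point E (E\<^sup>\<bottom>) (fst y))) y"
    using grassmannian_orthogonal_refl[OF E] subspace_model[OF E] y
    by (intro analytic_proj_gr_point analytic_intros) (auto intro!: subspace_Times)
  show "analytic_at_in (model E \<times> model E) (tangent_op E) y"
    unfolding tangent_op_def case_prod_unfold by (intro analytic_intros 1)
qed

lemma analytic_map_tangent_to_idem:
  "analytic_map gr_tangent gr_tangent_atlas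
     (idempotents :: ('k::{real_inner,banach} \<Rightarrow>\<^sub>L 'k) set) (submanifold_atlas flat_atlas idempotents)
     (inv_into idempotents idem_to_tangent)"
proof (rule analytic_mapI[where f = tangent_to_idem])
  fix p :: "'k set \<times> ('k \<Rightarrow> 'k)" assume p: "p \<in> gr_tangent"
  show P: "tangent_to_idem p \<in> idempotents"
    using inverse_mapsD(3)[OF inverse_maps_idem_to_tangent p] .
  show "inv_into idempotents idem_to_tangent p = tangent_to_idem p"
    using inverse_mapsD(7)[OF inverse_maps_idem_to_tangent p] .
  define E where "E = fst p"
  have E: "E \<in> grassmannian" using p by (auto simp: gr_tangent_def E_def)
  define P where "P = tangent_to_idem p"
  have P: "P \<in> idempotents" using P by (simp add: P_def)
  let ?V = "model E \<times> model E"
  have V: "subspace ?V" using subspace_model[OF E] by (intro subspace_Times)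
  note i = inverse_maps_tangent_chart[OF E]
  \<comment> \<open>The idempotent with tangent coordinate \<open>y\<close> as one operator
    expression; its coordinate domain is then cut out by \<open>idem_dom P\<close>.\<close>
  define h where "h y = proj (gr_point E (E\<^sup>\<bottom>) (fst y)) + adj (tangent_op E y)" for y
  have h: "tangent_to_idem (tangent_point E y) = h y" if "y \<in> ?V" for y
  proof -
    obtain A W where y: "y = (A, W)" "A \<in> model E" "W \<in> model E" using \<open>y \<in> ?V\<close> by blast
    show ?thesis
      using bundle_to_tangent(2)[OF tangent_op_vanishing[OF E y(2), of W]]
      by (simp add: y(1) tangent_point_def bundle_to_tangent_def tangent_to_idem_def h_def)
  qed
  have anh: "analytic_at_in ?V h y" if "y \<in> ?V" for y
    unfolding h_def[abs_def] by (intro analytic_intros analytic_at_in_adj analytic_tangent_op E that)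
  have "{y \<in> ?V. tangent_point E y \<in> gr_tangent \<and> tangent_to_idem (tangent_point E y) \<in> idem_dom P \<inter> idempotents}
      = {y \<in> ?V. h y \<in> idem_dom P}"
  proof -
    have 1: "tangent_point E y \<in> gr_tangent" if "y \<in> ?V" for y
      using inverse_mapsD(3)[OF i that] by (simp add: tangent_chart_dom_def)
    have 2: "h y \<in> idempotents" if "y \<in> ?V" for y
      using inverse_mapsD(3)[OF inverse_maps_idem_to_tangent 1[OF that]] by (simp add: h[OF that])
    show ?thesis
    proof (rule Collect_cong, rule conj_cong[OF refl])
      fix y assume y: "y \<in> ?V"
      show "(tangent_point E y \<in> gr_tangent \<and> tangent_to_idem (tangent_point E y) \<in> idem_dom P \<inter> idempotents)
          = (h y \<in> idem_dom P)"
        unfolding h[OF y] using 1[OF y] 2[OF y] by simp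
    qed
  qed
  moreover have "analytic_on_in ?V {y \<in> ?V. h y \<in> idem_dom P} (\<lambda>y. idem_chart P (h y))"
    unfolding analytic_on_in_def
  proof (intro conjI ballI)
    show "openin (top_of_set ?V) {y \<in> ?V. h y \<in> idem_dom P}"
      by (intro openin_idem_dom V anh) auto
    show "analytic_at_in ?V (\<lambda>y. idem_chart P (h y)) y" if "y \<in> {y \<in> ?V. h y \<in> idem_dom P}" for y
      using that by (intro analytic_idem_chart V anh) auto
  qed
  then have "analytic_on_in ?V {y \<in> ?V. h y \<in> idem_dom P}
     (\<lambda>y. idem_chart P (tangent_to_idem (tangent_point E y)))"
    by (rule analytic_on_in_cong[OF _ V refl]) (simp add: h)
  ultimately have an: "analytic_on_in ?V
     {y \<in> ?V. tangent_point E y \<in> gr_tangent \<and> tangent_to_idem (tangent_point E y) \<in> idem_dom P \<inter> idempotents}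
     (\<lambda>y. idem_chart P (tangent_to_idem (tangent_point E y)))" by simp
  have "p \<in> tangent_chart_dom E"
    using p grassmannian_orthogonal_refl[OF E] by (simp add: tangent_chart_dom_def E_def mem_Times_iff)
  moreover have "tangent_to_idem p \<in> idem_dom P \<inter> idempotents"
    using P idem_in_idem_dom[OF idempotentsD(1)[OF P]] by (simp add: P_def)
  ultimately show "\<exists>U \<phi> V W \<psi> Z k D. (U, \<phi>, V) \<in> gr_tangent_atlas \<and>
      (W, \<psi>, Z) \<in> submanifold_atlas flat_atlas idempotents \<and> p \<in> U \<and> tangent_to_idem p \<in> W \<and>
      subspace V \<and> inverse_maps \<phi> k U D \<and>
      analytic_on_in V {y \<in> D. k y \<in> gr_tangent \<and> tangent_to_idem (k y) \<in> W} (\<lambda>y. \<psi> (tangent_to_idem (k y)))"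
    using tangent_chart_in_atlas[OF E] idem_chart_in_submanifold_atlas(1)[OF P] V i an by blast
qed

section \<open>The vanishing bundle as a subbundle\<close>

text \<open>For \<open>G\<close> complementary to \<open>E\<^sup>\<bottom>\<close>, the operator \<open>D = P\<^sub>G + P\<^sub>E - I\<close> is invertible and satisfies
  \<open>D P\<^sub>E = P\<^sub>G D\<close>, so conjugation by it carries the fibre over \<open>G\<close> to the fibre over \<open>E\<close>.\<close>

definition intertwiner :: "'k::{real_inner,banach} set \<Rightarrow> ('k \<Rightarrow>\<^sub>L 'k) \<Rightarrow> ('k \<Rightarrow>\<^sub>L 'k)" where
  "intertwiner E P = P + proj E - id_blinfun"

definition triv :: "'k::{real_inner,banach} set \<Rightarrow> ('k \<Rightarrow>\<^sub>L 'k) \<Rightarrow> ('k \<Rightarrow>\<^sub>L 'k) \<Rightarrow> ('k \<Rightarrow>\<^sub>L 'k)" where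
  "triv E P S = op_inv (intertwiner E P) o\<^sub>L S o\<^sub>L intertwiner E P"

definition triv_inv :: "'k::{real_inner,banach} set \<Rightarrow> ('k \<Rightarrow>\<^sub>L 'k) \<Rightarrow> ('k \<Rightarrow>\<^sub>L 'k) \<Rightarrow> ('k \<Rightarrow>\<^sub>L 'k)" where
  "triv_inv E P S = intertwiner E P o\<^sub>L S o\<^sub>L op_inv (intertwiner E P)"

text \<open>Since the projection onto \<open>E\<^sup>\<bottom>\<close> is I - P_E, the intertwiner
  equals \<open>proj G - proj (E\<^sup>\<bottom>)\<close>.\<close>

lemma intertwiner_invertible:
  fixes E G :: "'k::{real_inner,banach} set"
  assumes E: "E \<in> grassmannian" and G: "complements G (E\<^sup>\<bottom>)"
  shows "op_invertible (intertwiner E (proj G))"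
  using obl_via_proj(1)[OF G]
  by (simp add: intertwiner_def proj_orthogonal_comp[OF grassmannianD[OF E]] diff_diff_eq2)

lemma
  fixes E G :: "'k::{real_inner,banach} set"
  assumes E: "E \<in> grassmannian" and G: "complements G (E\<^sup>\<bottom>)"
  shows triv_triv_inv: "triv E (proj G) (triv_inv E (proj G) S) = S"
    and triv_inv_triv: "triv_inv E (proj G) (triv E (proj G) S) = S"
    and triv_inv_vanishing_iff: "(G, triv_inv E (proj G) S) \<in> vanishing_bundle \<longleftrightarrow> S \<in> model E"
proof -
  let ?D = "intertwiner E (proj G)"
  note inv = intertwiner_invertible[OF E G]
  note sE = grassmannianD[OF E] and sG = complementsD(1,2)[OF G]
  show 1: "triv E (proj G) (triv_inv E (proj G) S) = S"
    by (simp add: triv_def triv_inv_def compose_assoc op_inv[OF inv] op_inv_assoc[OF inv])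
  show "triv_inv E (proj G) (triv E (proj G) S) = S"
    by (simp add: triv_def triv_inv_def compose_assoc op_inv[OF inv] op_inv_assoc[OF inv])
  have D: "?D o\<^sub>L proj E = proj G o\<^sub>L ?D"
    by (simp add: intertwiner_def compose_simps proj_proj[OF sE] proj_proj[OF sG])
  have "op_inv ?D o\<^sub>L (?D o\<^sub>L proj E) o\<^sub>L op_inv ?D = op_inv ?D o\<^sub>L (proj G o\<^sub>L ?D) o\<^sub>L op_inv ?D"
    unfolding D ..
  then have D': "proj E o\<^sub>L op_inv ?D = op_inv ?D o\<^sub>L proj G"
    by (simp add: compose_assoc op_inv[OF inv] op_inv_assoc[OF inv])
  have "triv_inv E (proj G) S o\<^sub>L proj G = ?D o\<^sub>L (S o\<^sub>L proj E) o\<^sub>L op_inv ?D"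
    by (simp add: triv_inv_def compose_assoc D')
  then have 2: "triv_inv E (proj G) S o\<^sub>L proj G = triv_inv E (proj G) S \<longleftrightarrow> S o\<^sub>L proj E = S"
    using op_inv_cancel[OF inv] op_inv_cancel[OF op_invertible_op_inv(1)[OF inv]]
    by (simp add: triv_inv_def compose_assoc)
      (metis compose_assoc op_inv_cancel(2)[OF op_invertible_op_inv(1)[OF inv]])
  have "proj G o\<^sub>L triv_inv E (proj G) S = ?D o\<^sub>L (proj E o\<^sub>L S) o\<^sub>L op_inv ?D"
    by (simp add: triv_inv_def D flip: compose_assoc)
  then have 3: "proj G o\<^sub>L triv_inv E (proj G) S = 0 \<longleftrightarrow> proj E o\<^sub>L S = 0"
    using op_inv_cancel(2)[OF op_invertible_op_inv(1)[OF inv], of "?D o\<^sub>L (proj E o\<^sub>L S)" 0]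
      op_inv_cancel(1)[OF inv, of "proj E o\<^sub>L S" 0] by simp
  show "(G, triv_inv E (proj G) S) \<in> vanishing_bundle \<longleftrightarrow> S \<in> model E"
    unfolding vanishing_bundle_iff gr_model_orthogonal_iff[OF sE] 2 3
    using complements_grassmannian[OF G orthogonal_comp_grassmannian[OF E]] by blast
qed

lemma
  fixes f g :: "'a::real_normed_vector \<Rightarrow> ('k::{real_inner,banach} \<Rightarrow>\<^sub>L 'k)"
  assumes "subspace V" "analytic_at_in V f x" "analytic_at_in V g x" "op_invertible (intertwiner E (f x))"
  shows analytic_triv: "analytic_at_in V (\<lambda>y. triv E (f y) (g y)) x"
    and analytic_triv_inv: "analytic_at_in V (\<lambda>y. triv_inv E (f y) (g y)) x"
proof -
  have D: "analytic_at_in V (\<lambda>y. intertwiner E (f y)) x"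
    unfolding intertwiner_def by (intro analytic_intros assms)
  show "analytic_at_in V (\<lambda>y. triv E (f y) (g y)) x" "analytic_at_in V (\<lambda>y. triv_inv E (f y) (g y)) x"
    unfolding triv_def triv_inv_def by (intro analytic_intros D analytic_op_inv_at assms)+
qed

text \<open>The map S to (I - P_E) S P_E is a bounded projection of L(K) onto
  \<open>model E\<close>, and its kernel is the complement.\<close>

lemma complement_model:
  fixes E :: "'k::{real_inner,banach} set"
  assumes E: "E \<in> grassmannian"
  shows "complements {S. (id_blinfun - proj E) o\<^sub>L S o\<^sub>L proj E = 0} (model E)" (is "complements ?C _")
proof (rule complementsI)
  note sE = grassmannianD[OF E]
  note PP = proj_proj[OF sE]
  show "subspace ?C" by (auto simp: subspace_def compose_simps)
  show "closed ?C"
    by (intro closed_Collect_eq continuous_intros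
        bounded_bilinear.continuous_on[OF bounded_bilinear_blinfun_compose])
  show "S = 0" if "S \<in> ?C" "S \<in> model E" for S
    using that unfolding gr_model_orthogonal_iff[OF sE] by (simp add: compose_simps)
  fix S
  let ?T = "(id_blinfun - proj E) o\<^sub>L S o\<^sub>L proj E"
  have "?T \<in> model E"
    unfolding gr_model_orthogonal_iff[OF sE]
    by (simp add: compose_simps compose_assoc PP PP[THEN compose_eq_assoc])
  moreover have "S - ?T \<in> ?C"
    by (simp add: compose_simps compose_assoc PP PP[THEN compose_eq_assoc])
  ultimately show "\<exists>B\<in>?C. S - B \<in> model E" by (intro bexI[of _ "S - ?T"]) auto
qed (use subspace_model[OF E] in auto)

section \<open>Charts of the trivial bundle adapted to the vanishing bundle\<close>

lemma prod_flat_chart: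
  fixes E F :: "'k::{real_inner,banach} set"
  assumes "F \<in> grassmannian" "complements E F"
  shows "({G. complements G F} \<times> UNIV, map_prod (gr_coord E F) id, gr_model E F \<times> UNIV)
      \<in> prod_atlas gr_atlas (flat_atlas :: ('k \<Rightarrow>\<^sub>L 'k, 'k \<Rightarrow>\<^sub>L 'k) chart set)"
  using assms unfolding prod_atlas_def gr_atlas_eq flat_atlas_def by blast

lemma prod_flat_chartE:
  fixes d :: "('k::{real_inner,banach} set \<times> ('k \<Rightarrow>\<^sub>L 'k), ('k \<Rightarrow>\<^sub>L 'k) \<times> ('k \<Rightarrow>\<^sub>L 'k)) chart"
  assumes "d \<in> prod_atlas gr_atlas flat_atlas"
  obtains E F :: "'k set" where "F \<in> grassmannian" "complements E F"
    "d = ({G. complements G F} \<times> UNIV, map_prod (gr_coord E F) id, gr_model E F \<times> UNIV)"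
  using assms unfolding prod_atlas_def gr_atlas_eq flat_atlas_def by blast

lemma inverse_maps_prod_flat:
  fixes E F :: "'k::{real_inner,banach} set"
  assumes "complements E F"
  shows "inverse_maps (map_prod (gr_coord E F) id) (map_prod (gr_point E F) id)
     ({G. complements G F} \<times> UNIV) (gr_model E F \<times> UNIV)"
  using inverse_maps_gr_coord[OF assms] unfolding inverse_maps_def by auto

lemma analytic_proj_gr_point_fst:
  fixes E F :: "'k::{real_inner,banach} set" and Z :: "'b::real_normed_vector set"
  assumes E: "complements E F" and Z: "subspace Z" and y: "y \<in> gr_model E F \<times> Z"
  shows "analytic_at_in (gr_model E F \<times> Z) (\<lambda>y. proj (gr_point E F (fst y))) y"
  using subspace_gr_model[OF E] y Z
  by (intro analytic_proj_gr_point E analytic_intros) (auto intro!: subspace_Times)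

lemma openin_complements_prod:
  fixes E F F1 :: "'k::{real_inner,banach} set" and Z :: "'b::real_normed_vector set"
  assumes E: "complements E F" and F: "F \<in> grassmannian" and F1: "F1 \<in> grassmannian" and Z: "subspace Z"
  shows "openin (top_of_set (gr_model E F \<times> Z)) {y \<in> gr_model E F \<times> Z. complements (gr_point E F (fst y)) F1}"
proof -
  have "{y \<in> gr_model E F \<times> Z. complements (gr_point E F (fst y)) F1}
    = {y \<in> gr_model E F \<times> Z. op_invertible (proj (gr_point E F (fst y)) - proj F1)}"
    using complements_proj_iff[OF complements_grassmannian[OF complements_gr_point[OF E] F] F1] by auto
  moreover have "openin (top_of_set (gr_model E F \<times> Z)) \<dots>"
    using subspace_gr_model[OF E] Z
    by (intro openin_op_invertible subspace_Times analytic_intros analytic_proj_gr_point_fst[OF E Z]) auto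
  ultimately show ?thesis by simp
qed

text \<open>A product chart twisted by \<open>triv\<close>: in product charts the fibre of the
  vanishing bundle moves with the base point, here it is always \<open>model E\<close>.\<close>

definition vb_chart ::
    "'k::{real_inner,banach} set \<Rightarrow> 'k set \<times> ('k \<Rightarrow>\<^sub>L 'k) \<Rightarrow> ('k \<Rightarrow>\<^sub>L 'k) \<times> ('k \<Rightarrow>\<^sub>L 'k)" where
  "vb_chart E = (\<lambda>(G, S). (gr_coord E (E\<^sup>\<bottom>) G, triv E (proj G) S))"

definition vb_point ::
    "'k::{real_inner,banach} set \<Rightarrow> ('k \<Rightarrow>\<^sub>L 'k) \<times> ('k \<Rightarrow>\<^sub>L 'k) \<Rightarrow> 'k set \<times> ('k \<Rightarrow>\<^sub>L 'k)" where
  "vb_point E = (\<lambda>(A, S). (gr_point E (E\<^sup>\<bottom>) A, triv_inv E (proj (gr_point E (E\<^sup>\<bottom>) A)) S))"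

definition vb_dom :: "'k::{real_inner,banach} set \<Rightarrow> ('k set \<times> ('k \<Rightarrow>\<^sub>L 'k)) set" where
  "vb_dom E = {G. complements G (E\<^sup>\<bottom>)} \<times> UNIV"

lemma inverse_maps_vb_chart:
  fixes E :: "'k::{real_inner,banach} set"
  assumes E: "E \<in> grassmannian"
  shows "inverse_maps (vb_chart E) (vb_point E) (vb_dom E) (model E \<times> UNIV)"
  using inverse_maps_gr_coord[OF grassmannian_orthogonal_refl[OF E]] triv_triv_inv[OF E] triv_inv_triv[OF E]
  unfolding inverse_maps_def vb_chart_def vb_point_def vb_dom_def by auto

text \<open>Compatibility is required with every product chart, over arbitrary pairs
  \<open>E1\<close>, \<open>F1\<close>. On an overlap both complementarity conditions hold, so the
  oblique projection along the other kernel and the inverse of the intertwiner are available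
  together.\<close>

lemma vb_chart_in_max_atlas:
  fixes E :: "'k::{real_inner,banach} set"
  assumes E: "E \<in> grassmannian"
  shows "(vb_dom E, vb_chart E, model E \<times> UNIV) \<in> max_atlas (prod_atlas gr_atlas flat_atlas)"
proof -
  note cE = grassmannian_orthogonal_refl[OF E] and E' = orthogonal_comp_grassmannian[OF E]
  note i = inverse_maps_vb_chart[OF E]
  have V: "subspace (model E \<times> (UNIV :: ('k \<Rightarrow>\<^sub>L 'k) set))" "closed (model E \<times> (UNIV :: ('k \<Rightarrow>\<^sub>L 'k) set))"
    using subspace_model[OF E] by (auto intro!: subspace_Times closed_Times)
  have "is_chart (vb_dom E, vb_chart E, model E \<times> UNIV)"
    using V inverse_mapsD(5,6)[OF i] by (simp add: is_chart_def banach_model_def)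
  moreover have "vb_dom E \<subseteq> \<Union> (fst ` prod_atlas gr_atlas (flat_atlas :: ('k \<Rightarrow>\<^sub>L 'k, 'k \<Rightarrow>\<^sub>L 'k) chart set))"
    using prod_flat_chart[OF E' cE] unfolding vb_dom_def by force
  moreover have "chart_compatible (vb_dom E, vb_chart E, model E \<times> UNIV) d"
    if d': "d \<in> prod_atlas gr_atlas flat_atlas" for d
  proof -
    obtain E1 F1 :: "'k set" where F1: "F1 \<in> grassmannian" and E1: "complements E1 F1"
      and d: "d = ({G. complements G F1} \<times> UNIV, map_prod (gr_coord E1 F1) id, gr_model E1 F1 \<times> UNIV)"
      using prod_flat_chartE[OF d'] .
    let ?W = "gr_model E1 F1 \<times> (UNIV :: ('k \<Rightarrow>\<^sub>L 'k) set)"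
    have W: "subspace ?W" using subspace_gr_model[OF E1] by (intro subspace_Times) auto
    show ?thesis
      unfolding d
    proof (rule chart_compatibleI[OF i inverse_maps_prod_flat[OF E1] V(1) W])
      let ?S = "{y \<in> model E \<times> (UNIV :: ('k \<Rightarrow>\<^sub>L 'k) set). complements (gr_point E (E\<^sup>\<bottom>) (fst y)) F1}"
      let ?R = "\<lambda>y. proj (gr_point E (E\<^sup>\<bottom>) (fst y))"
      have S: "{y \<in> model E \<times> UNIV. vb_point E y \<in> {G. complements G F1} \<times> UNIV} = ?S"
        by (auto simp: vb_point_def)
      have "analytic_on_in (model E \<times> UNIV) ?S
          (\<lambda>y. ((oblique_of F1 (?R y) - id_blinfun) o\<^sub>L proj E1, triv_inv E (?R y) (snd y)))"
        unfolding analytic_on_in_def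
      proof (intro conjI ballI)
        show "openin (top_of_set (model E \<times> (UNIV :: ('k \<Rightarrow>\<^sub>L 'k) set))) ?S"
          by (rule openin_complements_prod[OF cE E' F1 subspace_UNIV])
        fix y assume y: "y \<in> ?S"
        then have "fst y \<in> model E" by auto
        from intertwiner_invertible[OF E complements_gr_point[OF cE this]]
        show "analytic_at_in (model E \<times> UNIV)
          (\<lambda>y. ((oblique_of F1 (?R y) - id_blinfun) o\<^sub>L proj E1, triv_inv E (?R y) (snd y))) y"
          using y obl_via_proj(1)
          by (intro analytic_intros analytic_oblique_of analytic_triv_inv V
              analytic_proj_gr_point_fst[OF cE subspace_UNIV]) auto
      qed
      then show "analytic_on_in (model E \<times> UNIV) {y \<in> model E \<times> UNIV. vb_point E y \<in> {G. complements G F1} \<times> UNIV}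
          (\<lambda>y. map_prod (gr_coord E1 F1) id (vb_point E y))"
        unfolding S
        by (rule analytic_on_in_cong[OF _ V(1) refl])
           (auto simp: vb_point_def gr_coord_proj[OF E1])
      let ?S' = "{y \<in> ?W. complements (gr_point E1 F1 (fst y)) (E\<^sup>\<bottom>)}"
      let ?R' = "\<lambda>y. proj (gr_point E1 F1 (fst y))"
      have S': "{y \<in> ?W. map_prod (gr_point E1 F1) id y \<in> vb_dom E} = ?S'"
        by (auto simp: vb_dom_def)
      have "analytic_on_in ?W ?S' (\<lambda>y. ((oblique_of (E\<^sup>\<bottom>) (?R' y) - id_blinfun) o\<^sub>L proj E, triv E (?R' y) (snd y)))"
        unfolding analytic_on_in_def
      proof (intro conjI ballI)
        show "openin (top_of_set ?W) ?S'"
          by (rule openin_complements_prod[OF E1 F1 E' subspace_UNIV])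
        fix y assume y: "y \<in> ?S'"
        then have "complements (gr_point E1 F1 (fst y)) (E\<^sup>\<bottom>)" by auto
        from intertwiner_invertible[OF E this] obl_via_proj(1)[OF this]
        show "analytic_at_in ?W (\<lambda>y. ((oblique_of (E\<^sup>\<bottom>) (?R' y) - id_blinfun) o\<^sub>L proj E, triv E (?R' y) (snd y))) y"
          using y
          by (intro analytic_intros analytic_oblique_of analytic_triv W
              analytic_proj_gr_point_fst[OF E1 subspace_UNIV]) auto
      qed
      then show "analytic_on_in ?W {y \<in> ?W. map_prod (gr_point E1 F1) id y \<in> vb_dom E}
          (\<lambda>y. vb_chart E (map_prod (gr_point E1 F1) id y))"
        unfolding S'
        by (rule analytic_on_in_cong[OF _ W refl])
           (auto simp: vb_chart_def gr_coord_proj[OF cE])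
    qed
  qed
  ultimately show ?thesis by (simp add: max_atlas_def)
qed

lemma vb_chart_in_submanifold_atlas:
  fixes E :: "'k::{real_inner,banach} set"
  assumes E: "E \<in> grassmannian"
  shows "(vb_dom E \<inter> vanishing_bundle, vb_chart E, model E \<times> model E)
      \<in> submanifold_atlas (prod_atlas gr_atlas flat_atlas) vanishing_bundle"
    and "inverse_maps (vb_chart E) (vb_point E) (vb_dom E \<inter> vanishing_bundle) (model E \<times> model E)"
proof -
  note cE = grassmannian_orthogonal_refl[OF E]
  note i = inverse_maps_vb_chart[OF E]
  have eq: "(model E \<times> UNIV) \<inter> (model E \<times> model E) = model E \<times> model E" by auto
  have "vb_point E y \<in> vanishing_bundle \<longleftrightarrow> y \<in> model E \<times> model E" if "y \<in> model E \<times> UNIV" for y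
    using that triv_inv_vanishing_iff[OF E complements_gr_point[OF cE]] by (auto simp: vb_point_def)
  from inverse_maps_restrict[OF i this]
  show 1: "inverse_maps (vb_chart E) (vb_point E) (vb_dom E \<inter> vanishing_bundle) (model E \<times> model E)"
    unfolding eq .
  let ?C = "{S. (id_blinfun - proj E) o\<^sub>L S o\<^sub>L proj E = 0}"
  note C = complement_model[OF E]
  \<comment> \<open>The base coordinates already fill \<open>model E\<close>, so only the fibre
    direction needs a complement.\<close>
  have "{0} \<times> ?C \<in> closed_complements_in (model E \<times> UNIV) (model E \<times> model E)"
    unfolding closed_complements_in_def
  proof (intro CollectI conjI)
    show "subspace ({0 :: 'k \<Rightarrow>\<^sub>L 'k} \<times> ?C)" using complementsD(1)[OF C] by (intro subspace_Times) auto
    show "closed ({0 :: 'k \<Rightarrow>\<^sub>L 'k} \<times> ?C)" using complementsD(2)[OF C] by (intro closed_Times) auto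
    show "{0} \<times> ?C \<inter> model E \<times> model E = {0}"
      using complementsD(5)[OF C] subspace_0[OF subspace_model(1)[OF E]] subspace_0[OF complementsD(1)[OF C]]
      by (auto simp: zero_prod_def)
    show "{x + y |x y. x \<in> {0} \<times> ?C \<and> y \<in> model E \<times> model E} = model E \<times> UNIV"
    proof safe
      fix A S assume A: "A \<in> model E"
      obtain B where "B \<in> ?C" "S - B \<in> model E" using complementsD(6)[OF C, of S] by blast
      then show "\<exists>x y. (A, S) = x + y \<and> x \<in> {0} \<times> ?C \<and> y \<in> model E \<times> model E"
        using A by (intro exI[of _ "(0, B)"] exI[of _ "(A, S - B)"]) auto
    qed auto
  qed
  moreover have "vb_chart E ` (vb_dom E \<inter> vanishing_bundle) = vb_chart E ` vb_dom E \<inter> (model E \<times> model E)"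
    unfolding inverse_mapsD(6)[OF 1] inverse_mapsD(6)[OF i] eq ..
  moreover have "banach_model (model E \<times> model E)"
    using subspace_model[OF E] by (auto simp: banach_model_def intro!: subspace_Times closed_Times)
  ultimately show "(vb_dom E \<inter> vanishing_bundle, vb_chart E, model E \<times> model E)
      \<in> submanifold_atlas (prod_atlas gr_atlas flat_atlas) vanishing_bundle"
    unfolding submanifold_atlas_def using vb_chart_in_max_atlas[OF E] by blast
qed

section \<open>The map of (b) and its inverse in charts\<close>

lemma analytic_map_tangent_to_trivial:
  "analytic_map (gr_tangent :: ('k::{real_inner,banach} set \<times> ('k \<Rightarrow> 'k)) set) gr_tangent_atlas
     vanishing_bundle (submanifold_atlas (prod_atlas gr_atlas flat_atlas) vanishing_bundle) tangent_to_trivial"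
proof (rule analytic_mapI[where f = tangent_to_trivial])
  fix p :: "'k set \<times> ('k \<Rightarrow> 'k)" assume p: "p \<in> gr_tangent"
  note j = inverse_maps_tangent_to_trivial[where 'k = 'k]
  show pv: "tangent_to_trivial p \<in> vanishing_bundle" using inverse_mapsD(1)[OF j p] .
  define E where "E = fst p"
  have E: "E \<in> grassmannian" using p by (auto simp: gr_tangent_def E_def)
  note cE = grassmannian_orthogonal_refl[OF E]
  let ?V = "model E \<times> model E"
  have V: "subspace ?V" using subspace_model[OF E] by (intro subspace_Times)
  note i = inverse_maps_tangent_chart[OF E]
  let ?R = "\<lambda>y. proj (gr_point E (E\<^sup>\<bottom>) (fst y))"
  have tt: "tangent_to_trivial (tangent_point E y) = (gr_point E (E\<^sup>\<bottom>) (fst y), tangent_op E y)"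
    and td: "tangent_point E y \<in> tangent_chart_dom E" if y': "y \<in> ?V" for y
  proof -
    obtain A W where y: "y = (A, W)" "A \<in> model E" "W \<in> model E" using y' by blast
    show "tangent_to_trivial (tangent_point E y) = (gr_point E (E\<^sup>\<bottom>) (fst y), tangent_op E y)"
      using inverse_mapsD(4)[OF j tangent_op_vanishing[OF E y(2), of W]] by (simp add: y(1) tangent_point_def)
    show "tangent_point E y \<in> tangent_chart_dom E" using inverse_mapsD(3)[OF i y'] .
  qed
  \<comment> \<open>The tangent chart and the bundle chart at \<open>E\<close> lie over the same
    chart of the base, so the coordinate domain is the whole model space.\<close>
  have S: "{y \<in> ?V. tangent_point E y \<in> gr_tangent \<and>
      tangent_to_trivial (tangent_point E y) \<in> vb_dom E \<inter> vanishing_bundle} = ?V"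
  proof -
    have "tangent_point E y \<in> gr_tangent \<and> tangent_to_trivial (tangent_point E y) \<in> vb_dom E \<inter> vanishing_bundle"
      if y: "y \<in> ?V" for y
      using td[OF y] inverse_mapsD(1)[OF j, of "tangent_point E y"] complements_gr_point[OF cE, of "fst y"] y
      by (auto simp: tangent_chart_dom_def tt[OF y] vb_dom_def)
    then show ?thesis by blast
  qed
  have "analytic_on_in ?V ?V (\<lambda>y. (fst y, triv E (?R y) (tangent_op E y)))"
    unfolding analytic_on_in_def
    by (intro conjI ballI openin_subtopology_self analytic_intros analytic_triv V analytic_tangent_op[OF E])
       (auto intro!: intertwiner_invertible[OF E] complements_gr_point[OF cE])
  then have an: "analytic_on_in ?V {y \<in> ?V. tangent_point E y \<in> gr_tangent \<and>
      tangent_to_trivial (tangent_point E y) \<in> vb_dom E \<inter> vanishing_bundle}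
     (\<lambda>y. vb_chart E (tangent_to_trivial (tangent_point E y)))"
    unfolding S
    by (rule analytic_on_in_cong[OF _ V refl])
       (auto simp: tt vb_chart_def gr_coord_gr_point[OF cE])
  have "p \<in> tangent_chart_dom E"
    using p cE by (simp add: tangent_chart_dom_def E_def mem_Times_iff)
  moreover have "tangent_to_trivial p \<in> vb_dom E \<inter> vanishing_bundle"
    using pv cE by (auto simp: vb_dom_def tangent_to_trivial_def E_def case_prod_unfold)
  ultimately show "\<exists>U \<phi> V W \<psi> Z k D. (U, \<phi>, V) \<in> gr_tangent_atlas \<and>
      (W, \<psi>, Z) \<in> submanifold_atlas (prod_atlas gr_atlas flat_atlas) vanishing_bundle \<and> p \<in> U \<and>
      tangent_to_trivial p \<in> W \<and> subspace V \<and> inverse_maps \<phi> k U D \<and>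
      analytic_on_in V {y \<in> D. k y \<in> gr_tangent \<and> tangent_to_trivial (k y) \<in> W} (\<lambda>y. \<psi> (tangent_to_trivial (k y)))"
    using tangent_chart_in_atlas[OF E] vb_chart_in_submanifold_atlas(1)[OF E] V i an by blast
qed simp

lemma analytic_map_bundle_to_tangent:
  "analytic_map vanishing_bundle (submanifold_atlas (prod_atlas gr_atlas flat_atlas) vanishing_bundle)
     (gr_tangent :: ('k::{real_inner,banach} set \<times> ('k \<Rightarrow> 'k)) set) gr_tangent_atlas
     (inv_into gr_tangent tangent_to_trivial)"
proof (rule analytic_mapI[where f = bundle_to_tangent])
  fix p :: "'k set \<times> ('k \<Rightarrow>\<^sub>L 'k)" assume p: "p \<in> vanishing_bundle"
  note j = inverse_maps_tangent_to_trivial[where 'k = 'k]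
  show pv: "bundle_to_tangent p \<in> gr_tangent" using inverse_mapsD(3)[OF j p] .
  show "inv_into gr_tangent tangent_to_trivial p = bundle_to_tangent p" using inverse_mapsD(7)[OF j p] .
  define E where "E = fst p"
  have E: "E \<in> grassmannian" using p by (auto simp: vanishing_bundle_def E_def)
  note cE = grassmannian_orthogonal_refl[OF E]
  let ?V = "model E \<times> model E"
  have V: "subspace ?V" using subspace_model[OF E] by (intro subspace_Times)
  note i = vb_chart_in_submanifold_atlas(2)[OF E]
  let ?R = "\<lambda>y. proj (gr_point E (E\<^sup>\<bottom>) (fst y))"
  have G: "complements (gr_point E (E\<^sup>\<bottom>) (fst y)) (E\<^sup>\<bottom>)" if "y \<in> ?V" for y
    using that by (intro complements_gr_point[OF cE]) auto
  have vp: "(gr_point E (E\<^sup>\<bottom>) (fst y), triv_inv E (?R y) (snd y)) \<in> vanishing_bundle" if "y \<in> ?V" for y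
    using inverse_mapsD(3)[OF i that] by (simp add: vb_point_def case_prod_unfold)
  have vp_eq: "vb_point E y = (gr_point E (E\<^sup>\<bottom>) (fst y), triv_inv E (?R y) (snd y))" for y
    by (simp add: vb_point_def case_prod_unfold)
  have S: "{y \<in> ?V. vb_point E y \<in> vanishing_bundle \<and> bundle_to_tangent (vb_point E y) \<in> tangent_chart_dom E} = ?V"
  proof -
    have "bundle_to_tangent (vb_point E y) \<in> tangent_chart_dom E" if y: "y \<in> ?V" for y
      using inverse_mapsD(3)[OF j vp[OF y]] G[OF y]
      by (simp add: tangent_chart_dom_def vp_eq bundle_to_tangent_def)
    then show ?thesis using vp vp_eq by fastforce
  qed
  have "analytic_on_in ?V ?V (\<lambda>y. bundle_coord E (?R y) (triv_inv E (?R y) (snd y)))"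
    unfolding analytic_on_in_def
    by (intro conjI ballI openin_subtopology_self analytic_bundle_coord analytic_triv_inv analytic_intros V
        analytic_tangent_op[OF E] intertwiner_invertible[OF E] G obl_via_proj(1))
  then have an: "analytic_on_in ?V {y \<in> ?V. vb_point E y \<in> vanishing_bundle \<and>
      bundle_to_tangent (vb_point E y) \<in> tangent_chart_dom E} (\<lambda>y. tangent_chart E (bundle_to_tangent (vb_point E y)))"
    unfolding S
    by (rule analytic_on_in_cong[OF _ V refl]) (simp only: vp_eq tangent_chart_bundle[OF E G vp])
  have "p \<in> vb_dom E \<inter> vanishing_bundle"
    using p cE by (simp add: vb_dom_def E_def mem_Times_iff)
  moreover have "bundle_to_tangent p \<in> tangent_chart_dom E"
    using pv cE by (auto simp: tangent_chart_dom_def bundle_to_tangent_def E_def case_prod_unfold)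
  ultimately show "\<exists>U \<phi> V W \<psi> Z k D. (U, \<phi>, V) \<in> submanifold_atlas (prod_atlas gr_atlas flat_atlas) vanishing_bundle \<and>
      (W, \<psi>, Z) \<in> gr_tangent_atlas \<and> p \<in> U \<and> bundle_to_tangent p \<in> W \<and> subspace V \<and> inverse_maps \<phi> k U D \<and>
      analytic_on_in V {y \<in> D. k y \<in> vanishing_bundle \<and> bundle_to_tangent (k y) \<in> W} (\<lambda>y. \<psi> (bundle_to_tangent (k y)))"
    using tangent_chart_in_atlas[OF E] vb_chart_in_submanifold_atlas(1)[OF E] V i an by blast
qed

section \<open>Local trivialisations\<close>

lemma mopen_complements:
  fixes F :: "'k::{real_inner,banach} set"
  assumes F: "F \<in> grassmannian" and E: "complements E F"
  shows "mopen gr_atlas {G. complements G F}"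
  unfolding mopen_def
proof (intro conjI ballI)
  show "{G. complements G F} \<subseteq> \<Union> (fst ` gr_atlas)" using F E unfolding gr_atlas_eq by force
  fix d :: "('k set, 'k \<Rightarrow>\<^sub>L 'k) chart" assume "d \<in> gr_atlas"
  then obtain E1 F1 where F1: "F1 \<in> grassmannian" and E1: "complements E1 F1"
    and d: "d = ({G. complements G F1}, gr_coord E1 F1, gr_model E1 F1)" unfolding gr_atlas_eq by blast
  note V = subspace_gr_model[OF E1]
  have "gr_coord E1 F1 ` ({G. complements G F1} \<inter> {G. complements G F})
    = {A \<in> gr_model E1 F1. op_invertible (proj (gr_point E1 F1 A) - proj F)}"
    unfolding inverse_mapsD(9)[OF inverse_maps_gr_coord[OF E1]]
    using complements_proj_iff[OF complements_grassmannian[OF complements_gr_point[OF E1] F1] F] by auto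
  moreover have "openin (top_of_set (gr_model E1 F1)) \<dots>"
    by (intro openin_op_invertible V openin_subtopology_self analytic_intros analytic_proj_gr_point[OF E1])
  ultimately show "case d of (U, \<phi>, V) \<Rightarrow> openin (top_of_set V) (\<phi> ` (U \<inter> {G. complements G F}))"
    by (simp add: d)
qed

lemma bianalytic_triv:
  fixes E :: "'k::{real_inner,banach} set"
  assumes E: "E \<in> grassmannian"
  defines "U \<equiv> {G. complements G (E\<^sup>\<bottom>)} \<times> (UNIV :: ('k \<Rightarrow>\<^sub>L 'k) set)"
  shows "bianalytic U (prod_atlas gr_atlas flat_atlas) U (prod_atlas gr_atlas flat_atlas)
     (\<lambda>(G, S). (G, triv E (proj G) S))" (is "bianalytic U ?A U ?A ?f")
proof (rule bianalyticI)
  let ?g = "\<lambda>(G, S). (G, triv_inv E (proj G) S)"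
  let ?V = "model E \<times> (UNIV :: ('k \<Rightarrow>\<^sub>L 'k) set)"
  let ?k = "map_prod (gr_point E (E\<^sup>\<bottom>)) id"
  let ?R = "\<lambda>y. proj (gr_point E (E\<^sup>\<bottom>) (fst y))"
  note cE = grassmannian_orthogonal_refl[OF E]
  note ch = prod_flat_chart[OF orthogonal_comp_grassmannian[OF E] cE, folded U_def]
  have i: "inverse_maps (map_prod (gr_coord E (E\<^sup>\<bottom>)) id) ?k U ?V"
    unfolding U_def by (rule inverse_maps_prod_flat[OF cE])
  have V: "subspace ?V" using subspace_model[OF E] by (auto intro!: subspace_Times)
  show fg: "inverse_maps ?f ?g U U"
    using triv_triv_inv[OF E] triv_inv_triv[OF E] by (auto simp: inverse_maps_def U_def)
  \<comment> \<open>The trivialisation and its inverse both send (G, S) to (G, t P_G S) for some t,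
    so one argument covers them; \<open>h'\<close> allows for \<open>inv_into\<close>.\<close>
  have main: "analytic_map U ?A U ?A h'"
    if h: "h = (\<lambda>(G, S). (G, t (proj G) S))" and h': "\<And>p. p \<in> U \<Longrightarrow> h' p = h p"
      and t: "\<And>y. y \<in> ?V \<Longrightarrow> analytic_at_in ?V (\<lambda>y. t (?R y) (snd y)) y"
    for h h' :: "'k set \<times> ('k \<Rightarrow>\<^sub>L 'k) \<Rightarrow> 'k set \<times> ('k \<Rightarrow>\<^sub>L 'k)" and t
  proof (rule analytic_mapI[where f = h])
    fix p assume p: "p \<in> U"
    show hp: "h p \<in> U" using p by (auto simp: h U_def)
    have S: "{y \<in> ?V. ?k y \<in> U \<and> h (?k y) \<in> U} = ?V"
      using complements_gr_point[OF cE] by (auto simp: h U_def)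
    have "analytic_on_in ?V ?V (\<lambda>y. (fst y, t (?R y) (snd y)))"
      unfolding analytic_on_in_def
      by (intro conjI ballI openin_subtopology_self analytic_intros t)
    then have "analytic_on_in ?V {y \<in> ?V. ?k y \<in> U \<and> h (?k y) \<in> U} (\<lambda>y. map_prod (gr_coord E (E\<^sup>\<bottom>)) id (h (?k y)))"
      unfolding S
      by (rule analytic_on_in_cong[OF _ V refl]) (auto simp: h gr_coord_gr_point[OF cE])
    then show "\<exists>U' \<phi> V W \<psi> Z k D. (U', \<phi>, V) \<in> ?A \<and> (W, \<psi>, Z) \<in> ?A \<and> p \<in> U' \<and> h p \<in> W \<and>
       subspace V \<and> inverse_maps \<phi> k U' D \<and> analytic_on_in V {y \<in> D. k y \<in> U \<and> h (k y) \<in> W} (\<lambda>y. \<psi> (h (k y)))"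
      using ch p hp V i by blast
  qed (rule h')
  have inv: "op_invertible (intertwiner E (?R y))" if "y \<in> ?V" for y
    using that by (intro intertwiner_invertible[OF E] complements_gr_point[OF cE]) auto
  show "analytic_map U ?A U ?A ?f"
    by (rule main[of _ "triv E", OF refl refl])
       (intro analytic_triv V inv analytic_proj_gr_point_fst[OF cE] analytic_intros subspace_UNIV)
  show "analytic_map U ?A U ?A (inv_into U ?f)"
    by (rule main[of _ "triv_inv E", OF refl inverse_mapsD(7)[OF fg]])
       (assumption, intro analytic_triv_inv V inv analytic_proj_gr_point_fst[OF cE] analytic_intros subspace_UNIV)
qed

lemma vanishing_bundle_subbundle:
  "trivial_bundle_subbundle grassmannian gr_atlas
     (vanishing_bundle :: ('k::{real_inner,banach} set \<times> ('k \<Rightarrow>\<^sub>L 'k)) set)"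
  unfolding trivial_bundle_subbundle_def
proof (intro conjI ballI)
  show "(vanishing_bundle :: ('k set \<times> ('k \<Rightarrow>\<^sub>L 'k)) set) \<subseteq> grassmannian \<times> UNIV"
    by (auto simp: vanishing_bundle_def)
  fix E :: "'k set" assume E: "E \<in> grassmannian"
  note cE = grassmannian_orthogonal_refl[OF E] and E' = orthogonal_comp_grassmannian[OF E]
  let ?O = "{G. complements G (E\<^sup>\<bottom>)}"
  have "?O \<subseteq> grassmannian" using complements_grassmannian[OF _ E'] by blast
  moreover have "mopen gr_atlas ?O" by (rule mopen_complements[OF E' cE])
  moreover have "banach_model (model E)" using subspace_model[OF E] by (simp add: banach_model_def)
  moreover have "closed_complements_in UNIV (model E) \<noteq> {}"
    using complement_model[OF E] complements_iff[of _ "model E"] by blast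
  moreover have "linear (triv E (proj G))" for G
    unfolding triv_def by (rule linearI) (simp_all add: compose_simps)
  moreover have "triv E (proj G) ` {S. (G, S) \<in> vanishing_bundle} = model E" if G: "complements G (E\<^sup>\<bottom>)" for G
  proof -
    have iff: "(G, S) \<in> vanishing_bundle \<longleftrightarrow> triv E (proj G) S \<in> model E" for S
      using triv_inv_vanishing_iff[OF E G, of "triv E (proj G) S"] by (simp add: triv_inv_triv[OF E G])
    show ?thesis
    proof
      show "model E \<subseteq> triv E (proj G) ` {S. (G, S) \<in> vanishing_bundle}"
      proof
        fix S assume "S \<in> model E"
        then show "S \<in> triv E (proj G) ` {S. (G, S) \<in> vanishing_bundle}"
          using triv_triv_inv[OF E G, of S] iff by (intro image_eqI[of _ _ "triv_inv E (proj G) S"]) auto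
      qed
    qed (use iff in auto)
  qed
  ultimately show "\<exists>O' (\<tau> :: 'k set \<Rightarrow> ('k \<Rightarrow>\<^sub>L 'k) \<Rightarrow> ('k \<Rightarrow>\<^sub>L 'k)) Y. E \<in> O' \<and> O' \<subseteq> grassmannian \<and> mopen gr_atlas O' \<and>
        banach_model Y \<and> closed_complements_in UNIV Y \<noteq> {} \<and>
        bianalytic (O' \<times> UNIV) (prod_atlas gr_atlas flat_atlas) (O' \<times> UNIV) (prod_atlas gr_atlas flat_atlas)
          (\<lambda>(e, s). (e, \<tau> e s)) \<and>
        (\<forall>e\<in>O'. linear (\<tau> e) \<and> \<tau> e ` {s. (e, s) \<in> vanishing_bundle} = Y)"
    using bianalytic_triv[OF E] cE
    by (intro exI[of _ ?O] exI[of _ "\<lambda>G. triv E (proj G)"] exI[of _ "model E"]) simp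
qed

section \<open>Fibrewise properties\<close>

lemma idem_to_tangent_onto:
  fixes E :: "'k::{real_inner,banach} set"
  assumes E: "E \<in> grassmannian" and Q: "Q \<in> idempotents_onto E"
  shows "idem_to_tangent Q = (E, restrict ((id_blinfun - proj E) o\<^sub>L adj Q o\<^sub>L proj E) E)"
  using Q idem_to_tangent_eq(1)[of Q] by (auto simp: idempotents_onto_def bundle_to_tangent_def)

text \<open>The bijection of (a) has base component \<open>range Q\<close>, so it matches fibres
  with fibres.\<close>

lemma image_idempotents_onto:
  fixes E :: "'k::{real_inner,banach} set"
  assumes E: "E \<in> grassmannian"
  shows "idem_to_tangent ` idempotents_onto E = {E} \<times> bops E (E\<^sup>\<bottom>)"
proof -
  note i = inverse_maps_idem_to_tangent[where 'k = 'k]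
  have fst: "fst (idem_to_tangent Q) = range Q" for Q :: "'k \<Rightarrow>\<^sub>L 'k"
    by (simp add: idem_to_tangent_def Let_def)
  have "idempotents_onto E = idempotents \<inter> {Q. fst (idem_to_tangent Q) = E}"
    by (auto simp: idempotents_onto_def fst)
  also have "idem_to_tangent ` \<dots> = {p \<in> gr_tangent. fst (idem_to_tangent (tangent_to_idem p)) = E}"
    using inverse_mapsD(9)[OF i] by simp
  also have "\<dots> = {p \<in> gr_tangent. fst p = E}" using inverse_mapsD(4)[OF i] by auto
  also have "\<dots> = {E} \<times> bops E (E\<^sup>\<bottom>)" using E by (auto simp: gr_tangent_def)
  finally show ?thesis .
qed

lemma affine_idempotents_onto:
  fixes E :: "'k::{real_inner,banach} set"
  assumes E: "E \<in> grassmannian"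
  shows "affine (idempotents_onto E)"
  unfolding affine_def
  by (auto simp: idempotents_onto_iff[OF E] compose_simps simp flip: scaleR_add_left)

text \<open>For fixed \<open>E\<close> the expression (I - P_E) \<open>adj Q\<close> P_E is linear
  in \<open>Q\<close>; the condition \<open>a + b = 1\<close> keeps the combination in the fibre,
  where this expression describes the map.\<close>

lemma idem_to_tangent_affine:
  fixes E :: "'k::{real_inner,banach} set"
  assumes E: "E \<in> grassmannian" and Q: "Q \<in> idempotents_onto E" and R: "R \<in> idempotents_onto E"
    and ab: "a + b = 1"
  shows "snd (idem_to_tangent (a *\<^sub>R Q + b *\<^sub>R R)) =
     bops_comb E a (snd (idem_to_tangent Q)) b (snd (idem_to_tangent R))"
proof -
  have "a *\<^sub>R Q + b *\<^sub>R R \<in> idempotents_onto E"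
    using affine_idempotents_onto[OF E] Q R ab unfolding affine_def by blast
  then show ?thesis
    by (auto simp: idem_to_tangent_onto[OF E] Q R bops_comb_def adj_add adj_scaleR compose_simps
        blinfun.add_left blinfun.scaleR_left intro!: restrict_ext)
qed

text \<open>On the fibre over \<open>E\<close>, \<open>comp_proj E\<close> is inverse to restriction
  to \<open>E\<close>, which is linear.\<close>

lemma comp_proj_bops_comb:
  fixes E :: "'k::{real_inner,banach} set"
  assumes E: "E \<in> grassmannian" and S: "S \<in> bops E (E\<^sup>\<bottom>)" and T: "T \<in> bops E (E\<^sup>\<bottom>)"
  shows "comp_proj E (bops_comb E a S b T) = a *\<^sub>R comp_proj E S + b *\<^sub>R comp_proj E T"
proof -
  let ?A = "comp_proj E S" and ?B = "comp_proj E T"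
  have "(E, S) \<in> gr_tangent" "(E, T) \<in> gr_tangent" using E S T by (auto simp: gr_tangent_iff)
  note * = tangent_to_bundle[OF this(1)] tangent_to_bundle[OF this(2)]
  have "(E, a *\<^sub>R ?A + b *\<^sub>R ?B) \<in> vanishing_bundle"
    using *(1,3) by (simp add: vanishing_bundle_iff compose_simps)
  from bundle_to_tangent(2)[OF this]
  have "comp_proj E (restrict (a *\<^sub>R ?A + b *\<^sub>R ?B) E) = a *\<^sub>R ?A + b *\<^sub>R ?B" .
  moreover have "restrict (a *\<^sub>R ?A + b *\<^sub>R ?B) E = bops_comb E a S b T"
    unfolding bops_comb_def
    by (subst *(2)[symmetric], subst *(4)[symmetric])
       (auto intro!: restrict_ext simp: blinfun.add_left blinfun.scaleR_left)
  ultimately show ?thesis by simp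
qed

theorem theorem2:
  assumes "\<exists>B :: 'k::{real_inner,banach} set. finite B \<and> independent B \<and> card B > 1"
  shows
    "bianalytic
       (idempotents :: ('k \<Rightarrow>\<^sub>L 'k) set) (submanifold_atlas flat_atlas idempotents)
       gr_tangent gr_tangent_atlas
       idem_to_tangent
     \<and> (\<forall>E \<in> (grassmannian :: 'k set set).
          idem_to_tangent ` idempotents_onto E = {E} \<times> bops E (E\<^sup>\<bottom>) \<and>
          affine (idempotents_onto E) \<and>
          (\<forall>Q \<in> idempotents_onto E. \<forall>R \<in> idempotents_onto E. \<forall>a b. a + b = 1 \<longrightarrow>
             snd (idem_to_tangent (a *\<^sub>R Q + b *\<^sub>R R)) =
               bops_comb E a (snd (idem_to_tangent Q)) b (snd (idem_to_tangent R))))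
     \<and> trivial_bundle_subbundle grassmannian gr_atlas (vanishing_bundle :: ('k set \<times> ('k \<Rightarrow>\<^sub>L 'k)) set)
     \<and> bianalytic
         gr_tangent gr_tangent_atlas
         (vanishing_bundle :: ('k set \<times> ('k \<Rightarrow>\<^sub>L 'k)) set)
         (submanifold_atlas (prod_atlas gr_atlas flat_atlas) vanishing_bundle)
         tangent_to_trivial
     \<and> (\<forall>E \<in> (grassmannian :: 'k set set).
          (\<forall>T \<in> bops E (E\<^sup>\<bottom>). fst (tangent_to_trivial (E, T)) = E) \<and>
          (\<forall>S \<in> bops E (E\<^sup>\<bottom>). \<forall>T \<in> bops E (E\<^sup>\<bottom>). \<forall>a b.
             snd (tangent_to_trivial (E, bops_comb E a S b T)) =
               a *\<^sub>R snd (tangent_to_trivial (E, S)) + b *\<^sub>R snd (tangent_to_trivial (E, T))))"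
proof (intro conjI)
  show "bianalytic (idempotents :: ('k \<Rightarrow>\<^sub>L 'k) set) (submanifold_atlas flat_atlas idempotents)
       gr_tangent gr_tangent_atlas idem_to_tangent"
    by (rule bianalyticI[OF inverse_maps_idem_to_tangent analytic_map_idem_to_tangent
          analytic_map_tangent_to_idem])
  show "bianalytic gr_tangent gr_tangent_atlas (vanishing_bundle :: ('k set \<times> ('k \<Rightarrow>\<^sub>L 'k)) set)
         (submanifold_atlas (prod_atlas gr_atlas flat_atlas) vanishing_bundle) tangent_to_trivial"
    by (rule bianalyticI[OF inverse_maps_tangent_to_trivial analytic_map_tangent_to_trivial
          analytic_map_bundle_to_tangent])
qed (auto simp: image_idempotents_onto affine_idempotents_onto idem_to_tangent_affine
    vanishing_bundle_subbundle tangent_to_trivial_def comp_proj_bops_comb)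

end
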